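(* Let $H$ be a shuffle-like Hopf algebra with basis $(b_w)$. Let $\equiv$ be a congruence on the free monoid $A^*$ such that: (1) two words are equivalent if and only if they have the same evaluation and their packed words are equivalent; (2) for all words $u,v$ and every interval $I$ of $A$, $u\equiv v$ implies $u|_I\equiv v|_I$. Then the elements $$P_u=\sum_{w\equiv u} b_w$$ span a Hopf subalgebra $B$ of $H$. Moreover, the dual Hopf algebra $B^*$ can be identified with the quotient of $H^*$ by the relations $b^*_w=b^*_{w'}$ if and only if $w\equiv w'$, where $(b_w^* )$ is the dual basis of $(b_w)$.
   Context: $A=\{1<2<3<\cdots\}$ is the alphabet of positive integers, $A^*$ the free monoid on $A$; all algebras are over a field $\mathbb{K}$ of characteristic $0$, and duals of graded Hopf algebras are graded duals. A congruence is an equivalence relation on $A^*$ compatible with concatenation on both sides. The evaluation $\mathrm{ev}(w)$ is the sequence whose $i$-th term is the number of occurrences of $i$ in $w$. If $b_1<\cdots<b_r$ are the letters occurring in $w$, the packed word $\mathrm{pack}(w)$ is the image of $w$ under $b_i\mapsto i$. For an interval $I$ of $A$, $w|_I$ is the word obtained from $w$ by erasing the letters not in $I$. For a word $w$, $w[k]$ is obtained by replacing each letter $i$ by $i+k$. The shifted shuffle is $u\Cup v=u\sqcup\!\sqcup\, (v[k])$, with $k$ the length of $u$ and $\sqcup\!\sqcup$ the usual shuffle product (a sum of words). Permutations $\sigma\in\mathfrak{S}_n$ act on words of length $n$ on the right by permuting positions: $(w\cdot\sigma)_i=w_{\sigma(i)}$. A shuffle-like Hopf algebra is a graded connected Hopf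 algebra $H$ with a basis $b_w$ indexed by some class of words over $A$ such that the product in this basis is given by the shifted shuffle, $b_ub_v=\sum_{w\in u\Cup v}b_w$, and the coproduct is of the form $$\Delta b_w=\sum_{w=w_1\cdot w_2} b_{a(w_1)}\otimes b_{a(w_2)}$$ (where $\cdot$ is concatenation), where $a$ is an algorithm (a map on words) such that $a(u\cdot\sigma)=a(u)\cdot\sigma$ for any permutation $\sigma$ and such that $\mathrm{pack}(a(v))=\mathrm{pack}(v)$. In the definition of $P_u$, $u$ and $w$ are words indexing the basis.
   Formalization: The class of words indexing the basis is additionally assumed to be stable under permuting positions (implicit in a(u·σ)=a(u)·σ for index words); without this, the elements P_u need not span a subalgebra. The degree of b_w is taken to be the length of w. *)

theory Defs
  imports
    "HOL-Algebra.Module"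
    "HOL-Algebra.QuotRing"
    "HOL-Combinatorics.Permutations"
    "HOL-Library.Multiset"
begin

section \<open>Words over the positive integers\<close>

type_synonym word = "nat list"

definition words :: "word set" where
  "words = lists {1..}"

definition ev :: "word \<Rightarrow> nat \<Rightarrow> nat" where
  "ev w i = count_list w i"

text \<open>If \<open>b\<^sub>1 < \<dots> < b\<^sub>r\<close> are the letters of \<open>w\<close>, then \<open>i\<close> is the number of letters
  of \<open>w\<close> that are at most \<open>b\<^sub>i\<close>.\<close>
definition pack :: "word \<Rightarrow> word" where
  "pack w = map (\<lambda>x. card {y \<in> set w. y \<le> x}) w"

definition interval :: "nat set \<Rightarrow> bool" where
  "interval I \<longleftrightarrow> I \<subseteq> {1..} \<and> (\<forall>x\<in>I. \<forall>y\<in>I. {x..y} \<subseteq> I)"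

definition restr_word :: "word \<Rightarrow> nat set \<Rightarrow> word" where
  "restr_word w I = filter (\<lambda>x. x \<in> I) w"

definition shift :: "nat \<Rightarrow> word \<Rightarrow> word" where
  "shift k w = map (\<lambda>i. i + k) w"

text \<open>The shuffle product is a sum of words with multiplicities, hence a multiset; the library's
  set \<^const>\<open>shuffles\<close> forgets the multiplicities.\<close>
fun shuffle :: "word \<Rightarrow> word \<Rightarrow> word multiset" where
  "shuffle [] v = {#v#}"
| "shuffle u [] = {#u#}"
| "shuffle (x # u) (y # v) =
     image_mset ((#) x) (shuffle u (y # v)) + image_mset ((#) y) (shuffle (x # u) v)"

definition shifted_shuffle :: "word \<Rightarrow> word \<Rightarrow> word multiset" where
  "shifted_shuffle u v = shuffle u (shift (length u) v)"

definition congruence :: "(word \<times> word) set \<Rightarrow> bool" where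
  "congruence E \<longleftrightarrow> equiv words E \<and>
     (\<forall>(u, v) \<in> E. \<forall>x\<in>words. \<forall>y\<in>words. (x @ u @ y, x @ v @ y) \<in> E)"


section \<open>Vector spaces and tensor squares\<close>

text \<open>The ground field is the type \<open>'k\<close>, here as a record, so that vector spaces are modules in the
  sense of HOL-Algebra.\<close>
definition scalars :: "'k::field ring" where
  "scalars = \<lparr>carrier = UNIV, monoid.mult = (*), one = 1, zero = 0, add = (+)\<rparr>"

abbreviation vsubspace :: "'v set \<Rightarrow> ('k::field, 'v, 'm) module_scheme \<Rightarrow> bool" where
  "vsubspace W V \<equiv> submodule W (scalars :: 'k ring) V"

definition vspan :: "('k::field, 'v, 'm) module_scheme \<Rightarrow> 'v set \<Rightarrow> 'v set" where
  "vspan V S = \<Inter>{W. vsubspace W V \<and> S \<subseteq> W}"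

definition vbasis :: "('k::field, 'v, 'm) module_scheme \<Rightarrow> 'i set \<Rightarrow> ('i \<Rightarrow> 'v) \<Rightarrow> bool" where
  "vbasis V I b \<longleftrightarrow> b \<in> I \<rightarrow> carrier V \<and>
     (\<forall>x \<in> carrier V. \<exists>!c. finite {i. c i \<noteq> 0} \<and> {i. c i \<noteq> 0} \<subseteq> I \<and>
        x = (\<Oplus>\<^bsub>V\<^esub>i\<in>{i. c i \<noteq> 0}. c i \<odot>\<^bsub>V\<^esub> b i))"

definition linear_form :: "('k::field, 'v, 'm) module_scheme \<Rightarrow> ('v \<Rightarrow> 'k) \<Rightarrow> bool" where
  "linear_form V f \<longleftrightarrow>
     (\<forall>x \<in> carrier V. \<forall>y \<in> carrier V. f (x \<oplus>\<^bsub>V\<^esub> y) = f x + f y) \<and>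
     (\<forall>c. \<forall>x \<in> carrier V. f (c \<odot>\<^bsub>V\<^esub> x) = c * f x)"

definition bilinear_form ::
    "('k::field, 'v, 'm) module_scheme \<Rightarrow> ('v \<Rightarrow> 'v \<Rightarrow> 'k) \<Rightarrow> bool" where
  "bilinear_form V \<beta> \<longleftrightarrow>
     (\<forall>x \<in> carrier V. linear_form V (\<lambda>y. \<beta> x y)) \<and>
     (\<forall>y \<in> carrier V. linear_form V (\<lambda>x. \<beta> x y))"

definition trilinear_form ::
    "('k::field, 'v, 'm) module_scheme \<Rightarrow> ('v \<Rightarrow> 'v \<Rightarrow> 'v \<Rightarrow> 'k) \<Rightarrow> bool" where
  "trilinear_form V \<gamma> \<longleftrightarrow>
     (\<forall>x \<in> carrier V. bilinear_form V (\<lambda>y z. \<gamma> x y z)) \<and>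
     (\<forall>y \<in> carrier V. bilinear_form V (\<lambda>x z. \<gamma> x y z)) \<and>
     (\<forall>z \<in> carrier V. bilinear_form V (\<lambda>x y. \<gamma> x y z))"

text \<open>Over a field, \<open>V \<otimes> V\<close> is the space of functionals on the bilinear forms on \<open>V\<close> spanned by the
  pure tensors \<open>x \<otimes> y = (\<lambda>\<beta>. \<beta> x y)\<close>. Thus \<open>t \<beta>\<close> is the value at \<open>t\<close> of the linear form on
  \<open>V \<otimes> V\<close> induced by \<open>\<beta>\<close>, and two functionals denote the same tensor if they agree on all bilinear
  forms; their values at other functions are irrelevant. Scalars are absorbed into the factors.

  \<open>tensors V T\<close> consists of the finite sums of pure tensors \<open>x \<otimes> y\<close> with \<open>(x, y) \<in> T\<close>; in particular
  \<open>tensors V (carrier V \<times> carrier V)\<close> is \<open>V \<otimes> V\<close>, and for a subspace \<open>W\<close> of \<open>V\<close>,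
  \<open>tensors V (W \<times> W)\<close> is \<open>W \<otimes> W\<close> inside \<open>V \<otimes> V\<close>.\<close>
definition tensors ::
    "('k::field, 'v, 'm) module_scheme \<Rightarrow> ('v \<times> 'v) set \<Rightarrow> (('v \<Rightarrow> 'v \<Rightarrow> 'k) \<Rightarrow> 'k) set" where
  "tensors V T = {t. \<exists>ps. set ps \<subseteq> T \<and>
     (\<forall>\<beta>. bilinear_form V \<beta> \<longrightarrow> t \<beta> = (\<Sum>(x, y)\<leftarrow>ps. \<beta> x y))}"


section \<open>Hopf algebras\<close>

record ('k, 'v) hopf = "('k, 'v) module" +
  comult :: "'v \<Rightarrow> ('v \<Rightarrow> 'v \<Rightarrow> 'k) \<Rightarrow> 'k"
  counit :: "'v \<Rightarrow> 'k"
  antipode :: "'v \<Rightarrow> 'v"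

text \<open>If \<open>\<Delta> x = \<Sum> x\<^sub>1 \<otimes> x\<^sub>2\<close>, then \<open>comult H x (\<lambda>y z. \<beta> y z)\<close> is \<open>\<Sum> \<beta> x\<^sub>1 x\<^sub>2\<close>. Identities in
  \<open>H\<close>, \<open>H \<otimes> H\<close> and \<open>H \<otimes> H \<otimes> H\<close> that involve \<open>\<Delta>\<close> are tested on all linear, bilinear and
  trilinear forms respectively.\<close>
locale hopf_algebra = ring H + module "scalars :: 'k ring" H
  for H :: "('k::field, 'v) hopf" (structure) +
  assumes smult_mult_left:
      "\<lbrakk>x \<in> carrier H; y \<in> carrier H\<rbrakk> \<Longrightarrow> (c \<odot>\<^bsub>H\<^esub> x) \<otimes>\<^bsub>H\<^esub> y = c \<odot>\<^bsub>H\<^esub> (x \<otimes>\<^bsub>H\<^esub> y)"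
    and smult_mult_right:
      "\<lbrakk>x \<in> carrier H; y \<in> carrier H\<rbrakk> \<Longrightarrow> x \<otimes>\<^bsub>H\<^esub> (c \<odot>\<^bsub>H\<^esub> y) = c \<odot>\<^bsub>H\<^esub> (x \<otimes>\<^bsub>H\<^esub> y)"
    and comult_closed:
      "x \<in> carrier H \<Longrightarrow> comult H x \<in> tensors H (carrier H \<times> carrier H)"
    and comult_add:
      "\<lbrakk>x \<in> carrier H; y \<in> carrier H; bilinear_form H \<beta>\<rbrakk> \<Longrightarrow>
        comult H (x \<oplus>\<^bsub>H\<^esub> y) \<beta> = comult H x \<beta> + comult H y \<beta>"
    and comult_smult:
      "\<lbrakk>x \<in> carrier H; bilinear_form H \<beta>\<rbrakk> \<Longrightarrow> comult H (c \<odot>\<^bsub>H\<^esub> x) \<beta> = c * comult H x \<beta>"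
    and coassoc:
      "\<lbrakk>x \<in> carrier H; trilinear_form H \<gamma>\<rbrakk> \<Longrightarrow>
        comult H x (\<lambda>y z. comult H y (\<lambda>y\<^sub>1 y\<^sub>2. \<gamma> y\<^sub>1 y\<^sub>2 z)) =
        comult H x (\<lambda>y z. comult H z (\<lambda>z\<^sub>1 z\<^sub>2. \<gamma> y z\<^sub>1 z\<^sub>2))"
    and counit_linear: "linear_form H (counit H)"
    and counit_left:
      "\<lbrakk>x \<in> carrier H; linear_form H f\<rbrakk> \<Longrightarrow> comult H x (\<lambda>y z. counit H y * f z) = f x"
    and counit_right:
      "\<lbrakk>x \<in> carrier H; linear_form H f\<rbrakk> \<Longrightarrow> comult H x (\<lambda>y z. f y * counit H z) = f x"
    and comult_one:
      "bilinear_form H \<beta> \<Longrightarrow> comult H \<one>\<^bsub>H\<^esub> \<beta> = \<beta> \<one>\<^bsub>H\<^esub> \<one>\<^bsub>H\<^esub>"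
    and comult_mult:
      "\<lbrakk>x \<in> carrier H; y \<in> carrier H; bilinear_form H \<beta>\<rbrakk> \<Longrightarrow>
        comult H (x \<otimes>\<^bsub>H\<^esub> y) \<beta> =
        comult H x (\<lambda>x\<^sub>1 x\<^sub>2. comult H y (\<lambda>y\<^sub>1 y\<^sub>2. \<beta> (x\<^sub>1 \<otimes>\<^bsub>H\<^esub> y\<^sub>1) (x\<^sub>2 \<otimes>\<^bsub>H\<^esub> y\<^sub>2)))"
    and counit_one: "counit H \<one>\<^bsub>H\<^esub> = 1"
    and counit_mult:
      "\<lbrakk>x \<in> carrier H; y \<in> carrier H\<rbrakk> \<Longrightarrow> counit H (x \<otimes>\<^bsub>H\<^esub> y) = counit H x * counit H y"
    and antipode_closed: "x \<in> carrier H \<Longrightarrow> antipode H x \<in> carrier H"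
    and antipode_add:
      "\<lbrakk>x \<in> carrier H; y \<in> carrier H\<rbrakk> \<Longrightarrow>
        antipode H (x \<oplus>\<^bsub>H\<^esub> y) = antipode H x \<oplus>\<^bsub>H\<^esub> antipode H y"
    and antipode_smult:
      "x \<in> carrier H \<Longrightarrow> antipode H (c \<odot>\<^bsub>H\<^esub> x) = c \<odot>\<^bsub>H\<^esub> antipode H x"
    and antipode_left:
      "\<lbrakk>x \<in> carrier H; linear_form H f\<rbrakk> \<Longrightarrow>
        comult H x (\<lambda>y z. f (antipode H y \<otimes>\<^bsub>H\<^esub> z)) = counit H x * f \<one>\<^bsub>H\<^esub>"
    and antipode_right:
      "\<lbrakk>x \<in> carrier H; linear_form H f\<rbrakk> \<Longrightarrow>
        comult H x (\<lambda>y z. f (y \<otimes>\<^bsub>H\<^esub> antipode H z)) = counit H x * f \<one>\<^bsub>H\<^esub>"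

locale graded_connected_hopf_algebra = hopf_algebra H
  for H :: "('k::field, 'v) hopf" (structure) +
  fixes gr :: "nat \<Rightarrow> 'v set"
  assumes gr_subspace: "vsubspace (gr n) H"
    and gr_decomp:
      "x \<in> carrier H \<Longrightarrow> \<exists>N h. (\<forall>n. h n \<in> gr n) \<and> x = (\<Oplus>\<^bsub>H\<^esub>n\<in>{..N::nat}. h n)"
    and gr_indep:
      "\<lbrakk>\<forall>n. h n \<in> gr n; (\<Oplus>\<^bsub>H\<^esub>n\<in>{..N::nat}. h n) = \<zero>\<^bsub>H\<^esub>; m \<le> N\<rbrakk> \<Longrightarrow> h m = \<zero>\<^bsub>H\<^esub>"
    and gr_mult: "\<lbrakk>x \<in> gr m; y \<in> gr n\<rbrakk> \<Longrightarrow> x \<otimes>\<^bsub>H\<^esub> y \<in> gr (m + n)"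
    and gr_comult: "x \<in> gr n \<Longrightarrow> comult H x \<in> tensors H (\<Union>i\<le>n. gr i \<times> gr (n - i))"
    and gr_counit: "\<lbrakk>x \<in> gr n; n > 0\<rbrakk> \<Longrightarrow> counit H x = 0"
    and gr_antipode: "x \<in> gr n \<Longrightarrow> antipode H x \<in> gr n"
    and connected: "gr 0 = {c \<odot>\<^bsub>H\<^esub> \<one>\<^bsub>H\<^esub> | c. True}"

definition hopf_subalgebra :: "('k::field, 'v) hopf \<Rightarrow> 'v set \<Rightarrow> bool" where
  "hopf_subalgebra H B \<longleftrightarrow> vsubspace B H \<and> \<one>\<^bsub>H\<^esub> \<in> B \<and>
     (\<forall>x\<in>B. \<forall>y\<in>B. x \<otimes>\<^bsub>H\<^esub> y \<in> B) \<and>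
     (\<forall>x\<in>B. comult H x \<in> tensors H (B \<times> B)) \<and>
     (\<forall>x\<in>B. antipode H x \<in> B)"

text \<open>The coproduct of \<open>x\<close> in \<open>B\<close> is the element of \<open>B \<otimes> B\<close> that the inclusion \<open>B \<otimes> B \<subseteq> H \<otimes> H\<close>
  maps to the coproduct of \<open>x\<close> in \<open>H\<close>.\<close>
definition sub_hopf :: "('k::field, 'v) hopf \<Rightarrow> 'v set \<Rightarrow> ('k, 'v) hopf" where
  "sub_hopf H B = H\<lparr>carrier := B,
     comult := (\<lambda>x. SOME t. t \<in> tensors (H\<lparr>carrier := B\<rparr>) (B \<times> B) \<and>
                            (\<forall>\<beta>. bilinear_form H \<beta> \<longrightarrow> t \<beta> = comult H x \<beta>))\<rparr>"

definition hopf_iso ::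
    "('k::field, 'v) hopf \<Rightarrow> ('k, 'w) hopf \<Rightarrow> ('v \<Rightarrow> 'w) \<Rightarrow> bool" where
  "hopf_iso G H \<phi> \<longleftrightarrow> hopf_algebra G \<and> hopf_algebra H \<and> \<phi> \<in> ring_iso G H \<and>
     (\<forall>c. \<forall>x \<in> carrier G. \<phi> (c \<odot>\<^bsub>G\<^esub> x) = c \<odot>\<^bsub>H\<^esub> \<phi> x) \<and>
     (\<forall>x \<in> carrier G. \<forall>\<beta>. bilinear_form H \<beta> \<longrightarrow>
        comult H (\<phi> x) \<beta> = comult G x (\<lambda>y z. \<beta> (\<phi> y) (\<phi> z))) \<and>
     (\<forall>x \<in> carrier G. counit H (\<phi> x) = counit G x) \<and>
     (\<forall>x \<in> carrier G. \<phi> (antipode G x) = antipode H (\<phi> x))"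


section \<open>Graded duals and quotients\<close>

text \<open>Functions on a subset \<open>B\<close> of a type are extended by 0 outside \<open>B\<close>.\<close>
definition restr_form :: "'v set \<Rightarrow> ('v \<Rightarrow> 'k::zero) \<Rightarrow> 'v \<Rightarrow> 'k" where
  "restr_form B f = (\<lambda>x. if x \<in> B then f x else 0)"

text \<open>The graded dual consists of the linear forms that vanish on almost all homogeneous
  components; the product is dual to the coproduct of \<open>H\<close>.\<close>
definition graded_dual_algebra ::
    "('k::field, 'v) hopf \<Rightarrow> (nat \<Rightarrow> 'v set) \<Rightarrow> ('k, 'v \<Rightarrow> 'k) module" where
  "graded_dual_algebra H gr =
     \<lparr>carrier = {f. linear_form H f \<and> (\<forall>x. x \<notin> carrier H \<longrightarrow> f x = 0) \<and>
                    (\<exists>N. \<forall>n>N. \<forall>x \<in> gr n. f x = 0)},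
      monoid.mult = (\<lambda>f g. restr_form (carrier H) (\<lambda>x. comult H x (\<lambda>y z. f y * g z))),
      one = restr_form (carrier H) (counit H),
      zero = (\<lambda>x. 0),
      add = (\<lambda>f g x. f x + g x),
      smult = (\<lambda>c f x. c * f x)\<rparr>"

text \<open>The coproduct of \<open>f\<close> in the graded dual \<open>D\<close> is the element \<open>t\<close> of \<open>D \<otimes> D\<close> with
  \<open>\<langle>t, x \<otimes> y\<rangle> = f (x y)\<close> for all \<open>x\<close> and \<open>y\<close>, where \<open>\<langle>g \<otimes> h, x \<otimes> y\<rangle> = g x * h y\<close>.\<close>
definition graded_dual ::
    "('k::field, 'v) hopf \<Rightarrow> (nat \<Rightarrow> 'v set) \<Rightarrow> ('k, 'v \<Rightarrow> 'k) hopf" where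
  "graded_dual H gr = (let D = graded_dual_algebra H gr in
     \<lparr>carrier = carrier D, monoid.mult = monoid.mult D, one = one D, zero = zero D, add = add D, smult = smult D,
      comult = (\<lambda>f. SOME t. t \<in> tensors D (carrier D \<times> carrier D) \<and>
         (\<forall>x \<in> carrier H. \<forall>y \<in> carrier H. t (\<lambda>g h. g x * h y) = f (x \<otimes>\<^bsub>H\<^esub> y))),
      counit = (\<lambda>f. f \<one>\<^bsub>H\<^esub>),
      antipode = (\<lambda>f. restr_form (carrier H) (\<lambda>x. f (antipode H x)))\<rparr>)"

definition dual_basis :: "('k::field, 'v) hopf \<Rightarrow> 'i set \<Rightarrow> ('i \<Rightarrow> 'v) \<Rightarrow> 'i \<Rightarrow> 'v \<Rightarrow> 'k" where
  "dual_basis H I b i = (THE f. linear_form H f \<and> (\<forall>x. x \<notin> carrier H \<longrightarrow> f x = 0) \<and>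
     (\<forall>j\<in>I. f (b j) = (if j = i then 1 else 0)))"

text \<open>The underlying ring is the quotient \<^term>\<open>D Quot J\<close> of HOL-Algebra, whose elements are the
  cosets \<^term>\<open>J +>\<^bsub>D\<^esub> x\<close>; the other operations are induced by those of \<open>D\<close> on representatives.\<close>
definition quot_hopf :: "('k::field, 'v) hopf \<Rightarrow> 'v set \<Rightarrow> ('k, 'v set) hopf" where
  "quot_hopf D J =
     \<lparr>carrier = carrier (D Quot J), monoid.mult = monoid.mult (D Quot J), one = one (D Quot J),
      zero = zero (D Quot J), add = add (D Quot J),
      smult = (\<lambda>c U. J +>\<^bsub>D\<^esub> (c \<odot>\<^bsub>D\<^esub> (SOME x. x \<in> U))),
      comult = (\<lambda>U \<beta>. comult D (SOME x. x \<in> U) (\<lambda>y z. \<beta> (J +>\<^bsub>D\<^esub> y) (J +>\<^bsub>D\<^esub> z))),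
      counit = (\<lambda>U. counit D (SOME x. x \<in> U)),
      antipode = (\<lambda>U. J +>\<^bsub>D\<^esub> antipode D (SOME x. x \<in> U))\<rparr>"


section \<open>Shuffle-like Hopf algebras\<close>

text \<open>\<open>C\<close> is the class of words that indexes the basis, and the degree of \<^term>\<open>b w\<close> is the length
  of \<open>w\<close>. The right action of a permutation of positions is \<^const>\<open>permute_list\<close>.

  Assumption \<open>index_permute\<close> is implicit in reading \<open>a(u\<cdot>\<sigma>) = a(u)\<cdot>\<sigma>\<close> as an identity between
  index words: the counit axiom forces \<open>a(u) = u\<close> for index words \<open>u\<close>, so the identity becomes
  \<open>a(u\<cdot>\<sigma>) = u\<cdot>\<sigma>\<close>. It cannot be dropped: in the Hopf algebra of parking functions, with \<open>a\<close> the
  parkization, the iterated shifted shuffles of 1, 11, 211 and 1142 are the basis of a Hopf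
  subalgebra \<open>K\<close>, but the sums over the rearrangement classes in \<open>K\<close> do not span a subalgebra (the
  product of the sums of 211 and of 1 contains 2114 but not 1142). On the other hand \<open>a\<close> need not
  map words that are not factors of index words into \<open>C\<close>: for permutations, \<open>a = pack\<close>.\<close>
locale shuffle_like_hopf_algebra = graded_connected_hopf_algebra H gr
  for H :: "('k::field, 'v) hopf" (structure) and gr +
  fixes C :: "word set" and b :: "word \<Rightarrow> 'v" and a :: "word \<Rightarrow> word"
  assumes index_words: "C \<subseteq> words"
    and basis: "vbasis H C b"
    and basis_degree: "w \<in> C \<Longrightarrow> b w \<in> gr (length w)"
    and alg_words: "u \<in> words \<Longrightarrow> a u \<in> words"
    and alg_permute:
      "\<lbrakk>u \<in> words; \<sigma> permutes {..<length u}\<rbrakk> \<Longrightarrow> a (permute_list \<sigma> u) = permute_list \<sigma> (a u)"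
    and alg_pack: "v \<in> words \<Longrightarrow> pack (a v) = pack v"
    and index_permute: "\<lbrakk>u \<in> C; \<sigma> permutes {..<length u}\<rbrakk> \<Longrightarrow> permute_list \<sigma> u \<in> C"
    and index_shuffle: "\<lbrakk>u \<in> C; v \<in> C; w \<in># shifted_shuffle u v\<rbrakk> \<Longrightarrow> w \<in> C"
    and mult_basis:
      "\<lbrakk>u \<in> C; v \<in> C\<rbrakk> \<Longrightarrow> b u \<otimes>\<^bsub>H\<^esub> b v =
        (\<Oplus>\<^bsub>H\<^esub>w\<in>set_mset (shifted_shuffle u v). of_nat (count (shifted_shuffle u v) w) \<odot>\<^bsub>H\<^esub> b w)"
    and index_alg: "w\<^sub>1 @ w\<^sub>2 \<in> C \<Longrightarrow> a w\<^sub>1 \<in> C \<and> a w\<^sub>2 \<in> C"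
    and comult_basis:
      "\<lbrakk>w \<in> C; bilinear_form H \<beta>\<rbrakk> \<Longrightarrow>
        comult H (b w) \<beta> = (\<Sum>i\<le>length w. \<beta> (b (a (take i w))) (b (a (drop i w))))"

definition class_sum ::
    "('k, 'v) hopf \<Rightarrow> word set \<Rightarrow> (word \<Rightarrow> 'v) \<Rightarrow> (word \<times> word) set \<Rightarrow> word \<Rightarrow> 'v" where
  "class_sum H C b E u = (\<Oplus>\<^bsub>H\<^esub>w\<in>{w \<in> C. (w, u) \<in> E}. b w)"

end

theory Submission
  imports Defs
begin

text \<open>The span \<open>B\<close> of the class sums consists of the elements of \<open>H\<close> whose coordinates in the basis \<open>b\<close>
  are constant on the classes of the congruence. Choosing a representative in every class gives a
  graded projection of \<open>H\<close> onto \<open>B\<close>.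

  Product: comparing the two sides of \<open>\<Delta>(b\<^sub>u b\<^sub>v) = \<Delta>(b\<^sub>u) \<Delta>(b\<^sub>v)\<close> shows that the letters of an index word
  of length \<open>n\<close> lie in a window of length \<open>n\<close> that begins at the least letter of all index words. So a
  word in the shifted shuffle of \<open>u\<close> and \<open>v\<close> determines \<open>u\<close> and \<open>v\<close> by restriction to two complementary
  intervals, and condition (2) applies. Coproduct: \<open>a\<close> commutes with permutations and preserves packed
  words, so by condition (1) the coordinates of \<open>\<Delta>(x)\<close> with \<open>x\<close> in \<open>B\<close> are constant on classes in both
  tensor factors. Hence applying the projection to both factors does not change \<open>\<Delta>(x)\<close>.

  Duality: forms on \<open>B\<close> extend along the projection, so restriction to \<open>B\<close> maps the graded dual of \<open>H\<close>
  onto that of \<open>B\<close>, and it preserves all operations. Its kernel is spanned by the differences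
  \<open>b\<^sub>w\<^sup>* - b\<^sub>w\<^sub>'\<^sup>*\<close> of equivalent words. The image of a Hopf algebra under a surjection that preserves all
  operations is a Hopf algebra; this applies to the dual of \<open>B\<close> and to the quotient alike.\<close>

section \<open>Vector spaces with a basis\<close>

text \<open>The definition of a shuffle-like Hopf algebra does not bound the letters of an index
  word by its length. If \<open>u\<close> and the shifted \<open>v\<close> shared a letter, a word
  could occur in their shuffle several times, and no restriction to an interval would recover
  \<open>u\<close>. Nor would the homogeneous components have to be finite-dimensional, which the
  coproduct of the graded dual requires. The bound is therefore extracted from the bialgebra axiom,
  by counting the shuffles that begin with two equal letters; characteristic 0 allows such counts to
  be read off from scalars.

  A tensor is a functional whose values matter only at bilinear forms, and the coproducts of
  \<open>sub_hopf\<close> and \<open>graded_dual\<close> are choices among such functionals. Hence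
  every tensor is represented by a list of pure tensors, and two lists are compared on products of
  coordinate forms, which for the graded dual are evaluations at pairs of basis vectors of
  \<open>H\<close>.\<close>

lemma scalars_simps [simp]:
  "carrier scalars = UNIV" "x \<otimes>\<^bsub>scalars\<^esub> y = x * y" "\<one>\<^bsub>scalars\<^esub> = 1"
  "\<zero>\<^bsub>scalars\<^esub> = 0" "x \<oplus>\<^bsub>scalars\<^esub> y = x + y"
  by (simp_all add: scalars_def)

lemma cring_scalars: "cring (scalars :: 'k::field ring)"
proof (rule cringI)
  have "\<exists>y. y + x = 0" for x :: 'k
    by (rule exI[of _ "- x"]) simp
  then show "abelian_group (scalars :: 'k ring)"
    by (intro abelian_groupI) (auto simp: algebra_simps)
  show "comm_monoid (scalars :: 'k ring)"
    by (intro comm_monoidI) (auto simp: algebra_simps)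
qed (simp add: algebra_simps)

locale vspace = module "scalars :: 'k::field ring" V
  for V :: "('k::field, 'v, 'm) module_scheme" (structure)

context vspace
begin

lemma smult_zero_left [simp]: "x \<in> carrier V \<Longrightarrow> 0 \<odot> x = \<zero>"
  using smult_l_null[of x] by simp

lemma smult_one_left [simp]: "x \<in> carrier V \<Longrightarrow> 1 \<odot> x = x"
  using smult_one[of x] by simp

lemma smult_add_left: "x \<in> carrier V \<Longrightarrow> (c + d) \<odot> x = c \<odot> x \<oplus> d \<odot> x"
  using smult_l_distr[of c d x] by simp

lemma smult_mult_scalar: "x \<in> carrier V \<Longrightarrow> (c * d) \<odot> x = c \<odot> (d \<odot> x)"
  using smult_assoc1[of c d x] by simp

lemma linear_form_add:
  "linear_form V f \<Longrightarrow> x \<in> carrier V \<Longrightarrow> y \<in> carrier V \<Longrightarrow> f (x \<oplus> y) = f x + f y"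
  by (simp add: linear_form_def)

lemma linear_form_smult: "linear_form V f \<Longrightarrow> x \<in> carrier V \<Longrightarrow> f (c \<odot> x) = c * f x"
  by (simp add: linear_form_def)

lemma linear_form_zero: "linear_form V f \<Longrightarrow> f \<zero> = 0"
  using linear_form_smult[of f \<zero> 0] smult_l_null[of \<zero>] by simp

lemma linear_form_minus:
  assumes "linear_form V f" "x \<in> carrier V" "y \<in> carrier V"
  shows "f (x \<ominus> y) = f x - f y"
  using linear_form_add[OF assms(1), of "x \<ominus> y" y] assms
  by (simp add: a_minus_def M.a_assoc M.l_neg)

lemma linear_form_finsum:
  assumes "linear_form V f" "finite A" "g \<in> A \<rightarrow> carrier V"
  shows "f (\<Oplus>i\<in>A. g i) = (\<Sum>i\<in>A. f (g i))"
  using assms(2,3)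
proof (induction A rule: finite_induct)
  case empty
  then show ?case using linear_form_zero[OF assms(1)] by simp
next
  case (insert i A)
  then show ?case using linear_form_add[OF assms(1)] by (simp add: Pi_def)
qed

lemma finsum_carrier: "g \<in> A \<rightarrow> carrier V \<Longrightarrow> (\<Oplus>i\<in>A. g i) \<in> carrier V"
  by (rule M.finsum_closed)

lemma finsum_one: "f i \<in> carrier V \<Longrightarrow> (\<Oplus>j\<in>{i}. f j) = f i"
  by simp

lemma subspace_finsum:
  assumes W: "vsubspace W V" and "finite A" "g \<in> A \<rightarrow> W"
  shows "(\<Oplus>i\<in>A. g i) \<in> W"
  using assms(2,3)
proof (induction A rule: finite_induct)
  case empty
  \<comment> \<open>A submodule is only known to be nonempty, so zero is produced as a multiple of
    some element.\<close>
  obtain w where "w \<in> W" using submoduleE(2)[OF W] by blast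
  then have "0 \<odot> w \<in> W" "w \<in> carrier V"
    using submoduleE(1,4)[OF W] by auto
  then show ?case by simp
next
  case (insert i A)
  then show ?case
    using submoduleE(1,5)[OF W] by (subst M.finsum_insert) auto
qed

lemma bilinear_form_left: "bilinear_form V \<beta> \<Longrightarrow> y \<in> carrier V \<Longrightarrow> linear_form V (\<lambda>x. \<beta> x y)"
  by (simp add: bilinear_form_def)

lemma bilinear_form_right: "bilinear_form V \<beta> \<Longrightarrow> x \<in> carrier V \<Longrightarrow> linear_form V (\<beta> x)"
  by (simp add: bilinear_form_def)

lemma bilinear_form_times:
  "linear_form V f \<Longrightarrow> linear_form V g \<Longrightarrow> bilinear_form V (\<lambda>x y. f x * g y)"
  by (auto simp: bilinear_form_def linear_form_def algebra_simps)

end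

lemma tensorsE:
  assumes "t \<in> tensors V T"
  obtains ps where "set ps \<subseteq> T" "\<And>\<beta>. bilinear_form V \<beta> \<Longrightarrow> t \<beta> = (\<Sum>(x, y)\<leftarrow>ps. \<beta> x y)"
  using assms by (auto simp: tensors_def)

lemma tensorsI:
  assumes "set ps \<subseteq> T" "\<And>\<beta>. bilinear_form V \<beta> \<Longrightarrow> t \<beta> = (\<Sum>(x, y)\<leftarrow>ps. \<beta> x y)"
  shows "t \<in> tensors V T"
  using assms by (auto simp: tensors_def)

section \<open>Coordinates in a basis\<close>

locale based_space = vspace V
  for V :: "('k::field, 'v, 'm) module_scheme" (structure) +
  fixes I :: "'i set" and e :: "'i \<Rightarrow> 'v"
  assumes basis: "vbasis V I e"
begin

definition coord :: "'v \<Rightarrow> 'i \<Rightarrow> 'k" where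
  "coord x = (THE c. finite {i. c i \<noteq> 0} \<and> {i. c i \<noteq> 0} \<subseteq> I \<and>
     x = (\<Oplus>i\<in>{i. c i \<noteq> 0}. c i \<odot> e i))"

lemma basis_closed [simp, intro]: "i \<in> I \<Longrightarrow> e i \<in> carrier V"
  using basis by (auto simp: vbasis_def)

lemma coord_props:
  assumes "x \<in> carrier V"
  shows finite_coord: "finite {i. coord x i \<noteq> 0}"
    and coord_support: "{i. coord x i \<noteq> 0} \<subseteq> I"
    and coord_expansion: "x = (\<Oplus>i\<in>{i. coord x i \<noteq> 0}. coord x i \<odot> e i)"
proof -
  define P where "P c \<longleftrightarrow> finite {i. c i \<noteq> 0} \<and> {i. c i \<noteq> 0} \<subseteq> I \<and>
    x = (\<Oplus>i\<in>{i. c i \<noteq> 0}. c i \<odot> e i)" for c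
  have "\<exists>!c. P c"
    using basis assms unfolding vbasis_def P_def by blast
  then have "P (The P)" by (rule theI')
  moreover have "coord x = The P"
    unfolding coord_def P_def ..
  ultimately have "P (coord x)" by simp
  note P = this[unfolded P_def]
  show "finite {i. coord x i \<noteq> 0}" by (rule conjunct1[OF P])
  show "{i. coord x i \<noteq> 0} \<subseteq> I" by (rule conjunct1[OF conjunct2[OF P]])
  show "x = (\<Oplus>i\<in>{i. coord x i \<noteq> 0}. coord x i \<odot> e i)" by (rule conjunct2[OF conjunct2[OF P]])
qed

lemma coord_outside: "x \<in> carrier V \<Longrightarrow> i \<notin> I \<Longrightarrow> coord x i = 0"
  using subsetD[OF coord_support, of x i] by blast

lemma coord_finsum:
  assumes "finite F" "F \<subseteq> I" "\<And>i. i \<notin> F \<Longrightarrow> c i = 0"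
  shows "coord (\<Oplus>i\<in>F. c i \<odot> e i) = c"
proof -
  let ?x = "\<Oplus>i\<in>F. c i \<odot> e i"
  have x: "?x \<in> carrier V"
    using assms(2) by (intro M.finsum_closed) auto
  have sub: "{i. c i \<noteq> 0} \<subseteq> F" using assms(3) by blast
  have eq: "?x = (\<Oplus>i\<in>{i. c i \<noteq> 0}. c i \<odot> e i)"
    using assms sub by (intro M.add.finprod_mono_neutral_cong_right) (auto simp: subset_iff)
  define P where "P d \<longleftrightarrow> finite {i. d i \<noteq> 0} \<and> {i. d i \<noteq> 0} \<subseteq> I \<and>
    ?x = (\<Oplus>i\<in>{i. d i \<noteq> 0}. d i \<odot> e i)" for d
  have "\<exists>!d. P d"
    using basis x unfolding vbasis_def P_def by blast
  moreover have "P c"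
    unfolding P_def using eq sub assms(1,2) finite_subset by (intro conjI) auto
  moreover have "coord ?x = The P"
    unfolding coord_def P_def ..
  ultimately show ?thesis
    using the1_equality[of P c] by simp
qed

text \<open>The inverse of \<open>coord\<close> on finitely supported families on \<open>I\<close>,
  by \<open>coord_vec\<close> and \<open>vec_coord\<close>.\<close>

definition vec :: "('i \<Rightarrow> 'k) \<Rightarrow> 'v" where
  "vec c = (\<Oplus>i\<in>{i. c i \<noteq> 0}. c i \<odot> e i)"

lemma vec_closed: "{i. c i \<noteq> 0} \<subseteq> I \<Longrightarrow> vec c \<in> carrier V"
  unfolding vec_def by (intro M.finsum_closed) auto

lemma coord_vec: "finite {i. c i \<noteq> 0} \<Longrightarrow> {i. c i \<noteq> 0} \<subseteq> I \<Longrightarrow> coord (vec c) = c"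
  unfolding vec_def by (rule coord_finsum) auto

lemma vec_coord: "x \<in> carrier V \<Longrightarrow> vec (coord x) = x"
  unfolding vec_def by (rule coord_expansion[symmetric])

lemma coord_eqI: "x \<in> carrier V \<Longrightarrow> y \<in> carrier V \<Longrightarrow> coord x = coord y \<Longrightarrow> x = y"
  by (metis vec_coord)

lemma coord_basis: "i \<in> I \<Longrightarrow> coord (e i) = (\<lambda>j. if j = i then 1 else 0)"
  using coord_finsum[of "{i}" "\<lambda>j. if j = i then 1 else 0"] by simp

text \<open>Allowing \<open>F\<close> to exceed the support lets several vectors share one index
  set, as in \<open>coord_add\<close> and \<open>bilinear_form_expansion\<close>.\<close>

lemma basis_expansion:
  assumes "x \<in> carrier V" "finite F" "F \<subseteq> I" "{i. coord x i \<noteq> 0} \<subseteq> F"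
  shows "x = (\<Oplus>i\<in>F. coord x i \<odot> e i)"
proof (rule coord_eqI)
  have "coord (\<Oplus>i\<in>F. coord x i \<odot> e i) = coord x"
    using assms by (intro coord_finsum) auto
  then show "coord x = coord (\<Oplus>i\<in>F. coord x i \<odot> e i)" by simp
  show "(\<Oplus>i\<in>F. coord x i \<odot> e i) \<in> carrier V"
    using assms by (intro M.finsum_closed) auto
qed (fact assms(1))

lemma linear_form_expansion:
  assumes "linear_form V f" "x \<in> carrier V" "finite F" "F \<subseteq> I" "{i. coord x i \<noteq> 0} \<subseteq> F"
  shows "f x = (\<Sum>i\<in>F. coord x i * f (e i))"
proof -
  have "f x = f (\<Oplus>i\<in>F. coord x i \<odot> e i)"
    using basis_expansion[OF assms(2-5)] by simp
  also have "\<dots> = (\<Sum>i\<in>F. f (coord x i \<odot> e i))"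
    using assms by (intro linear_form_finsum) auto
  also have "\<dots> = (\<Sum>i\<in>F. coord x i * f (e i))"
    using assms by (intro sum.cong refl linear_form_smult) auto
  finally show ?thesis .
qed

lemma coord_add:
  assumes "x \<in> carrier V" "y \<in> carrier V"
  shows "coord (x \<oplus> y) i = coord x i + coord y i"
proof -
  let ?F = "{i. coord x i \<noteq> 0} \<union> {i. coord y i \<noteq> 0}"
  have F: "finite ?F" "?F \<subseteq> I"
    using assms by (simp_all add: finite_coord coord_support)
  have "x \<oplus> y = (\<Oplus>i\<in>?F. coord x i \<odot> e i) \<oplus> (\<Oplus>i\<in>?F. coord y i \<odot> e i)"
    using basis_expansion[of x ?F] basis_expansion[of y ?F] assms F by auto
  also have "\<dots> = (\<Oplus>i\<in>?F. coord x i \<odot> e i \<oplus> coord y i \<odot> e i)"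
    using F by (intro M.finsum_addf[symmetric]) auto
  also have "\<dots> = (\<Oplus>i\<in>?F. (coord x i + coord y i) \<odot> e i)"
  proof (rule M.finsum_cong')
    show "coord x i \<odot> e i \<oplus> coord y i \<odot> e i = (coord x i + coord y i) \<odot> e i" if "i \<in> ?F" for i
      using smult_add_left[of "e i"] that F(2) by auto
  qed (use F in auto)
  finally have "coord (x \<oplus> y) = (\<lambda>i. coord x i + coord y i)"
    using coord_finsum[OF F, of "\<lambda>i. coord x i + coord y i"] by auto
  then show ?thesis by simp
qed

lemma coord_smult:
  assumes "x \<in> carrier V"
  shows "coord (c \<odot> x) i = c * coord x i"
proof -
  let ?F = "{i. coord x i \<noteq> 0}"
  have F: "finite ?F" "?F \<subseteq> I"
    using assms by (simp_all add: finite_coord coord_support)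
  have "c \<odot> x = c \<odot> (\<Oplus>i\<in>?F. coord x i \<odot> e i)"
    using basis_expansion[of x ?F] assms F by auto
  also have "\<dots> = (\<Oplus>i\<in>?F. c \<odot> (coord x i \<odot> e i))"
    using F by (intro finsum_smult_ldistr) auto
  also have "\<dots> = (\<Oplus>i\<in>?F. (c * coord x i) \<odot> e i)"
  proof (rule M.finsum_cong')
    show "c \<odot> (coord x i \<odot> e i) = (c * coord x i) \<odot> e i" if "i \<in> ?F" for i
      using smult_mult_scalar[of "e i"] that F(2) by auto
  qed (use F in auto)
  finally have "coord (c \<odot> x) = (\<lambda>i. c * coord x i)"
    using coord_finsum[OF F, of "\<lambda>i. c * coord x i"] by auto
  then show ?thesis by simp
qed

lemma linear_form_coord: "linear_form V (\<lambda>x. coord x i)"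
  by (simp add: linear_form_def coord_add coord_smult)

lemmas coord_zero = linear_form_zero[OF linear_form_coord]
lemmas coord_minus = linear_form_minus[OF linear_form_coord]
lemmas coord_sum = linear_form_finsum[OF linear_form_coord]

text \<open>The linear form with prescribed values \<open>g i\<close> on the basis, see
  \<open>form_basis\<close>.\<close>

definition form :: "('i \<Rightarrow> 'k) \<Rightarrow> 'v \<Rightarrow> 'k" where
  "form g x = (\<Sum>i | coord x i \<noteq> 0. coord x i * g i)"

lemma form_eq:
  assumes "x \<in> carrier V" "finite F" "{i. coord x i \<noteq> 0} \<subseteq> F"
  shows "form g x = (\<Sum>i\<in>F. coord x i * g i)"
  unfolding form_def using assms by (intro sum.mono_neutral_left) auto

lemma linear_form_form: "linear_form V (form g)"
  unfolding linear_form_def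
proof (intro conjI ballI allI)
  fix x y assume xy: "x \<in> carrier V" "y \<in> carrier V"
  let ?F = "{i. coord x i \<noteq> 0} \<union> {i. coord y i \<noteq> 0}"
  have "form g (x \<oplus> y) = (\<Sum>i\<in>?F. coord (x \<oplus> y) i * g i)"
    using xy by (intro form_eq) (auto simp: finite_coord coord_add)
  also have "\<dots> = (\<Sum>i\<in>?F. coord x i * g i) + (\<Sum>i\<in>?F. coord y i * g i)"
    using xy by (simp add: coord_add algebra_simps sum.distrib)
  also have "\<dots> = form g x + form g y"
    using xy by (simp add: form_eq[of _ ?F] finite_coord)
  finally show "form g (x \<oplus> y) = form g x + form g y" .
next
  fix c x assume x: "x \<in> carrier V"
  have "form g (c \<odot> x) = (\<Sum>i | coord x i \<noteq> 0. coord (c \<odot> x) i * g i)"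
    using x by (intro form_eq) (auto simp: finite_coord coord_smult)
  also have "\<dots> = c * form g x"
    using x by (simp add: coord_smult form_def sum_distrib_left mult.assoc)
  finally show "form g (c \<odot> x) = c * form g x" .
qed

lemma form_basis: "i \<in> I \<Longrightarrow> form g (e i) = g i"
  using form_eq[of "e i" "{i}" g] by (simp add: coord_basis)

lemma linear_form_eqI:
  assumes "linear_form V f" "linear_form V g" "\<And>i. i \<in> I \<Longrightarrow> f (e i) = g (e i)" "x \<in> carrier V"
  shows "f x = g x"
proof -
  have F: "finite {i. coord x i \<noteq> 0}" "{i. coord x i \<noteq> 0} \<subseteq> I"
    using finite_coord[OF assms(4)] coord_support[OF assms(4)] .
  show ?thesis
    unfolding linear_form_expansion[OF assms(1,4) F order_refl]
      linear_form_expansion[OF assms(2,4) F order_refl]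
    using F assms(3) by (intro sum.cong) auto
qed

lemma bilinear_form_eqI:
  assumes "bilinear_form V \<beta>" "bilinear_form V \<gamma>"
    and "\<And>i j. i \<in> I \<Longrightarrow> j \<in> I \<Longrightarrow> \<beta> (e i) (e j) = \<gamma> (e i) (e j)"
    and "x \<in> carrier V" "y \<in> carrier V"
  shows "\<beta> x y = \<gamma> x y"
proof (rule linear_form_eqI[where f = "\<lambda>x. \<beta> x y" and g = "\<lambda>x. \<gamma> x y"])
  fix i assume i: "i \<in> I"
  show "\<beta> (e i) y = \<gamma> (e i) y"
    by (rule linear_form_eqI[where f = "\<beta> (e i)" and g = "\<gamma> (e i)"])
      (use assms i in \<open>auto intro: bilinear_form_right\<close>)
qed (use assms in \<open>auto intro: bilinear_form_left\<close>)

lemma bilinear_form_expansion: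
  assumes "bilinear_form V \<beta>" "x \<in> carrier V" "y \<in> carrier V" "finite F" "F \<subseteq> I"
    and "{i. coord x i \<noteq> 0} \<subseteq> F" "{i. coord y i \<noteq> 0} \<subseteq> F"
  shows "\<beta> x y = (\<Sum>i\<in>F. \<Sum>j\<in>F. coord x i * coord y j * \<beta> (e i) (e j))"
proof -
  have "\<beta> x y = (\<Sum>i\<in>F. coord x i * \<beta> (e i) y)"
    using linear_form_expansion[OF bilinear_form_left[OF assms(1,3)] assms(2,4,5,6)] .
  also have "\<dots> = (\<Sum>i\<in>F. coord x i * (\<Sum>j\<in>F. coord y j * \<beta> (e i) (e j)))"
    using assms by (intro sum.cong refl arg_cong2[where f = "(*)"] linear_form_expansion)
      (auto intro: bilinear_form_right)
  finally show ?thesis by (simp add: sum_distrib_left mult.assoc)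
qed

section \<open>Separation of tensors by coordinate forms\<close>

lemma sum_list_sum_swap: "(\<Sum>p\<leftarrow>ps. \<Sum>i\<in>F. f p i) = (\<Sum>i\<in>F. \<Sum>p\<leftarrow>ps. (f p i :: 'c::comm_monoid_add))"
  by (induction ps) (auto simp: sum.distrib)

text \<open>Only finitely many basis vectors occur in the two lists. Over these, the value of a
  bilinear form at a list is a fixed linear combination of the values of the products of
  coordinates.\<close>

lemma tensor_eqI:
  assumes "set ps \<subseteq> carrier V \<times> carrier V" "set qs \<subseteq> carrier V \<times> carrier V"
    and eq: "\<And>i j. i \<in> I \<Longrightarrow> j \<in> I \<Longrightarrow>
      (\<Sum>(x, y)\<leftarrow>ps. coord x i * coord y j) = (\<Sum>(x, y)\<leftarrow>qs. coord x i * coord y j)"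
    and \<beta>: "bilinear_form V \<beta>"
  shows "(\<Sum>(x, y)\<leftarrow>ps. \<beta> x y) = (\<Sum>(x, y)\<leftarrow>qs. \<beta> x y)"
proof -
  \<comment> \<open>One finite set for all entries of both lists, so that every summand is expanded
    over the same indices.\<close>
  define F where "F = (\<Union>(x, y)\<in>set ps \<union> set qs. {i. coord x i \<noteq> 0} \<union> {i. coord y i \<noteq> 0})"
  have F: "finite F" "F \<subseteq> I"
    unfolding F_def using assms(1,2) by (auto intro!: finite_coord dest!: set_mp[OF coord_support])
  have *: "(\<Sum>(x, y)\<leftarrow>rs. \<beta> x y)
      = (\<Sum>i\<in>F. \<Sum>j\<in>F. (\<Sum>(x, y)\<leftarrow>rs. coord x i * coord y j) * \<beta> (e i) (e j))"
    if rs: "set rs \<subseteq> set ps \<union> set qs" for rs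
  proof -
    have "(\<Sum>(x, y)\<leftarrow>rs. \<beta> x y)
        = (\<Sum>p\<leftarrow>rs. \<Sum>i\<in>F. \<Sum>j\<in>F. coord (fst p) i * coord (snd p) j * \<beta> (e i) (e j))"
    proof (rule arg_cong[where f = sum_list], rule map_cong[OF refl])
      fix p assume "p \<in> set rs"
      moreover obtain x y where p: "p = (x, y)" by fastforce
      ultimately have xy: "(x, y) \<in> set ps \<union> set qs" using rs by blast
      then have "x \<in> carrier V" "y \<in> carrier V" using assms(1,2) by auto
      moreover have "{i. coord x i \<noteq> 0} \<subseteq> F" "{i. coord y i \<noteq> 0} \<subseteq> F"
        unfolding F_def using xy by blast+
      ultimately show "(case p of (x, y) \<Rightarrow> \<beta> x y)
          = (\<Sum>i\<in>F. \<Sum>j\<in>F. coord (fst p) i * coord (snd p) j * \<beta> (e i) (e j))"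
        unfolding p using bilinear_form_expansion[OF \<beta> _ _ F, of x y] by simp
    qed
    also have "\<dots> = (\<Sum>i\<in>F. \<Sum>j\<in>F. (\<Sum>p\<leftarrow>rs. coord (fst p) i * coord (snd p) j) * \<beta> (e i) (e j))"
      by (simp add: sum_list_sum_swap sum_list_mult_const)
    finally show ?thesis by (simp only: case_prod_unfold)
  qed
  have "(\<Sum>(x, y)\<leftarrow>ps. coord x i * coord y j) = (\<Sum>(x, y)\<leftarrow>qs. coord x i * coord y j)"
    if "i \<in> F" "j \<in> F" for i j
    using F that by (intro eq) auto
  then show ?thesis
    by (subst (1 2) *) (auto intro!: sum.cong)
qed

text \<open>Expanding the first factor in the basis leaves one identity of two-fold tensors for each
  basis vector, which \<open>tensor_eqI\<close> settles.\<close>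

lemma tensor3_eqI:
  assumes ps: "set ps \<subseteq> carrier V \<times> carrier V \<times> carrier V"
    and qs: "set qs \<subseteq> carrier V \<times> carrier V \<times> carrier V"
    and eq: "\<And>i j k. i \<in> I \<Longrightarrow> j \<in> I \<Longrightarrow> k \<in> I \<Longrightarrow>
      (\<Sum>(x, y, z)\<leftarrow>ps. coord x i * coord y j * coord z k) =
      (\<Sum>(x, y, z)\<leftarrow>qs. coord x i * coord y j * coord z k)"
    and \<gamma>: "trilinear_form V \<gamma>"
  shows "(\<Sum>(x, y, z)\<leftarrow>ps. \<gamma> x y z) = (\<Sum>(x, y, z)\<leftarrow>qs. \<gamma> x y z)"
proof -
  define F where "F = (\<Union>(x, y, z)\<in>set ps \<union> set qs. {i. coord x i \<noteq> 0})"
  have F: "finite F" "F \<subseteq> I"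
    unfolding F_def using ps qs by (auto intro!: finite_coord dest!: set_mp[OF coord_support])
  have bil: "bilinear_form V (\<gamma> x)" "linear_form V (\<lambda>x. \<gamma> x y z)"
    if "x \<in> carrier V" "y \<in> carrier V" "z \<in> carrier V" for x y z
    using \<gamma> that unfolding trilinear_form_def bilinear_form_def by auto
  \<comment> \<open>The slice at \<open>e i\<close>; the coordinate of the first factor is absorbed
    into the second, since pure tensors carry no scalars.\<close>
  let ?slice = "\<lambda>i. map (\<lambda>(x, y, z). (coord x i \<odot> y, z))"
  have *: "(\<Sum>(x, y, z)\<leftarrow>rs. \<gamma> x y z) = (\<Sum>i\<in>F. \<Sum>(y, z)\<leftarrow>?slice i rs. \<gamma> (e i) y z)"
    if rs: "set rs \<subseteq> set ps \<union> set qs" for rs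
  proof -
    have "(\<Sum>(x, y, z)\<leftarrow>rs. \<gamma> x y z) = (\<Sum>p\<leftarrow>rs. \<Sum>i\<in>F. case p of (x, y, z) \<Rightarrow> \<gamma> (e i) (coord x i \<odot> y) z)"
    proof (rule arg_cong[where f = sum_list], rule map_cong[OF refl])
      fix p assume "p \<in> set rs"
      moreover obtain x y z where p: "p = (x, y, z)" by (cases p)
      ultimately have xyz: "(x, y, z) \<in> set ps \<union> set qs" using rs by blast
      then have c: "x \<in> carrier V" "y \<in> carrier V" "z \<in> carrier V" using ps qs by auto
      have "{i. coord x i \<noteq> 0} \<subseteq> F" unfolding F_def using xyz by blast
      then have "\<gamma> x y z = (\<Sum>i\<in>F. coord x i * \<gamma> (e i) y z)"
        by (rule linear_form_expansion[OF bil(2)[OF c] c(1) F])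
      also have "\<dots> = (\<Sum>i\<in>F. \<gamma> (e i) (coord x i \<odot> y) z)"
      proof (intro sum.cong refl)
        fix i assume "i \<in> F"
        then have "bilinear_form V (\<gamma> (e i))" using F c by (intro bil(1)[of _ y z]) auto
        from linear_form_smult[OF bilinear_form_left[OF this c(3)] c(2), symmetric]
        show "coord x i * \<gamma> (e i) y z = \<gamma> (e i) (coord x i \<odot> y) z" .
      qed
      finally show "(case p of (x, y, z) \<Rightarrow> \<gamma> x y z) =
          (\<Sum>i\<in>F. case p of (x, y, z) \<Rightarrow> \<gamma> (e i) (coord x i \<odot> y) z)"
        by (simp add: p)
    qed
    then show ?thesis by (simp add: sum_list_sum_swap comp_def case_prod_unfold)
  qed
  have "(\<Sum>(y, z)\<leftarrow>?slice i ps. \<gamma> (e i) y z) = (\<Sum>(y, z)\<leftarrow>?slice i qs. \<gamma> (e i) y z)"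
    if i: "i \<in> F" for i
  proof (rule tensor_eqI)
    show "set (?slice i ps) \<subseteq> carrier V \<times> carrier V" "set (?slice i qs) \<subseteq> carrier V \<times> carrier V"
      using ps qs by auto
    show "bilinear_form V (\<gamma> (e i))" using i F by (intro bil(1)[of _ \<zero> \<zero>]) auto
    fix j k assume jk: "j \<in> I" "k \<in> I"
    have **: "(\<Sum>(y, z)\<leftarrow>?slice i rs. coord y j * coord z k) =
        (\<Sum>(x, y, z)\<leftarrow>rs. coord x i * coord y j * coord z k)"
      if "set rs \<subseteq> carrier V \<times> carrier V \<times> carrier V" for rs
      unfolding map_map comp_def case_prod_unfold
      by (rule arg_cong[where f = sum_list], rule map_cong[OF refl])
        (auto simp: coord_smult dest!: subsetD[OF that])
    show "(\<Sum>(y, z)\<leftarrow>?slice i ps. coord y j * coord z k) =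
        (\<Sum>(y, z)\<leftarrow>?slice i qs. coord y j * coord z k)"
      unfolding **[OF ps] **[OF qs] using i F jk by (intro eq) auto
  qed
  then show ?thesis by (simp add: *)
qed

end

section \<open>Tensors and images of Hopf algebras\<close>

lemma linear_form_sum_list:
  "(\<And>p. p \<in> set ps \<Longrightarrow> linear_form V (f p)) \<Longrightarrow> linear_form V (\<lambda>x. \<Sum>p\<leftarrow>ps. f p x)"
  by (induction ps) (auto simp: linear_form_def algebra_simps)

lemma linear_form_cmult: "linear_form V f \<Longrightarrow> linear_form V (\<lambda>x. c * f x)"
  by (simp add: linear_form_def algebra_simps)

lemma linear_form_multc: "linear_form V f \<Longrightarrow> linear_form V (\<lambda>x. f x * c)"
  by (simp add: linear_form_def algebra_simps)

context vspace
begin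

lemma linear_form_cong_carrier:
  "linear_form V f \<Longrightarrow> (\<And>x. x \<in> carrier V \<Longrightarrow> f x = g x) \<Longrightarrow> linear_form V g"
  unfolding linear_form_def by (metis M.a_closed UNIV_I scalars_simps(1) smult_closed)

lemma bilinear_form_cong:
  assumes "bilinear_form V \<beta>"
    and "\<And>x y. x \<in> carrier V \<Longrightarrow> y \<in> carrier V \<Longrightarrow> \<beta> x y = \<gamma> x y"
  shows "bilinear_form V \<gamma>"
  unfolding bilinear_form_def
proof (intro conjI ballI)
  fix x assume x: "x \<in> carrier V"
  show "linear_form V (\<gamma> x)"
    by (rule linear_form_cong_carrier[OF bilinear_form_right[OF assms(1) x]]) (use assms x in auto)
  show "linear_form V (\<lambda>y. \<gamma> y x)"
    by (rule linear_form_cong_carrier[OF bilinear_form_left[OF assms(1) x]]) (use assms x in auto)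
qed

text \<open>A tensor is determined only at bilinear forms, so agreement on the carrier does not
  suffice by itself: \<open>bilinear_form_cong\<close> first makes \<gamma> bilinear as
  well.\<close>

lemma tensor_cong:
  assumes t: "t \<in> tensors V (carrier V \<times> carrier V)" and \<beta>: "bilinear_form V \<beta>"
    and eq: "\<And>x y. x \<in> carrier V \<Longrightarrow> y \<in> carrier V \<Longrightarrow> \<beta> x y = \<gamma> x y"
  shows "t \<beta> = t \<gamma>"
proof -
  obtain ps where ps: "set ps \<subseteq> carrier V \<times> carrier V"
    "\<And>\<beta>. bilinear_form V \<beta> \<Longrightarrow> t \<beta> = (\<Sum>(x, y)\<leftarrow>ps. \<beta> x y)"
    using tensorsE[OF t] by blast
  show ?thesis
    by (subst ps(2)[OF \<beta>], subst ps(2)[OF bilinear_form_cong[OF \<beta>]])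
      (auto simp: eq intro!: arg_cong[where f = sum_list] map_cong dest!: subsetD[OF ps(1)])
qed

text \<open>At bilinear forms \<open>t\<close> is a finite sum of evaluations, so linearity in the
  parameter passes through. This is what makes nested coproducts admissible arguments of an outer
  coproduct.\<close>

lemma tensor_linear:
  assumes t: "t \<in> tensors V (carrier V \<times> carrier V)"
    and bil: "\<And>x. x \<in> carrier W \<Longrightarrow> bilinear_form V (\<beta> x)"
    and lin: "\<And>y z. y \<in> carrier V \<Longrightarrow> z \<in> carrier V \<Longrightarrow> linear_form W (\<lambda>x. \<beta> x y z)"
    and W: "vspace W"
  shows "linear_form W (\<lambda>x. t (\<beta> x))"
proof -
  obtain ps where ps: "set ps \<subseteq> carrier V \<times> carrier V"
    "\<And>\<beta>. bilinear_form V \<beta> \<Longrightarrow> t \<beta> = (\<Sum>(x, y)\<leftarrow>ps. \<beta> x y)"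
    using tensorsE[OF t] by blast
  have "linear_form W (\<lambda>x. \<Sum>(y, z)\<leftarrow>ps. \<beta> x y z)"
    using ps(1) lin unfolding case_prod_unfold by (intro linear_form_sum_list) auto
  then show ?thesis
    by (rule vspace.linear_form_cong_carrier[OF W]) (use ps(2)[OF bil] in auto)
qed

lemma tensor_bilinear:
  assumes t: "t \<in> tensors V (carrier V \<times> carrier V)"
    and "\<And>x\<^sub>1 x\<^sub>2. x\<^sub>1 \<in> carrier W \<Longrightarrow> x\<^sub>2 \<in> carrier W \<Longrightarrow> bilinear_form V (\<beta> x\<^sub>1 x\<^sub>2)"
    and "\<And>y z. y \<in> carrier V \<Longrightarrow> z \<in> carrier V \<Longrightarrow> bilinear_form W (\<lambda>x\<^sub>1 x\<^sub>2. \<beta> x\<^sub>1 x\<^sub>2 y z)"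
    and W: "vspace W"
  shows "bilinear_form W (\<lambda>x\<^sub>1 x\<^sub>2. t (\<beta> x\<^sub>1 x\<^sub>2))"
  unfolding bilinear_form_def
  by (intro conjI ballI tensor_linear[OF t _ _ W]) (use assms(2,3) in \<open>auto simp: bilinear_form_def\<close>)

text \<open>\<Delta> is arbitrary because the lemma also serves images and graded duals, before
  these are known to be Hopf algebras.\<close>

lemma bilinear_form_iterated:
  assumes closed: "\<And>x. x \<in> carrier V \<Longrightarrow> \<Delta> x \<in> tensors V (carrier V \<times> carrier V)"
    and lin: "\<And>\<beta>. bilinear_form V \<beta> \<Longrightarrow> linear_form V (\<lambda>x. \<Delta> x \<beta>)"
    and \<gamma>: "trilinear_form V \<gamma>"
  shows "bilinear_form V (\<lambda>y z. \<Delta> y (\<lambda>y\<^sub>1 y\<^sub>2. \<gamma> y\<^sub>1 y\<^sub>2 z))"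
    and "bilinear_form V (\<lambda>y z. \<Delta> z (\<lambda>z\<^sub>1 z\<^sub>2. \<gamma> y z\<^sub>1 z\<^sub>2))"
proof -
  have *: "\<And>x. x \<in> carrier V \<Longrightarrow> bilinear_form V (\<gamma> x)"
    "\<And>y. y \<in> carrier V \<Longrightarrow> bilinear_form V (\<lambda>x z. \<gamma> x y z)"
    "\<And>z. z \<in> carrier V \<Longrightarrow> bilinear_form V (\<lambda>x y. \<gamma> x y z)"
    using \<gamma> by (auto simp: trilinear_form_def)
  show "bilinear_form V (\<lambda>y z. \<Delta> y (\<lambda>y\<^sub>1 y\<^sub>2. \<gamma> y\<^sub>1 y\<^sub>2 z))"
    unfolding bilinear_form_def
    by (intro conjI ballI lin tensor_linear[OF closed])
      (auto intro!: * bilinear_form_right[OF *(1)] vspace_axioms)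
  show "bilinear_form V (\<lambda>y z. \<Delta> z (\<lambda>z\<^sub>1 z\<^sub>2. \<gamma> y z\<^sub>1 z\<^sub>2))"
    unfolding bilinear_form_def
    by (intro conjI ballI lin tensor_linear[OF closed])
      (auto intro!: * bilinear_form_left[OF *(3)] vspace_axioms)
qed

text \<open>\<open>t\<close> is an arbitrary function; its linearity in the form comes from the
  representing list.\<close>

lemma tensor_cmult:
  assumes t: "t \<in> tensors V (carrier V \<times> carrier V)" and \<beta>: "bilinear_form V \<beta>"
  shows "t (\<lambda>x y. \<beta> x y * c) = t \<beta> * c"
proof -
  obtain ps where ps: "set ps \<subseteq> carrier V \<times> carrier V"
    "\<And>\<beta>. bilinear_form V \<beta> \<Longrightarrow> t \<beta> = (\<Sum>(x, y)\<leftarrow>ps. \<beta> x y)"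
    using tensorsE[OF t] by blast
  have "bilinear_form V (\<lambda>x y. \<beta> x y * c)"
    using \<beta> by (simp add: bilinear_form_def linear_form_multc)
  then show ?thesis
    by (simp add: ps(2) \<beta> sum_list_mult_const[symmetric] case_prod_unfold)
qed

lemma tensor_sum_list:
  assumes t: "t \<in> tensors V (carrier V \<times> carrier V)"
    and \<beta>: "\<And>p. p \<in> set rs \<Longrightarrow> bilinear_form V (\<beta> p)"
  shows "t (\<lambda>x y. \<Sum>p\<leftarrow>rs. \<beta> p x y) = (\<Sum>p\<leftarrow>rs. t (\<beta> p))"
proof -
  obtain ps where ps: "set ps \<subseteq> carrier V \<times> carrier V"
    "\<And>\<beta>. bilinear_form V \<beta> \<Longrightarrow> t \<beta> = (\<Sum>(x, y)\<leftarrow>ps. \<beta> x y)"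
    using tensorsE[OF t] by blast
  have swap: "(\<Sum>q\<leftarrow>qs. \<Sum>p\<leftarrow>rs. g p q) = (\<Sum>p\<leftarrow>rs. \<Sum>q\<leftarrow>qs. g p q)"
    for qs :: "('v \<times> 'v) list" and rs and g :: "_ \<Rightarrow> _ \<Rightarrow> 'k"
    by (induction qs) (auto simp: sum_list_addf)
  have "bilinear_form V (\<lambda>x y. \<Sum>p\<leftarrow>rs. \<beta> p x y)"
    using \<beta> unfolding bilinear_form_def by (intro conjI ballI linear_form_sum_list) auto
  then have "t (\<lambda>x y. \<Sum>p\<leftarrow>rs. \<beta> p x y) = (\<Sum>(x, y)\<leftarrow>ps. \<Sum>p\<leftarrow>rs. \<beta> p x y)"
    by (rule ps(2))
  also have "\<dots> = (\<Sum>p\<leftarrow>rs. \<Sum>(x, y)\<leftarrow>ps. \<beta> p x y)"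
    unfolding case_prod_unfold by (rule swap)
  also have "\<dots> = (\<Sum>p\<leftarrow>rs. t (\<beta> p))"
    by (intro arg_cong[where f = sum_list] map_cong refl) (use ps(2)[OF \<beta>] in auto)
  finally show ?thesis .
qed

end

section \<open>Forms built from the operations of a Hopf algebra\<close>

sublocale hopf_algebra \<subseteq> vspace H ..

lemma (in ring) ring_distribs:
  assumes "x \<in> carrier R" "y \<in> carrier R" "z \<in> carrier R"
  shows "(x \<oplus> y) \<otimes> z = x \<otimes> z \<oplus> y \<otimes> z" "z \<otimes> (x \<oplus> y) = z \<otimes> x \<oplus> z \<otimes> y"
  using assms by (rule l_distr, rule r_distr)

context hopf_algebra
begin

lemma ring_H: "ring H" ..

lemma vspace_H: "vspace H" ..

lemmas distribs = ring.ring_distribs[OF ring_H]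

lemma mult_closed [simp, intro]:
  "x \<in> carrier H \<Longrightarrow> y \<in> carrier H \<Longrightarrow> x \<otimes> y \<in> carrier H"
  using ring_H by (rule ring.ring_simprules(5))

lemma one_closed [simp, intro]: "\<one> \<in> carrier H"
  using ring_H by (rule ring.ring_simprules(6))

lemma mult_assoc:
  "x \<in> carrier H \<Longrightarrow> y \<in> carrier H \<Longrightarrow> z \<in> carrier H \<Longrightarrow> (x \<otimes> y) \<otimes> z = x \<otimes> (y \<otimes> z)"
  using ring_H by (rule ring.ring_simprules(11))

lemma mult_one:
  "x \<in> carrier H \<Longrightarrow> \<one> \<otimes> x = x" "x \<in> carrier H \<Longrightarrow> x \<otimes> \<one> = x"
  using monoid.l_one[OF ring.axioms(2)[OF ring_H]] monoid.r_one[OF ring.axioms(2)[OF ring_H]] by auto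

lemma abelian_group_H: "abelian_group H"
  using ring_H by (rule ring.is_abelian_group)

lemmas l_neg_H = abelian_group.l_neg[OF abelian_group_H]
lemmas add_ac_H = abelian_monoid.a_ac[OF abelian_group.axioms(1)[OF abelian_group_H]]

lemma bilinear_form_mult:
  assumes "linear_form H f"
  shows "bilinear_form H (\<lambda>x y. f (x \<otimes> y))"
  unfolding bilinear_form_def linear_form_def
  using assms by (auto simp: linear_form_add linear_form_smult distribs
      smult_mult_left smult_mult_right)

lemma bilinear_form_mult2:
  assumes "bilinear_form H \<beta>" "x\<^sub>1 \<in> carrier H" "x\<^sub>2 \<in> carrier H"
  shows "bilinear_form H (\<lambda>y\<^sub>1 y\<^sub>2. \<beta> (x\<^sub>1 \<otimes> y\<^sub>1) (x\<^sub>2 \<otimes> y\<^sub>2))"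
    and "bilinear_form H (\<lambda>y\<^sub>1 y\<^sub>2. \<beta> (y\<^sub>1 \<otimes> x\<^sub>1) (y\<^sub>2 \<otimes> x\<^sub>2))"
  using assms unfolding bilinear_form_def linear_form_def
  by (auto simp: distribs smult_mult_left smult_mult_right)

lemma bilinear_form_antipode:
  assumes "linear_form H f"
  shows "bilinear_form H (\<lambda>x y. f (antipode H x \<otimes> y))"
    and "bilinear_form H (\<lambda>x y. f (x \<otimes> antipode H y))"
  using bilinear_form_mult[OF assms] unfolding bilinear_form_def linear_form_def
  by (auto simp: antipode_add antipode_smult antipode_closed)

lemma linear_form_comult: "bilinear_form H \<beta> \<Longrightarrow> linear_form H (\<lambda>x. comult H x \<beta>)"
  by (simp add: linear_form_def comult_add comult_smult)

lemma bilinear_form_comult: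
  assumes "trilinear_form H \<gamma>"
  shows "bilinear_form H (\<lambda>y z. comult H y (\<lambda>y\<^sub>1 y\<^sub>2. \<gamma> y\<^sub>1 y\<^sub>2 z))"
    and "bilinear_form H (\<lambda>y z. comult H z (\<lambda>z\<^sub>1 z\<^sub>2. \<gamma> y z\<^sub>1 z\<^sub>2))"
  by (rule bilinear_form_iterated[OF comult_closed linear_form_comult assms]; assumption)+

end

section \<open>Surjections that preserve all operations\<close>

locale hopf_image = hopf_algebra D
  for D :: "('k::field, 'd) hopf" (structure) +
  fixes Q :: "('k, 'q) hopf" and r :: "'d \<Rightarrow> 'q"
  assumes r_surj: "r ` carrier D = carrier Q"
    and r_add: "x \<in> carrier D \<Longrightarrow> y \<in> carrier D \<Longrightarrow> r (x \<oplus> y) = r x \<oplus>\<^bsub>Q\<^esub> r y"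
    and r_mult: "x \<in> carrier D \<Longrightarrow> y \<in> carrier D \<Longrightarrow> r (x \<otimes> y) = r x \<otimes>\<^bsub>Q\<^esub> r y"
    and r_zero: "r \<zero> = \<zero>\<^bsub>Q\<^esub>"
    and r_one: "r \<one> = \<one>\<^bsub>Q\<^esub>"
    and r_smult: "x \<in> carrier D \<Longrightarrow> r (c \<odot> x) = c \<odot>\<^bsub>Q\<^esub> r x"
    and r_comult: "x \<in> carrier D \<Longrightarrow> bilinear_form Q \<beta> \<Longrightarrow>
      comult Q (r x) \<beta> = comult D x (\<lambda>y z. \<beta> (r y) (r z))"
    and r_counit: "x \<in> carrier D \<Longrightarrow> counit Q (r x) = counit D x"
    and r_antipode: "x \<in> carrier D \<Longrightarrow> antipode Q (r x) = r (antipode D x)"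
begin

lemma r_closed: "x \<in> carrier D \<Longrightarrow> r x \<in> carrier Q"
  using r_surj by blast

lemma Q_cases:
  assumes "u \<in> carrier Q"
  obtains x where "x \<in> carrier D" "u = r x"
  using assms r_surj by blast

lemma ring_Q: "ring Q"
proof (intro ringI abelian_groupI monoidI)
  fix u assume "u \<in> carrier Q"
  then obtain x where x: "x \<in> carrier D" "u = r x" by (rule Q_cases)
  then have "r (\<ominus> x) \<oplus>\<^bsub>Q\<^esub> u = \<zero>\<^bsub>Q\<^esub>"
    by (simp add: l_neg_H flip: r_add r_zero)
  then show "\<exists>v\<in>carrier Q. v \<oplus>\<^bsub>Q\<^esub> u = \<zero>\<^bsub>Q\<^esub>"
    using x r_closed by blast
next
  show "\<zero>\<^bsub>Q\<^esub> \<in> carrier Q" using r_closed[OF abelian_monoid.zero_closed[OF abelian_group.axioms(1)[OF abelian_group_H]]] by (simp add: r_zero)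
  show "\<one>\<^bsub>Q\<^esub> \<in> carrier Q" using r_closed[OF one_closed] by (simp add: r_one)
qed (elim Q_cases; force simp: r_closed add_ac_H mult_assoc mult_one distribs
      simp flip: r_add r_mult r_zero r_one)+

lemma module_Q: "module scalars Q"
proof (rule moduleI[OF cring_scalars])
  show "abelian_group Q" using ring_Q by (rule ring.is_abelian_group)
qed (elim Q_cases; force simp: r_closed smult_add_left smult_mult_scalar smult_r_distr simp flip: r_smult r_add)+

lemma vspace_Q: "vspace Q"
  using module_Q by (rule vspace.intro)

lemma linear_form_pullback: "linear_form Q f \<Longrightarrow> linear_form D (\<lambda>x. f (r x))"
  by (simp add: linear_form_def r_add r_smult r_closed)

lemma bilinear_form_pullback: "bilinear_form Q \<beta> \<Longrightarrow> bilinear_form D (\<lambda>x y. \<beta> (r x) (r y))"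
  unfolding bilinear_form_def by (auto intro!: linear_form_pullback r_closed)

lemma trilinear_form_pullback:
  "trilinear_form Q \<gamma> \<Longrightarrow> trilinear_form D (\<lambda>x y z. \<gamma> (r x) (r y) (r z))"
  unfolding trilinear_form_def by (auto intro!: bilinear_form_pullback r_closed)

text \<open>The form under a coproduct cannot be rewritten directly, as the equations for
  \<open>r\<close> hold only on the carrier. Transport along \<open>r\<close> and this rewriting are
  done in one step.\<close>

lemma r_comult_eq:
  assumes x: "x \<in> carrier D" and \<beta>: "bilinear_form Q \<beta>"
    and eq: "\<And>y z. y \<in> carrier D \<Longrightarrow> z \<in> carrier D \<Longrightarrow> \<beta> (r y) (r z) = \<gamma> y z"
  shows "comult Q (r x) \<beta> = comult D x \<gamma>"
  unfolding r_comult[OF x \<beta>]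
  by (rule tensor_cong[OF comult_closed[OF x] bilinear_form_pullback[OF \<beta>] eq])

lemma comult_Q_closed:
  assumes "u \<in> carrier Q"
  shows "comult Q u \<in> tensors Q (carrier Q \<times> carrier Q)"
proof -
  obtain x where x: "x \<in> carrier D" "u = r x" using assms by (rule Q_cases)
  obtain ps where ps: "set ps \<subseteq> carrier D \<times> carrier D"
    "\<And>\<beta>. bilinear_form D \<beta> \<Longrightarrow> comult D x \<beta> = (\<Sum>(x, y)\<leftarrow>ps. \<beta> x y)"
    using tensorsE[OF comult_closed[OF x(1)]] by blast
  show ?thesis
    by (rule tensorsI[of "map (map_prod r r) ps"])
      (use ps(1) in \<open>auto simp: x r_comult ps(2)[OF bilinear_form_pullback] comp_def
        case_prod_unfold intro!: r_closed\<close>)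
qed

text \<open>An identity at \<open>u = r x\<close> is moved to \<open>D\<close>, where it is the
  corresponding axiom for the pulled-back form. Linearity of the coproduct of \<open>Q\<close> comes
  early: without it a nested coproduct would not be known to be a form on \<open>Q\<close>.\<close>

lemma hopf_algebra_Q: "hopf_algebra Q"
proof (intro hopf_algebra.intro hopf_algebra_axioms.intro ring_Q module_Q)
  interpret Q: vspace Q by (rule vspace_Q)
  interpret QR: ring Q by (rule ring_Q)
  note pull [simp] = linear_form_pullback bilinear_form_pullback trilinear_form_pullback
  show smult_left: "(c \<odot>\<^bsub>Q\<^esub> u) \<otimes>\<^bsub>Q\<^esub> v = c \<odot>\<^bsub>Q\<^esub> (u \<otimes>\<^bsub>Q\<^esub> v)" if "u \<in> carrier Q" "v \<in> carrier Q" for c u v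
    using that by (elim Q_cases) (simp add: smult_mult_left flip: r_smult r_mult)
  show smult_right: "u \<otimes>\<^bsub>Q\<^esub> (c \<odot>\<^bsub>Q\<^esub> v) = c \<odot>\<^bsub>Q\<^esub> (u \<otimes>\<^bsub>Q\<^esub> v)" if "u \<in> carrier Q" "v \<in> carrier Q" for c u v
    using that by (elim Q_cases) (simp add: smult_mult_right flip: r_smult r_mult)
  show "comult Q u \<in> tensors Q (carrier Q \<times> carrier Q)" if "u \<in> carrier Q" for u
    using that by (rule comult_Q_closed)
  show comult_add_Q: "comult Q (u \<oplus>\<^bsub>Q\<^esub> v) \<beta> = comult Q u \<beta> + comult Q v \<beta>"
    if "u \<in> carrier Q" "v \<in> carrier Q" "bilinear_form Q \<beta>" for u v \<beta>
    using that by (elim Q_cases) (simp add: comult_add r_comult flip: r_add)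
  show comult_smult_Q: "comult Q (c \<odot>\<^bsub>Q\<^esub> u) \<beta> = c * comult Q u \<beta>"
    if "u \<in> carrier Q" "bilinear_form Q \<beta>" for c u \<beta>
    using that by (elim Q_cases) (simp add: comult_smult r_comult flip: r_smult)
  show "comult Q u (\<lambda>y z. comult Q y (\<lambda>y\<^sub>1 y\<^sub>2. \<gamma> y\<^sub>1 y\<^sub>2 z)) =
      comult Q u (\<lambda>y z. comult Q z (\<lambda>z\<^sub>1 z\<^sub>2. \<gamma> y z\<^sub>1 z\<^sub>2))"
    if "u \<in> carrier Q" and \<gamma>: "trilinear_form Q \<gamma>" for u \<gamma>
  proof -
    obtain x where x: "x \<in> carrier D" "u = r x" using \<open>u \<in> carrier Q\<close> by (rule Q_cases)
    have *: "\<And>x. x \<in> carrier Q \<Longrightarrow> bilinear_form Q (\<gamma> x)"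
      "\<And>y. y \<in> carrier Q \<Longrightarrow> bilinear_form Q (\<lambda>x z. \<gamma> x y z)"
      "\<And>z. z \<in> carrier Q \<Longrightarrow> bilinear_form Q (\<lambda>x y. \<gamma> x y z)"
      using \<gamma> by (auto simp: trilinear_form_def)
    have lin: "linear_form Q (\<lambda>x. comult Q x \<beta>)" if "bilinear_form Q \<beta>" for \<beta>
      using that by (simp add: linear_form_def comult_add_Q comult_smult_Q)
    note iter = Q.bilinear_form_iterated[OF comult_Q_closed lin \<gamma>]
    have "comult Q u (\<lambda>y z. comult Q y (\<lambda>y\<^sub>1 y\<^sub>2. \<gamma> y\<^sub>1 y\<^sub>2 z)) =
        comult D x (\<lambda>y z. comult D y (\<lambda>y\<^sub>1 y\<^sub>2. \<gamma> (r y\<^sub>1) (r y\<^sub>2) (r z)))"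
      unfolding x(2) by (rule r_comult_eq[OF x(1) iter(1)]) (simp_all add: r_comult * r_closed)
    also have "\<dots> = comult D x (\<lambda>y z. comult D z (\<lambda>z\<^sub>1 z\<^sub>2. \<gamma> (r y) (r z\<^sub>1) (r z\<^sub>2)))"
      by (rule coassoc) (use x \<gamma> in auto)
    also have "\<dots> = comult Q u (\<lambda>y z. comult Q z (\<lambda>z\<^sub>1 z\<^sub>2. \<gamma> y z\<^sub>1 z\<^sub>2))"
      unfolding x(2) by (rule r_comult_eq[OF x(1) iter(2), symmetric]) (simp_all add: r_comult * r_closed)
    finally show ?thesis .
  qed
  show counit_Q: "linear_form Q (counit Q)"
    unfolding linear_form_def
  proof (intro conjI ballI allI)
    show "counit Q (u \<oplus>\<^bsub>Q\<^esub> v) = counit Q u + counit Q v" if "u \<in> carrier Q" "v \<in> carrier Q" for u v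
      using that by (elim Q_cases) (simp add: r_counit linear_form_add[OF counit_linear] flip: r_add)
    show "counit Q (c \<odot>\<^bsub>Q\<^esub> u) = c * counit Q u" if "u \<in> carrier Q" for c u
      using that by (elim Q_cases) (simp add: r_counit linear_form_smult[OF counit_linear] flip: r_smult)
  qed
  show "comult Q u (\<lambda>y z. counit Q y * f z) = f u" if "u \<in> carrier Q" and f: "linear_form Q f" for u f
  proof -
    obtain x where x: "x \<in> carrier D" "u = r x" using \<open>u \<in> carrier Q\<close> by (rule Q_cases)
    have "comult Q u (\<lambda>y z. counit Q y * f z) = comult D x (\<lambda>y z. counit D y * f (r z))"
      unfolding x(2)
      by (rule r_comult_eq[OF x(1) Q.bilinear_form_times[OF counit_Q f]]) (simp add: r_counit)
    then show ?thesis using counit_left[OF x(1), of "\<lambda>z. f (r z)"] f x(2) by simp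
  qed
  show "comult Q u (\<lambda>y z. f y * counit Q z) = f u" if "u \<in> carrier Q" and f: "linear_form Q f" for u f
  proof -
    obtain x where x: "x \<in> carrier D" "u = r x" using \<open>u \<in> carrier Q\<close> by (rule Q_cases)
    have "comult Q u (\<lambda>y z. f y * counit Q z) = comult D x (\<lambda>y z. f (r y) * counit D z)"
      unfolding x(2)
      by (rule r_comult_eq[OF x(1) Q.bilinear_form_times[OF f counit_Q]]) (simp add: r_counit)
    then show ?thesis using counit_right[OF x(1), of "\<lambda>z. f (r z)"] f x(2) by simp
  qed
  show "comult Q \<one>\<^bsub>Q\<^esub> \<beta> = \<beta> \<one>\<^bsub>Q\<^esub> \<one>\<^bsub>Q\<^esub>" if "bilinear_form Q \<beta>" for \<beta>
    using that by (simp add: r_comult comult_one flip: r_one)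
  show "comult Q (u \<otimes>\<^bsub>Q\<^esub> v) \<beta> =
      comult Q u (\<lambda>u\<^sub>1 u\<^sub>2. comult Q v (\<lambda>v\<^sub>1 v\<^sub>2. \<beta> (u\<^sub>1 \<otimes>\<^bsub>Q\<^esub> v\<^sub>1) (u\<^sub>2 \<otimes>\<^bsub>Q\<^esub> v\<^sub>2)))"
    if "u \<in> carrier Q" "v \<in> carrier Q" and \<beta>: "bilinear_form Q \<beta>" for u v \<beta>
  proof -
    obtain x where x: "x \<in> carrier D" "u = r x" using \<open>u \<in> carrier Q\<close> by (rule Q_cases)
    obtain y where y: "y \<in> carrier D" "v = r y" using \<open>v \<in> carrier Q\<close> by (rule Q_cases)
    \<comment> \<open>The counterpart of \<open>bilinear_form_mult2\<close>, which is available only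
      in a Hopf algebra and so not yet in \<open>Q\<close>.\<close>
    have mult2: "bilinear_form Q (\<lambda>y\<^sub>1 y\<^sub>2. \<beta> (x\<^sub>1 \<otimes>\<^bsub>Q\<^esub> y\<^sub>1) (x\<^sub>2 \<otimes>\<^bsub>Q\<^esub> y\<^sub>2))"
      "bilinear_form Q (\<lambda>y\<^sub>1 y\<^sub>2. \<beta> (y\<^sub>1 \<otimes>\<^bsub>Q\<^esub> x\<^sub>1) (y\<^sub>2 \<otimes>\<^bsub>Q\<^esub> x\<^sub>2))"
      if "x\<^sub>1 \<in> carrier Q" "x\<^sub>2 \<in> carrier Q" for x\<^sub>1 x\<^sub>2
      using that \<beta> unfolding bilinear_form_def linear_form_def
      by (auto simp: QR.l_distr QR.r_distr smult_left smult_right)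
    have "comult Q (u \<otimes>\<^bsub>Q\<^esub> v) \<beta> = comult D (x \<otimes> y) (\<lambda>y z. \<beta> (r y) (r z))"
      using x y \<beta> by (simp add: r_comult flip: r_mult)
    also have "\<dots> = comult D x (\<lambda>x\<^sub>1 x\<^sub>2. comult D y (\<lambda>y\<^sub>1 y\<^sub>2. \<beta> (r (x\<^sub>1 \<otimes> y\<^sub>1)) (r (x\<^sub>2 \<otimes> y\<^sub>2))))"
      by (rule comult_mult) (use x y \<beta> in auto)
    also have "\<dots> = comult Q u (\<lambda>u\<^sub>1 u\<^sub>2. comult Q v (\<lambda>v\<^sub>1 v\<^sub>2. \<beta> (u\<^sub>1 \<otimes>\<^bsub>Q\<^esub> v\<^sub>1) (u\<^sub>2 \<otimes>\<^bsub>Q\<^esub> v\<^sub>2)))"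
      unfolding x(2)
    proof (rule r_comult_eq[OF x(1), symmetric])
      show "bilinear_form Q (\<lambda>u\<^sub>1 u\<^sub>2. comult Q v (\<lambda>v\<^sub>1 v\<^sub>2. \<beta> (u\<^sub>1 \<otimes>\<^bsub>Q\<^esub> v\<^sub>1) (u\<^sub>2 \<otimes>\<^bsub>Q\<^esub> v\<^sub>2)))"
        by (rule Q.tensor_bilinear[OF comult_Q_closed[OF \<open>v \<in> carrier Q\<close>] _ _ vspace_Q]; rule mult2; assumption)
      fix x\<^sub>1 x\<^sub>2 assume "x\<^sub>1 \<in> carrier D" "x\<^sub>2 \<in> carrier D"
      then show "comult Q v (\<lambda>v\<^sub>1 v\<^sub>2. \<beta> (r x\<^sub>1 \<otimes>\<^bsub>Q\<^esub> v\<^sub>1) (r x\<^sub>2 \<otimes>\<^bsub>Q\<^esub> v\<^sub>2)) =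
          comult D y (\<lambda>y\<^sub>1 y\<^sub>2. \<beta> (r (x\<^sub>1 \<otimes> y\<^sub>1)) (r (x\<^sub>2 \<otimes> y\<^sub>2)))"
        unfolding y(2) by (intro r_comult_eq[OF y(1) mult2(1)]) (simp_all add: r_closed r_mult)
    qed
    finally show ?thesis .
  qed
  show "counit Q \<one>\<^bsub>Q\<^esub> = 1"
    by (simp add: r_counit counit_one flip: r_one)
  show "counit Q (u \<otimes>\<^bsub>Q\<^esub> v) = counit Q u * counit Q v" if "u \<in> carrier Q" "v \<in> carrier Q" for u v
    using that by (elim Q_cases) (simp add: counit_mult r_counit flip: r_mult)
  show anti_closed: "antipode Q u \<in> carrier Q" if "u \<in> carrier Q" for u
    using that by (elim Q_cases) (simp add: r_antipode r_closed antipode_closed)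
  show anti_add: "antipode Q (u \<oplus>\<^bsub>Q\<^esub> v) = antipode Q u \<oplus>\<^bsub>Q\<^esub> antipode Q v"
    if "u \<in> carrier Q" "v \<in> carrier Q" for u v
    using that by (elim Q_cases) (simp add: r_antipode antipode_add antipode_closed flip: r_add)
  show anti_smult: "antipode Q (c \<odot>\<^bsub>Q\<^esub> u) = c \<odot>\<^bsub>Q\<^esub> antipode Q u" if "u \<in> carrier Q" for c u
    using that by (elim Q_cases) (simp add: r_antipode antipode_smult antipode_closed flip: r_smult)
  have bil: "bilinear_form Q (\<lambda>y z. f (antipode Q y \<otimes>\<^bsub>Q\<^esub> z))"
      "bilinear_form Q (\<lambda>y z. f (y \<otimes>\<^bsub>Q\<^esub> antipode Q z))" if "linear_form Q f" for f
    using that unfolding bilinear_form_def linear_form_def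
    by (auto simp: anti_add anti_smult anti_closed QR.l_distr QR.r_distr smult_left smult_right)
  show "comult Q u (\<lambda>y z. f (antipode Q y \<otimes>\<^bsub>Q\<^esub> z)) = counit Q u * f \<one>\<^bsub>Q\<^esub>"
    if "u \<in> carrier Q" and f: "linear_form Q f" for u f
  proof -
    obtain x where x: "x \<in> carrier D" "u = r x" using \<open>u \<in> carrier Q\<close> by (rule Q_cases)
    have "comult Q u (\<lambda>y z. f (antipode Q y \<otimes>\<^bsub>Q\<^esub> z)) = comult D x (\<lambda>y z. f (r (antipode D y \<otimes> z)))"
      unfolding x(2)
      by (rule r_comult_eq[OF x(1) bil(1)[OF f]]) (simp add: r_antipode r_mult antipode_closed)
    then show ?thesis
      using antipode_left[OF x(1), of "\<lambda>z. f (r z)"] f x(1) by (simp add: x(2) r_one r_counit)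
  qed
  show "comult Q u (\<lambda>y z. f (y \<otimes>\<^bsub>Q\<^esub> antipode Q z)) = counit Q u * f \<one>\<^bsub>Q\<^esub>"
    if "u \<in> carrier Q" and f: "linear_form Q f" for u f
  proof -
    obtain x where x: "x \<in> carrier D" "u = r x" using \<open>u \<in> carrier Q\<close> by (rule Q_cases)
    have "comult Q u (\<lambda>y z. f (y \<otimes>\<^bsub>Q\<^esub> antipode Q z)) = comult D x (\<lambda>y z. f (r (y \<otimes> antipode D z)))"
      unfolding x(2)
      by (rule r_comult_eq[OF x(1) bil(2)[OF f]]) (simp add: r_antipode r_mult antipode_closed)
    then show ?thesis
      using antipode_right[OF x(1), of "\<lambda>z. f (r z)"] f x(1) by (simp add: x(2) r_one r_counit)
  qed
qed

end

section \<open>The graded dual\<close>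

lemma graded_dual_simps [simp]:
  "monoid.mult (graded_dual H gr) f g = restr_form (carrier H) (\<lambda>x. comult H x (\<lambda>y z. f y * g z))"
  "one (graded_dual H gr) = restr_form (carrier H) (counit H)"
  "zero (graded_dual H gr) = (\<lambda>x. 0)"
  "add (graded_dual H gr) f g = (\<lambda>x. f x + g x)"
  "smult (graded_dual H gr) c f = (\<lambda>x. c * f x)"
  "counit (graded_dual H gr) f = f \<one>\<^bsub>H\<^esub>"
  "antipode (graded_dual H gr) f = restr_form (carrier H) (\<lambda>x. f (antipode H x))"
  by (simp_all add: graded_dual_def graded_dual_algebra_def Let_def)

lemma carrier_graded_dual:
  "f \<in> carrier (graded_dual H gr) \<longleftrightarrow> linear_form H f \<and> (\<forall>x. x \<notin> carrier H \<longrightarrow> f x = 0) \<and>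
    (\<exists>N. \<forall>n>N. \<forall>x\<in>gr n. f x = 0)"
  by (simp add: graded_dual_def graded_dual_algebra_def Let_def)

text \<open>The coproduct of the graded dual is chosen in the tensor square of the record
  \<open>graded_dual_algebra\<close>. The two records have the same underlying vector space, hence
  the same bilinear forms and tensors, and \<open>comult_graded_dual\<close> can speak of the full
  record alone.\<close>

lemma bilinear_form_graded_dual:
  "bilinear_form (graded_dual H gr) \<beta> \<longleftrightarrow> bilinear_form (graded_dual_algebra H gr) \<beta>"
  by (simp add: bilinear_form_def linear_form_def graded_dual_def graded_dual_algebra_def Let_def)

lemma tensors_graded_dual: "tensors (graded_dual H gr) T = tensors (graded_dual_algebra H gr) T"
  by (simp add: tensors_def bilinear_form_graded_dual)

lemma comult_graded_dual:
  "comult (graded_dual H gr) f =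
    (SOME t. t \<in> tensors (graded_dual H gr) (carrier (graded_dual H gr) \<times> carrier (graded_dual H gr)) \<and>
      (\<forall>x\<in>carrier H. \<forall>y\<in>carrier H. t (\<lambda>g h. g x * h y) = f (x \<otimes>\<^bsub>H\<^esub> y)))"
proof -
  have "carrier (graded_dual H gr) = carrier (graded_dual_algebra H gr)"
    by (simp add: graded_dual_def Let_def)
  then show ?thesis
    unfolding tensors_graded_dual by (simp add: graded_dual_def Let_def)
qed

lemma linear_form_restr:
  assumes "vspace V" "linear_form V f"
  shows "linear_form V (restr_form (carrier V) f)"
  by (rule vspace.linear_form_cong_carrier[OF assms]) (simp add: restr_form_def)

lemma module_graded_dual:
  assumes "vspace V"
  shows "module scalars (graded_dual V gr)"
proof (rule moduleI[OF cring_scalars])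
  interpret vspace V by fact
  let ?D = "graded_dual V gr"
  have add: "(\<lambda>x. f x + g x) \<in> carrier ?D" if fg: "f \<in> carrier ?D" "g \<in> carrier ?D" for f g
  proof -
    obtain N M where "\<forall>n>N. \<forall>x\<in>gr n. f x = 0" "\<forall>n>M. \<forall>x\<in>gr n. g x = 0"
      using fg by (auto simp: carrier_graded_dual)
    then have "\<forall>n>max N M. \<forall>x\<in>gr n. f x + g x = 0" by auto
    moreover have "linear_form V (\<lambda>x. f x + g x)"
      using fg by (auto simp: carrier_graded_dual linear_form_def algebra_simps)
    ultimately show ?thesis
      using fg unfolding carrier_graded_dual by (intro conjI exI[of _ "max N M"]) auto
  qed
  have smult: "(\<lambda>x. c * f x) \<in> carrier ?D" if f: "f \<in> carrier ?D" for c f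
  proof -
    obtain N where "\<forall>n>N. \<forall>x\<in>gr n. f x = 0"
      using f by (auto simp: carrier_graded_dual)
    then show ?thesis
      using f unfolding carrier_graded_dual by (intro conjI linear_form_cmult exI[of _ N]) auto
  qed
  show "abelian_group ?D"
  proof (rule abelian_groupI)
    show "\<zero>\<^bsub>?D\<^esub> \<in> carrier ?D"
      by (simp add: carrier_graded_dual linear_form_def)
    show "\<exists>g\<in>carrier ?D. g \<oplus>\<^bsub>?D\<^esub> f = \<zero>\<^bsub>?D\<^esub>" if "f \<in> carrier ?D" for f
      by (rule bexI[OF _ smult[OF that, of "-1"]]) simp
  qed (simp_all add: add algebra_simps)
  show "c \<odot>\<^bsub>?D\<^esub> f \<in> carrier ?D" if "f \<in> carrier ?D" for c f
    using smult[OF that] by simp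
qed (simp_all add: algebra_simps)

lemma linear_form_eval: "linear_form (graded_dual H gr) (\<lambda>f. f x)"
  by (simp add: linear_form_def)

section \<open>Homogeneous bases\<close>

locale homogeneous_basis = graded_connected_hopf_algebra H gr
  for H :: "('k::field, 'v) hopf" (structure) and gr +
  fixes I :: "'i set" and e :: "'i \<Rightarrow> 'v" and deg :: "'i \<Rightarrow> nat"
  assumes vbasis: "vbasis H I e"
    and basis_deg: "i \<in> I \<Longrightarrow> e i \<in> gr (deg i)"

sublocale homogeneous_basis \<subseteq> based_space H I e
  by unfold_locales (rule vbasis)

context homogeneous_basis
begin

lemma gr_closed: "x \<in> gr n \<Longrightarrow> x \<in> carrier H"
  using submoduleE(1)[OF gr_subspace] by blast

lemma vec_gr: "finite {i. c i \<noteq> 0} \<Longrightarrow> {i. c i \<noteq> 0} \<subseteq> {i \<in> I. deg i = n} \<Longrightarrow> vec c \<in> gr n"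
  unfolding vec_def
  by (intro subspace_finsum[OF gr_subspace]) (auto intro!: submoduleE(4)[OF gr_subspace] basis_deg)

text \<open>Grouping the expansion of \<open>x\<close> by degree gives homogeneous elements
  \<open>vec (c m)\<close> with sum \<open>x\<close>. Subtracting \<open>x\<close> in degree
  \<open>n\<close> yields a vanishing sum of homogeneous elements, and since the sum of the
  components is direct, \<open>vec (c m)\<close> is zero for all other \<open>m\<close>.\<close>

lemma gr_coord:
  assumes "x \<in> gr n" "coord x j \<noteq> 0"
  shows "deg j = n"
proof (rule ccontr)
  assume ne: "deg j \<noteq> n"
  have x: "x \<in> carrier H" using assms(1) by (rule gr_closed)
  define c where "c m i = (if deg i = m then coord x i else 0)" for m i
  have sub: "{i. c m i \<noteq> 0} \<subseteq> {i \<in> I. deg i = m}" for m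
    using coord_support[OF x] by (auto simp: c_def)
  have fin: "finite {i. c m i \<noteq> 0}" for m
    by (rule finite_subset[OF _ finite_coord[OF x]]) (auto simp: c_def)
  have sub': "{i. c m i \<noteq> 0} \<subseteq> I" for m using sub by blast
  define h where "h m = (if m = n then vec (c m) \<ominus> x else vec (c m))" for m
  \<comment> \<open>The insertion of \<open>n\<close> ensures that the degree in which
    \<open>x\<close> is subtracted is part of the sum.\<close>
  define N where "N = Max (insert n (deg ` {i. coord x i \<noteq> 0}))"
  have N: "n \<le> N" "\<And>i. coord x i \<noteq> 0 \<Longrightarrow> deg i \<le> N"
    unfolding N_def by (rule Max_ge; simp add: finite_coord[OF x])+
  have gr_sub: "u \<ominus> v \<in> gr m" if "u \<in> gr m" "v \<in> gr m" for u v m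
    unfolding a_minus_def using submoduleE(3,5)[OF gr_subspace] that by blast
  have h: "\<forall>m. h m \<in> gr m"
    unfolding h_def using vec_gr[OF fin sub] gr_sub assms(1) by auto
  then have hc: "h m \<in> carrier H" for m using gr_closed by blast
  have "(\<Oplus>m\<in>{..N}. h m) = \<zero>"
  proof (rule coord_eqI)
    show "coord (\<Oplus>m\<in>{..N}. h m) = coord \<zero>"
    proof
      fix i
      have "coord (\<Oplus>m\<in>{..N}. h m) i = (\<Sum>m\<le>N. coord (h m) i)"
        using hc by (intro coord_sum) auto
      also have "\<dots> = (\<Sum>m\<le>N. c m i - (if m = n then coord x i else 0))"
        by (intro sum.cong refl)
          (simp add: h_def coord_minus vec_closed[OF sub'] x coord_vec[OF fin sub'])
      also have "\<dots> = (if deg i \<le> N then coord x i else 0) - coord x i"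
        using N(1) by (simp add: sum_subtractf c_def)
      also have "\<dots> = coord \<zero> i" using N(2)[of i] by (auto simp: coord_zero)
      finally show "coord (\<Oplus>m\<in>{..N}. h m) i = coord \<zero> i" .
    qed
  qed (use hc in \<open>auto intro: abelian_monoid.finsum_closed[OF abelian_group.axioms(1)[OF abelian_group_H]]\<close>)
  from gr_indep[OF h this, of "deg j"] have "h (deg j) = \<zero>"
    using N(2)[OF assms(2)] by simp
  then have "coord (vec (c (deg j))) j = 0"
    using ne by (simp add: h_def coord_zero)
  then show False
    using assms(2) by (simp add: coord_vec[OF fin sub'] c_def)
qed

lemma gr_iff: "x \<in> gr n \<longleftrightarrow> x \<in> carrier H \<and> (\<forall>i. coord x i \<noteq> 0 \<longrightarrow> deg i = n)"
proof safe
  assume x: "x \<in> carrier H" "\<forall>i. coord x i \<noteq> 0 \<longrightarrow> deg i = n"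
  then have "vec (coord x) \<in> gr n"
    using coord_support[OF x(1)] finite_coord[OF x(1)] by (intro vec_gr) auto
  then show "x \<in> gr n" using x by (simp add: vec_coord)
qed (auto simp: gr_closed gr_coord)

end

text \<open>Finite-dimensional components make the coordinate forms a basis of the graded dual and
  its coproduct a finite sum of pure tensors.\<close>

locale graded_hopf_basis = homogeneous_basis H gr I e deg
  for H :: "('k::field, 'v) hopf" (structure) and gr and I :: "'i set" and e deg +
  assumes finite_deg: "finite {i \<in> I. deg i = n}"
begin

lemma finite_deg_le: "finite {i \<in> I. deg i \<le> N}"
proof -
  have "{i \<in> I. deg i \<le> N} = (\<Union>n\<in>{..N}. {i \<in> I. deg i = n})" by auto
  then show ?thesis using finite_deg by simp
qed

section \<open>The dual basis of the graded dual\<close>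

abbreviation D :: "('k, 'v \<Rightarrow> 'k) hopf" where "D \<equiv> graded_dual H gr"

definition dual :: "'i \<Rightarrow> 'v \<Rightarrow> 'k" where
  "dual i = restr_form (carrier H) (\<lambda>x. coord x i)"

lemma vspace_D: "vspace D"
  by (rule vspace.intro[OF module_graded_dual[OF vspace_H]])

sublocale D: vspace D by (rule vspace_D)

lemma dual_closed: "dual i \<in> carrier D"
proof -
  have "\<forall>n>deg i. \<forall>x\<in>gr n. dual i x = 0"
    using gr_coord by (auto simp: dual_def restr_form_def)
  moreover have "linear_form H (dual i)"
    unfolding dual_def by (rule linear_form_restr[OF vspace_H linear_form_coord])
  ultimately show ?thesis
    unfolding carrier_graded_dual by (intro conjI exI[of _ "deg i"]) (auto simp: dual_def restr_form_def)
qed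

lemma D_linear: "f \<in> carrier D \<Longrightarrow> linear_form H f"
  by (simp add: carrier_graded_dual)

lemma D_eqI:
  assumes "f \<in> carrier D" "g \<in> carrier D" "\<And>x. x \<in> carrier H \<Longrightarrow> f x = g x"
  shows "f = g"
proof
  show "f x = g x" for x
    using assms by (cases "x \<in> carrier H") (auto simp: carrier_graded_dual)
qed

lemma D_bounded:
  assumes "f \<in> carrier D"
  obtains N where "\<And>n x. N < n \<Longrightarrow> x \<in> gr n \<Longrightarrow> f x = 0"
  using assms unfolding carrier_graded_dual by blast

text \<open>A form in the graded dual vanishes on the basis vectors of large degree, and only
  finitely many remain. The coefficients are forced by evaluation at the basis vectors.\<close>

lemma vbasis_D: "vbasis D I dual"
  unfolding vbasis_def
proof (intro conjI ballI)
  show "dual \<in> I \<rightarrow> carrier D" using dual_closed by blast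
  fix f assume f: "f \<in> carrier D"
  obtain N where "\<And>n x. N < n \<Longrightarrow> x \<in> gr n \<Longrightarrow> f x = 0" by (rule D_bounded[OF f]) blast
  then have N: "f (e i) = 0" if "i \<in> I" "N < deg i" for i
    using that basis_deg by blast
  \<comment> \<open>Set to 0 outside \<open>I\<close>, because the support of a coefficient family
    must lie in \<open>I\<close>.\<close>
  define c where "c i = (if i \<in> I then f (e i) else 0)" for i
  have "{i. c i \<noteq> 0} \<subseteq> {i \<in> I. deg i \<le> N}"
    using N by (auto simp: c_def split: if_splits intro: leI)
  then have c: "finite {i. c i \<noteq> 0}" "{i. c i \<noteq> 0} \<subseteq> I"
    using finite_deg_le finite_subset by auto
  have sum: "(\<Oplus>\<^bsub>D\<^esub>i\<in>{i. d i \<noteq> 0}. d i \<odot>\<^bsub>D\<^esub> dual i) x = (\<Sum>i | d i \<noteq> 0. d i * coord x i)"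
    if "finite {i. d i \<noteq> 0}" "x \<in> carrier H" for d x
  proof -
    have "(\<Oplus>\<^bsub>D\<^esub>i\<in>{i. d i \<noteq> 0}. d i \<odot>\<^bsub>D\<^esub> dual i) x = (\<Sum>i | d i \<noteq> 0. (d i \<odot>\<^bsub>D\<^esub> dual i) x)"
      using that(1) by (intro D.linear_form_finsum[OF linear_form_eval]) (auto intro!: dual_closed D.smult_closed simp del: graded_dual_simps)
    then show ?thesis using that(2) by (simp add: dual_def restr_form_def)
  qed
  have sum_basis: "(\<Sum>i | d i \<noteq> 0. d i * coord (e j) i) = d j"
    if "finite {i. d i \<noteq> 0}" "j \<in> I" for d :: "'i \<Rightarrow> 'k" and j
    using that by (simp add: coord_basis if_distrib sum.delta cong: if_cong)
  show "\<exists>!c. finite {i. c i \<noteq> 0} \<and> {i. c i \<noteq> 0} \<subseteq> I \<and> f = (\<Oplus>\<^bsub>D\<^esub>i\<in>{i. c i \<noteq> 0}. c i \<odot>\<^bsub>D\<^esub> dual i)"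
  proof (intro ex1I[of _ c] conjI c)
    have cl: "(\<Oplus>\<^bsub>D\<^esub>i\<in>{i. c i \<noteq> 0}. c i \<odot>\<^bsub>D\<^esub> dual i) \<in> carrier D"
      by (intro D.M.finsum_closed) (auto intro!: dual_closed D.smult_closed simp del: graded_dual_simps)
    show "f = (\<Oplus>\<^bsub>D\<^esub>i\<in>{i. c i \<noteq> 0}. c i \<odot>\<^bsub>D\<^esub> dual i)"
    proof (rule D_eqI[OF f cl], rule linear_form_eqI[OF D_linear[OF f] D_linear[OF cl]])
      show "f (e i) = (\<Oplus>\<^bsub>D\<^esub>i\<in>{i. c i \<noteq> 0}. c i \<odot>\<^bsub>D\<^esub> dual i) (e i)" if "i \<in> I" for i
        using that c(1) sum_basis[of c i] by (simp add: sum del: graded_dual_simps) (simp add: c_def)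
    qed
    fix d assume d: "finite {i. d i \<noteq> 0} \<and> {i. d i \<noteq> 0} \<subseteq> I \<and>
      f = (\<Oplus>\<^bsub>D\<^esub>i\<in>{i. d i \<noteq> 0}. d i \<odot>\<^bsub>D\<^esub> dual i)"
    show "d = c"
    proof
      fix i show "d i = c i"
      proof (cases "i \<in> I")
        case True
        have "f (e i) = (\<Oplus>\<^bsub>D\<^esub>i\<in>{i. d i \<noteq> 0}. d i \<odot>\<^bsub>D\<^esub> dual i) (e i)"
          by (rule fun_cong[OF conjunct2[OF conjunct2[OF d]]])
        also have "\<dots> = d i"
          unfolding sum[OF conjunct1[OF d] basis_closed[OF True]]
          by (rule sum_basis[OF conjunct1[OF d] True])
        finally show ?thesis using True by (simp add: c_def)
      next
        case False
        then show ?thesis using conjunct1[OF conjunct2[OF d]] unfolding c_def by auto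
      qed
    qed
  qed
qed

sublocale D: based_space D I dual
  by unfold_locales (rule vbasis_D)

lemma D_coord:
  assumes "f \<in> carrier D" "i \<in> I"
  shows "D.coord f i = f (e i)"
  by (rule D.linear_form_eqI[OF D.linear_form_coord linear_form_eval])
    (use assms in \<open>simp_all add: D.coord_basis, simp_all add: dual_def restr_form_def coord_basis\<close>)

text \<open>Coordinates in the dual basis are values at basis vectors, so evaluation at pairs of
  vectors of \<open>H\<close> separates tensors over \<open>D\<close>. The identities for the
  coproduct of \<open>D\<close> are reduced to \<open>H\<close> in this way.\<close>

lemma D_tensor_eqI:
  assumes "set ps \<subseteq> carrier D \<times> carrier D" "set qs \<subseteq> carrier D \<times> carrier D"
    and "\<And>x y. x \<in> carrier H \<Longrightarrow> y \<in> carrier H \<Longrightarrow>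
      (\<Sum>(g, h)\<leftarrow>ps. g x * h y) = (\<Sum>(g, h)\<leftarrow>qs. g x * h y)"
    and "bilinear_form D \<beta>"
  shows "(\<Sum>(g, h)\<leftarrow>ps. \<beta> g h) = (\<Sum>(g, h)\<leftarrow>qs. \<beta> g h)"
proof (rule D.tensor_eqI[OF assms(1,2) _ assms(4)])
  fix i j assume ij: "i \<in> I" "j \<in> I"
  have "(\<Sum>(g, h)\<leftarrow>rs. D.coord g i * D.coord h j) = (\<Sum>(g, h)\<leftarrow>rs. g (e i) * h (e j))"
    if "set rs \<subseteq> carrier D \<times> carrier D" for rs
    by (rule arg_cong[where f = sum_list], rule map_cong[OF refl])
      (use ij in \<open>auto simp: D_coord dest!: subsetD[OF that]\<close>)
  then show "(\<Sum>(g, h)\<leftarrow>ps. D.coord g i * D.coord h j) = (\<Sum>(g, h)\<leftarrow>qs. D.coord g i * D.coord h j)"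
    using assms(1-3) ij by simp
qed

lemma D_tensor3_eqI:
  assumes "set ps \<subseteq> carrier D \<times> carrier D \<times> carrier D" "set qs \<subseteq> carrier D \<times> carrier D \<times> carrier D"
    and "\<And>x y z. x \<in> carrier H \<Longrightarrow> y \<in> carrier H \<Longrightarrow> z \<in> carrier H \<Longrightarrow>
      (\<Sum>(f, g, h)\<leftarrow>ps. f x * g y * h z) = (\<Sum>(f, g, h)\<leftarrow>qs. f x * g y * h z)"
    and "trilinear_form D \<gamma>"
  shows "(\<Sum>(f, g, h)\<leftarrow>ps. \<gamma> f g h) = (\<Sum>(f, g, h)\<leftarrow>qs. \<gamma> f g h)"
proof (rule D.tensor3_eqI[OF assms(1,2) _ assms(4)])
  fix i j k assume ijk: "i \<in> I" "j \<in> I" "k \<in> I"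
  have "(\<Sum>(f, g, h)\<leftarrow>rs. D.coord f i * D.coord g j * D.coord h k) =
      (\<Sum>(f, g, h)\<leftarrow>rs. f (e i) * g (e j) * h (e k))"
    if "set rs \<subseteq> carrier D \<times> carrier D \<times> carrier D" for rs
    by (rule arg_cong[where f = sum_list], rule map_cong[OF refl])
      (use ijk in \<open>auto simp: D_coord dest!: subsetD[OF that]\<close>)
  then show "(\<Sum>(f, g, h)\<leftarrow>ps. D.coord f i * D.coord g j * D.coord h k) =
      (\<Sum>(f, g, h)\<leftarrow>qs. D.coord f i * D.coord g j * D.coord h k)"
    using assms(1-3) ijk by simp
qed

lemma D_linear_form_sum_list:
  assumes "linear_form D k" "set hs \<subseteq> carrier D"
  shows "(\<lambda>x. \<Sum>h\<leftarrow>hs. h x) \<in> carrier D \<and> k (\<lambda>x. \<Sum>h\<leftarrow>hs. h x) = (\<Sum>h\<leftarrow>hs. k h)"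
  using assms(2)
proof (induction hs)
  case Nil
  then show ?case
    using D.linear_form_zero[OF assms(1)] D.M.zero_closed by simp
next
  case (Cons h hs)
  let ?s = "\<lambda>x. \<Sum>h\<leftarrow>hs. h x"
  have h: "h \<in> carrier D" and s: "?s \<in> carrier D" and k: "k ?s = (\<Sum>h\<leftarrow>hs. k h)"
    using Cons by auto
  have "(\<lambda>x. \<Sum>h\<leftarrow>h # hs. h x) = h \<oplus>\<^bsub>D\<^esub> ?s" by simp
  then show ?case
    using D.M.a_closed[OF h s] D.linear_form_add[OF assms(1) h s] k by simp
qed

text \<open>If \<open>f\<close> vanishes above degree \<open>N\<close> and \<open>g\<close> above
  degree \<open>M\<close>, then in total degree above \<open>N + M\<close> each pure tensor of the
  coproduct has its left degree above \<open>N\<close> or its right degree above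
  \<open>M\<close>.\<close>

lemma D_mult_closed:
  assumes f: "f \<in> carrier D" and g: "g \<in> carrier D"
  shows "f \<otimes>\<^bsub>D\<^esub> g \<in> carrier D"
proof -
  obtain N where N: "\<And>n x. N < n \<Longrightarrow> x \<in> gr n \<Longrightarrow> f x = 0" by (rule D_bounded[OF f]) blast
  obtain M where M: "\<And>n x. M < n \<Longrightarrow> x \<in> gr n \<Longrightarrow> g x = 0" by (rule D_bounded[OF g]) blast
  have bil: "bilinear_form H (\<lambda>y z. f y * g z)"
    using f g by (intro bilinear_form_times D_linear)
  have "comult H x (\<lambda>y z. f y * g z) = 0" if "N + M < n" "x \<in> gr n" for n x
  proof -
    obtain ps where ps: "set ps \<subseteq> (\<Union>i\<le>n. gr i \<times> gr (n - i))"
      "\<And>\<beta>. bilinear_form H \<beta> \<Longrightarrow> comult H x \<beta> = (\<Sum>(y, z)\<leftarrow>ps. \<beta> y z)"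
      by (rule tensorsE[OF gr_comult[OF \<open>x \<in> gr n\<close>]]) (rule that; simp)
    have "f y * g z = 0" if yz: "(y, z) \<in> set ps" for y z
    proof -
      have "(y, z) \<in> (\<Union>i\<le>n. gr i \<times> gr (n - i))"
        using ps(1) yz by (rule subsetD)
      then obtain i where i: "y \<in> gr i" "z \<in> gr (n - i)" by (elim UN_E SigmaE2) (rule that)
      show ?thesis
      proof (cases "N < i")
        case True
        then show ?thesis using N[OF True i(1)] by simp
      next
        case False
        then have "M < n - i" using \<open>N + M < n\<close> by simp
        then show ?thesis using M[OF _ i(2)] by simp
      qed
    qed
    then have "(\<Sum>(y, z)\<leftarrow>ps. f y * g z) = (\<Sum>p\<leftarrow>ps. 0)"
      by (intro arg_cong[where f = sum_list] map_cong) (simp_all add: case_prod_unfold)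
    then show ?thesis unfolding ps(2)[OF bil] by simp
  qed
  then show ?thesis
    unfolding carrier_graded_dual graded_dual_simps
    by (intro conjI exI[of _ "N + M"] linear_form_restr[OF vspace_H] linear_form_comult bil)
      (simp_all add: restr_form_def)
qed

lemma D_one_closed: "\<one>\<^bsub>D\<^esub> \<in> carrier D"
  unfolding carrier_graded_dual graded_dual_simps
  by (intro conjI exI[of _ 0] linear_form_restr[OF vspace_H] counit_linear)
    (simp_all add: restr_form_def gr_counit)

lemma D_antipode_closed:
  assumes f: "f \<in> carrier D"
  shows "antipode D f \<in> carrier D"
proof -
  obtain N where N: "\<And>n x. N < n \<Longrightarrow> x \<in> gr n \<Longrightarrow> f x = 0" by (rule D_bounded[OF f]) blast
  have "linear_form H (\<lambda>x. f (antipode H x))"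
    using D_linear[OF f] by (simp add: linear_form_def antipode_add antipode_smult antipode_closed)
  then show ?thesis
    using N gr_antipode unfolding carrier_graded_dual graded_dual_simps
    by (intro conjI exI[of _ N] linear_form_restr[OF vspace_H]) (auto simp: restr_form_def)
qed

lemma D_smult_closed: "f \<in> carrier D \<Longrightarrow> c \<odot>\<^bsub>D\<^esub> f \<in> carrier D"
  by (rule D.smult_closed) simp_all

text \<open>The bilinear form that sends \<open>x\<close>, \<open>y\<close> to the value of
  \<open>f\<close> at their product vanishes on basis pairs of total degree above \<open>N\<close>.
  So it is a finite combination of products of dual basis elements, with its values at basis pairs
  as coefficients.\<close>

lemma ex_D_comult:
  assumes f: "f \<in> carrier D"
  shows "\<exists>t. t \<in> tensors D (carrier D \<times> carrier D) \<and>
    (\<forall>x\<in>carrier H. \<forall>y\<in>carrier H. t (\<lambda>g h. g x * h y) = f (x \<otimes> y))"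
proof -
  obtain N where "\<And>n x. N < n \<Longrightarrow> x \<in> gr n \<Longrightarrow> f x = 0" by (rule D_bounded[OF f]) blast
  then have N: "f (e i \<otimes> e j) = 0" if "i \<in> I" "j \<in> I" "N < deg i + deg j" for i j
    using gr_mult[OF basis_deg basis_deg] that by blast
  \<comment> \<open>Bounding each degree separately gives a square of a finite set that contains all
    pairs of total degree at most \<open>N\<close>.\<close>
  define F where "F = {i \<in> I. deg i \<le> N}"
  have F: "finite F" "F \<subseteq> I" by (auto simp: F_def finite_deg_le)
  then obtain js where js: "set js = F \<times> F" "distinct js"
    using finite_distinct_list[of "F \<times> F"] by auto
  define ps where "ps = map (\<lambda>(i, j). (f (e i \<otimes> e j) \<odot>\<^bsub>D\<^esub> dual i, dual j)) js"
  let ?t = "\<lambda>\<beta>. \<Sum>(g, h)\<leftarrow>ps. \<beta> g h"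
  have "?t \<in> tensors D (carrier D \<times> carrier D)"
    by (rule tensorsI[of ps]) (auto simp: ps_def simp del: graded_dual_simps intro!: dual_closed D_smult_closed)
  moreover have "?t (\<lambda>g h. g x * h y) = f (x \<otimes> y)" if xy: "x \<in> carrier H" "y \<in> carrier H" for x y
  proof -
    \<comment> \<open>Large enough to expand \<open>x\<close> and \<open>y\<close> as well; the
      pairs added to \<open>F\<close> contribute 0 by \<open>N\<close>.\<close>
    define G where "G = F \<union> {i. coord x i \<noteq> 0} \<union> {i. coord y i \<noteq> 0}"
    have G: "finite G" "G \<subseteq> I" "F \<subseteq> G"
      using F finite_coord[OF xy(1)] finite_coord[OF xy(2)] coord_support[OF xy(1)] coord_support[OF xy(2)]
      unfolding G_def by auto
    have "?t (\<lambda>g h. g x * h y) = (\<Sum>(i, j)\<leftarrow>js. coord x i * coord y j * f (e i \<otimes> e j))"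
      unfolding ps_def map_map comp_def
      by (rule arg_cong[where f = sum_list], rule map_cong[OF refl])
        (use xy in \<open>auto simp: dual_def restr_form_def\<close>)
    also have "\<dots> = (\<Sum>(i, j)\<in>F \<times> F. coord x i * coord y j * f (e i \<otimes> e j))"
      unfolding js(1)[symmetric] by (rule sum.distinct_set_conv_list[OF js(2), symmetric])
    also have "\<dots> = (\<Sum>(i, j)\<in>G \<times> G. coord x i * coord y j * f (e i \<otimes> e j))"
    proof (rule sum.mono_neutral_left)
      show "\<forall>p\<in>G \<times> G - F \<times> F. (case p of (i, j) \<Rightarrow> coord x i * coord y j * f (e i \<otimes> e j)) = 0"
      proof
        fix p assume "p \<in> G \<times> G - F \<times> F"
        then obtain i j where p: "p = (i, j)" "i \<in> G" "j \<in> G" "i \<notin> F \<or> j \<notin> F" by blast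
        then have "f (e i \<otimes> e j) = 0"
          using G(2) by (intro N) (auto simp: F_def)
        then show "(case p of (i, j) \<Rightarrow> coord x i * coord y j * f (e i \<otimes> e j)) = 0"
          by (simp add: p)
      qed
    qed (use G in auto)
    also have "\<dots> = f (x \<otimes> y)"
      unfolding sum.cartesian_product[symmetric]
      by (rule bilinear_form_expansion[OF bilinear_form_mult[OF D_linear[OF f]] xy G(1,2), symmetric])
        (auto simp: G_def)
    finally show ?thesis .
  qed
  ultimately show ?thesis by blast
qed

lemma D_comult_spec:
  assumes "f \<in> carrier D"
  shows D_comult_closed: "comult D f \<in> tensors D (carrier D \<times> carrier D)"
    and D_comult_eval: "x \<in> carrier H \<Longrightarrow> y \<in> carrier H \<Longrightarrow> comult D f (\<lambda>g h. g x * h y) = f (x \<otimes> y)"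
  using someI_ex[OF ex_D_comult[OF assms], folded comult_graded_dual] by blast+

section \<open>Representing lists for the dual coproduct\<close>

lemma bilinear_form_eval: "bilinear_form D (\<lambda>g h. g x * h y)"
  by (rule D.bilinear_form_times[OF linear_form_eval linear_form_eval])

text \<open>Sweedler notation for the coproduct of \<open>f\<close>. The list carries both of its
  descriptions: as a functional on bilinear forms on \<open>D\<close>, and as a function of two
  vectors of \<open>H\<close>.\<close>

definition coproduct_list :: "('v \<Rightarrow> 'k) \<Rightarrow> (('v \<Rightarrow> 'k) \<times> ('v \<Rightarrow> 'k)) list \<Rightarrow> bool" where
  "coproduct_list f ps \<longleftrightarrow> set ps \<subseteq> carrier D \<times> carrier D \<and>
    (\<forall>\<beta>. bilinear_form D \<beta> \<longrightarrow> comult D f \<beta> = (\<Sum>(g, h)\<leftarrow>ps. \<beta> g h)) \<and>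
    (\<forall>x\<in>carrier H. \<forall>y\<in>carrier H. (\<Sum>(g, h)\<leftarrow>ps. g x * h y) = f (x \<otimes> y))"

lemma coproduct_listD:
  assumes "coproduct_list f ps"
  shows "set ps \<subseteq> carrier D \<times> carrier D"
    and "bilinear_form D \<beta> \<Longrightarrow> comult D f \<beta> = (\<Sum>(g, h)\<leftarrow>ps. \<beta> g h)"
    and "x \<in> carrier H \<Longrightarrow> y \<in> carrier H \<Longrightarrow> (\<Sum>(g, h)\<leftarrow>ps. g x * h y) = f (x \<otimes> y)"
  using assms by (simp_all add: coproduct_list_def)

lemma D_comultE:
  assumes "f \<in> carrier D"
  obtains ps where "coproduct_list f ps"
proof (rule tensorsE[OF D_comult_closed[OF assms]])
  fix ps assume ps: "set ps \<subseteq> carrier D \<times> carrier D"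
    "\<And>\<beta>. bilinear_form D \<beta> \<Longrightarrow> comult D f \<beta> = (\<Sum>(g, h)\<leftarrow>ps. \<beta> g h)"
  then have "coproduct_list f ps"
    unfolding coproduct_list_def using D_comult_eval[OF assms, unfolded ps(2)[OF bilinear_form_eval]]
    by simp
  then show thesis by (rule that)
qed

text \<open>Although the coproduct is a choice, evaluations separate tensors, so every list with the
  right evaluations represents it.\<close>

lemma D_comult_eqI:
  assumes f: "f \<in> carrier D" and ps: "set ps \<subseteq> carrier D \<times> carrier D"
    and eq: "\<And>x y. x \<in> carrier H \<Longrightarrow> y \<in> carrier H \<Longrightarrow> (\<Sum>(g, h)\<leftarrow>ps. g x * h y) = f (x \<otimes> y)"
    and \<beta>: "bilinear_form D \<beta>"
  shows "comult D f \<beta> = (\<Sum>(g, h)\<leftarrow>ps. \<beta> g h)"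
proof -
  obtain qs where "coproduct_list f qs" by (rule D_comultE[OF f])
  note qs = coproduct_listD[OF this]
  show ?thesis
    unfolding qs(2)[OF \<beta>]
    by (rule D_tensor_eqI[OF qs(1) ps _ \<beta>]) (simp add: qs(3) eq)
qed

text \<open>The choices for \<open>f\<close>, \<open>g\<close> and their sum are independent of each
  other. Concatenated lists have the evaluations required for the sum, and lists with scaled left
  factors those for a multiple.\<close>

lemma D_linear_form_comult:
  assumes \<beta>: "bilinear_form D \<beta>"
  shows "linear_form D (\<lambda>f. comult D f \<beta>)"
  unfolding linear_form_def
proof (intro conjI ballI allI)
  fix f g assume f: "f \<in> carrier D" and g: "g \<in> carrier D"
  obtain ps where "coproduct_list f ps" by (rule D_comultE[OF f])
  note ps = coproduct_listD[OF this]
  obtain qs where "coproduct_list g qs" by (rule D_comultE[OF g])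
  note qs = coproduct_listD[OF this]
  have "comult D (f \<oplus>\<^bsub>D\<^esub> g) \<beta> = (\<Sum>(g, h)\<leftarrow>ps @ qs. \<beta> g h)"
    by (rule D_comult_eqI[OF D.M.a_closed[OF f g] _ _ \<beta>]) (use ps(1,3) qs(1,3) in auto)
  then show "comult D (f \<oplus>\<^bsub>D\<^esub> g) \<beta> = comult D f \<beta> + comult D g \<beta>"
    unfolding ps(2)[OF \<beta>] qs(2)[OF \<beta>] by simp
next
  fix c f assume f: "f \<in> carrier D"
  obtain ps where "coproduct_list f ps" by (rule D_comultE[OF f])
  note ps = coproduct_listD[OF this]
  let ?qs = "map (\<lambda>(g, h). (c \<odot>\<^bsub>D\<^esub> g, h)) ps"
  have qs: "set ?qs \<subseteq> carrier D \<times> carrier D"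
    using ps(1) by (auto simp del: graded_dual_simps intro!: D_smult_closed)
  have "(\<Sum>(g, h)\<leftarrow>?qs. g x * h y) = (c \<odot>\<^bsub>D\<^esub> f) (x \<otimes> y)"
    if "x \<in> carrier H" "y \<in> carrier H" for x y
  proof -
    have "(\<Sum>(g, h)\<leftarrow>?qs. g x * h y) = c * (\<Sum>(g, h)\<leftarrow>ps. g x * h y)"
      by (simp add: sum_list_const_mult[symmetric] comp_def case_prod_unfold mult.assoc)
    then show ?thesis using ps(3)[OF that] by simp
  qed
  from D_comult_eqI[OF D_smult_closed[OF f] qs this \<beta>]
  have "comult D (c \<odot>\<^bsub>D\<^esub> f) \<beta> = (\<Sum>(g, h)\<leftarrow>?qs. \<beta> g h)" .
  also have "\<dots> = (\<Sum>(g, h)\<leftarrow>ps. c * \<beta> g h)"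
    unfolding map_map comp_def
    by (rule arg_cong[where f = sum_list], rule map_cong[OF refl])
      (auto simp del: graded_dual_simps dest!: subsetD[OF ps(1)]
        intro!: D.linear_form_smult[OF D.bilinear_form_left[OF \<beta>]])
  also have "\<dots> = c * comult D f \<beta>"
    unfolding ps(2)[OF \<beta>] by (simp add: sum_list_const_mult[symmetric] case_prod_unfold)
  finally show "comult D (c \<odot>\<^bsub>D\<^esub> f) \<beta> = c * comult D f \<beta>" .
qed

section \<open>The algebra structure of the graded dual\<close>

lemma D_mult_eval:
  "x \<in> carrier H \<Longrightarrow> (f \<otimes>\<^bsub>D\<^esub> g) x = comult H x (\<lambda>y z. f y * g z)"
  by (simp add: restr_form_def)

lemma D_bilinear: "f \<in> carrier D \<Longrightarrow> g \<in> carrier D \<Longrightarrow> bilinear_form H (\<lambda>y z. f y * g z)"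
  by (intro bilinear_form_times D_linear)

lemma D_trilinear:
  assumes "f \<in> carrier D" "g \<in> carrier D" "h \<in> carrier D"
  shows "trilinear_form H (\<lambda>x y z. f x * g y * h z)"
  using assms[THEN D_linear] unfolding trilinear_form_def bilinear_form_def linear_form_def
  by (auto simp: algebra_simps)

text \<open>Associativity is coassociativity of \<open>H\<close> tested on the product of three
  forms, and the unit laws are the counit axioms.\<close>

lemma ring_D: "ring D"
proof (rule ringI)
  show "abelian_group D" by (rule D.abelian_group_axioms)
  show "monoid D"
  proof (rule monoidI)
    fix f g h assume fgh: "f \<in> carrier D" "g \<in> carrier D" "h \<in> carrier D"
    show "(f \<otimes>\<^bsub>D\<^esub> g) \<otimes>\<^bsub>D\<^esub> h = f \<otimes>\<^bsub>D\<^esub> (g \<otimes>\<^bsub>D\<^esub> h)"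
    proof (rule D_eqI)
      fix x assume x: "x \<in> carrier H"
      note tri = D_trilinear[OF fgh]
      have "((f \<otimes>\<^bsub>D\<^esub> g) \<otimes>\<^bsub>D\<^esub> h) x = comult H x (\<lambda>y z. (f \<otimes>\<^bsub>D\<^esub> g) y * h z)"
        by (rule D_mult_eval[OF x])
      also have "\<dots> = comult H x (\<lambda>y z. comult H y (\<lambda>y\<^sub>1 y\<^sub>2. f y\<^sub>1 * g y\<^sub>2 * h z))"
        by (rule tensor_cong[OF comult_closed[OF x]])
          (use fgh in \<open>simp_all add: D_bilinear D_mult_closed D_mult_eval
            tensor_cmult[OF comult_closed] del: graded_dual_simps\<close>)
      also have "\<dots> = comult H x (\<lambda>y z. comult H z (\<lambda>z\<^sub>1 z\<^sub>2. f y * g z\<^sub>1 * h z\<^sub>2))"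
        by (rule coassoc[OF x tri])
      also have "\<dots> = comult H x (\<lambda>y z. f y * (g \<otimes>\<^bsub>D\<^esub> h) z)"
      proof (rule tensor_cong[OF comult_closed[OF x] bilinear_form_comult(2)[OF tri]])
        fix y z assume z: "z \<in> carrier H"
        \<comment> \<open>The constant \<open>f y\<close> is moved to the right, where
          \<open>tensor_cmult\<close> can pull it out.\<close>
        have "comult H z (\<lambda>z\<^sub>1 z\<^sub>2. f y * g z\<^sub>1 * h z\<^sub>2) = comult H z (\<lambda>z\<^sub>1 z\<^sub>2. (g z\<^sub>1 * h z\<^sub>2) * f y)"
          by (simp add: mult_ac)
        also have "\<dots> = comult H z (\<lambda>z\<^sub>1 z\<^sub>2. g z\<^sub>1 * h z\<^sub>2) * f y"
          by (rule tensor_cmult[OF comult_closed[OF z] D_bilinear]) (use fgh in auto)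
        finally show "comult H z (\<lambda>z\<^sub>1 z\<^sub>2. f y * g z\<^sub>1 * h z\<^sub>2) = f y * (g \<otimes>\<^bsub>D\<^esub> h) z"
          unfolding D_mult_eval[OF z] by (simp add: mult.commute)
      qed
      also have "\<dots> = (f \<otimes>\<^bsub>D\<^esub> (g \<otimes>\<^bsub>D\<^esub> h)) x"
        by (rule D_mult_eval[OF x, symmetric])
      finally show "((f \<otimes>\<^bsub>D\<^esub> g) \<otimes>\<^bsub>D\<^esub> h) x = (f \<otimes>\<^bsub>D\<^esub> (g \<otimes>\<^bsub>D\<^esub> h)) x" .
    qed (use fgh D_mult_closed in auto)
  next
    fix f assume f: "f \<in> carrier D"
    have one: "\<one>\<^bsub>D\<^esub> y = counit H y" if "y \<in> carrier H" for y
      using that by (simp add: restr_form_def)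
    show "\<one>\<^bsub>D\<^esub> \<otimes>\<^bsub>D\<^esub> f = f"
    proof (rule D_eqI[OF D_mult_closed[OF D_one_closed f] f])
      fix x assume x: "x \<in> carrier H"
      have "(\<one>\<^bsub>D\<^esub> \<otimes>\<^bsub>D\<^esub> f) x = comult H x (\<lambda>y z. counit H y * f z)"
        unfolding D_mult_eval[OF x]
        by (rule tensor_cong[OF comult_closed[OF x] D_bilinear[OF D_one_closed f]]) (simp add: one del: graded_dual_simps)
      then show "(\<one>\<^bsub>D\<^esub> \<otimes>\<^bsub>D\<^esub> f) x = f x" using counit_left[OF x D_linear[OF f]] by (simp only:)
    qed
    show "f \<otimes>\<^bsub>D\<^esub> \<one>\<^bsub>D\<^esub> = f"
    proof (rule D_eqI[OF D_mult_closed[OF f D_one_closed] f])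
      fix x assume x: "x \<in> carrier H"
      have "(f \<otimes>\<^bsub>D\<^esub> \<one>\<^bsub>D\<^esub>) x = comult H x (\<lambda>y z. f y * counit H z)"
        unfolding D_mult_eval[OF x]
        by (rule tensor_cong[OF comult_closed[OF x] D_bilinear[OF f D_one_closed]]) (simp add: one del: graded_dual_simps)
      then show "(f \<otimes>\<^bsub>D\<^esub> \<one>\<^bsub>D\<^esub>) x = f x" using counit_right[OF x D_linear[OF f]] by (simp only:)
    qed
  qed (use D_mult_closed D_one_closed in auto)
  fix f g h assume fgh: "f \<in> carrier D" "g \<in> carrier D" "h \<in> carrier D"
  have add: "comult H x (\<lambda>y z. \<beta> y z + \<gamma> y z) = comult H x \<beta> + comult H x \<gamma>"
    if "x \<in> carrier H" "bilinear_form H \<beta>" "bilinear_form H \<gamma>" for x \<beta> \<gamma>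
  proof -
    have "bilinear_form H \<delta>" if "\<delta> \<in> set [\<beta>, \<gamma>]" for \<delta>
      using that \<open>bilinear_form H \<beta>\<close> \<open>bilinear_form H \<gamma>\<close> by auto
    from tensor_sum_list[OF comult_closed[OF that(1)], of "[\<beta>, \<gamma>]" "\<lambda>\<delta>. \<delta>", OF this]
    show ?thesis by simp
  qed
  show "(f \<oplus>\<^bsub>D\<^esub> g) \<otimes>\<^bsub>D\<^esub> h = f \<otimes>\<^bsub>D\<^esub> h \<oplus>\<^bsub>D\<^esub> g \<otimes>\<^bsub>D\<^esub> h"
    using fgh by (auto simp: restr_form_def fun_eq_iff distrib_right add D_bilinear)
  show "h \<otimes>\<^bsub>D\<^esub> (f \<oplus>\<^bsub>D\<^esub> g) = h \<otimes>\<^bsub>D\<^esub> f \<oplus>\<^bsub>D\<^esub> h \<otimes>\<^bsub>D\<^esub> g"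
    using fgh by (auto simp: restr_form_def fun_eq_iff distrib_left add D_bilinear)
qed

lemma D_smult_mult:
  assumes "f \<in> carrier D" "g \<in> carrier D"
  shows "(c \<odot>\<^bsub>D\<^esub> f) \<otimes>\<^bsub>D\<^esub> g = c \<odot>\<^bsub>D\<^esub> (f \<otimes>\<^bsub>D\<^esub> g)" "f \<otimes>\<^bsub>D\<^esub> (c \<odot>\<^bsub>D\<^esub> g) = c \<odot>\<^bsub>D\<^esub> (f \<otimes>\<^bsub>D\<^esub> g)"
proof -
  have "comult H x (\<lambda>y z. f y * g z * c) = comult H x (\<lambda>y z. f y * g z) * c" if "x \<in> carrier H" for x
    using that assms by (intro tensor_cmult comult_closed D_bilinear)
  then show "(c \<odot>\<^bsub>D\<^esub> f) \<otimes>\<^bsub>D\<^esub> g = c \<odot>\<^bsub>D\<^esub> (f \<otimes>\<^bsub>D\<^esub> g)" "f \<otimes>\<^bsub>D\<^esub> (c \<odot>\<^bsub>D\<^esub> g) = c \<odot>\<^bsub>D\<^esub> (f \<otimes>\<^bsub>D\<^esub> g)"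
    by (auto simp: restr_form_def fun_eq_iff mult_ac)
qed

end

lemma sum_list_concat_map:
  "(\<Sum>x\<leftarrow>concat (map f xs). F x) = (\<Sum>x\<leftarrow>xs. \<Sum>y\<leftarrow>f x. (F y :: 'a::monoid_add))"
  by (induction xs) auto

lemma sum_list_swap3:
  "(\<Sum>q\<leftarrow>qs. \<Sum>x\<leftarrow>xs. \<Sum>y\<leftarrow>ys. F q x y) =
    (\<Sum>x\<leftarrow>xs. \<Sum>y\<leftarrow>ys. \<Sum>q\<leftarrow>qs. (F q x y :: 'a::comm_monoid_add))"
  by (induction qs) (simp_all add: sum_list_addf)

lemma sum_list_swap4:
  "(\<Sum>p\<leftarrow>ps. \<Sum>q\<leftarrow>qs. \<Sum>x\<leftarrow>xs. \<Sum>y\<leftarrow>ys. F p q x y) =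
    (\<Sum>x\<leftarrow>xs. \<Sum>y\<leftarrow>ys. \<Sum>p\<leftarrow>ps. \<Sum>q\<leftarrow>qs. (F p q x y :: 'a::comm_monoid_add))"
  by (induction ps) (simp_all add: sum_list_addf sum_list_swap3[where qs = qs, symmetric])

section \<open>The coalgebra structure and the antipode of the graded dual\<close>

context graded_hopf_basis
begin

declare graded_dual_simps [simp del]

text \<open>Both iterated coproducts are lists of triples. Evaluated at three vectors, they give the
  value of \<open>f\<close> at the two bracketings of the product, so associativity of
  \<open>H\<close> makes them equal.\<close>

lemma D_coassoc:
  assumes f: "f \<in> carrier D" and \<gamma>: "trilinear_form D \<gamma>"
  shows "comult D f (\<lambda>y z. comult D y (\<lambda>y\<^sub>1 y\<^sub>2. \<gamma> y\<^sub>1 y\<^sub>2 z)) =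
    comult D f (\<lambda>y z. comult D z (\<lambda>z\<^sub>1 z\<^sub>2. \<gamma> y z\<^sub>1 z\<^sub>2))"
proof -
  \<comment> \<open>A simultaneous choice of lists, since the factors of the list for
    \<open>f\<close> have to be expanded in turn.\<close>
  define cl where "cl g = (SOME ps. coproduct_list g ps)" for g
  have "coproduct_list g (cl g)" if g: "g \<in> carrier D" for g
    unfolding cl_def by (rule someI_ex, rule D_comultE[OF g]) (rule exI)
  note cl = coproduct_listD[OF this]
  note iter = D.bilinear_form_iterated[OF D_comult_closed D_linear_form_comult \<gamma>]
  have bil: "bilinear_form D (\<gamma> x)" "bilinear_form D (\<lambda>y z. \<gamma> y z x)" if "x \<in> carrier D" for x
    using \<gamma> that unfolding trilinear_form_def by blast+
  have cl_mem: "fst p \<in> carrier D" "snd p \<in> carrier D" if "g \<in> carrier D" "p \<in> set (cl g)" for g p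
    using subsetD[OF cl(1)[OF that(1)] that(2)] by (auto simp: mem_Times_iff)
  have cl_pair: "g\<^sub>1 \<in> carrier D \<and> g\<^sub>2 \<in> carrier D" if "g \<in> carrier D" "(g\<^sub>1, g\<^sub>2) \<in> set (cl g)" for g g\<^sub>1 g\<^sub>2
    using cl_mem[OF that] by simp
  let ?L = "concat (map (\<lambda>(g, h). map (\<lambda>(g\<^sub>1, g\<^sub>2). (g\<^sub>1, g\<^sub>2, h)) (cl g)) (cl f))"
  let ?R = "concat (map (\<lambda>(g, h). map (\<lambda>(h\<^sub>1, h\<^sub>2). (g, h\<^sub>1, h\<^sub>2)) (cl h)) (cl f))"
  have L: "(\<Sum>(g, h)\<leftarrow>cl f. \<Sum>(g\<^sub>1, g\<^sub>2)\<leftarrow>cl g. F g\<^sub>1 g\<^sub>2 h) = (\<Sum>(x, y, z)\<leftarrow>?L. F x y z)"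
    and R: "(\<Sum>(g, h)\<leftarrow>cl f. \<Sum>(h\<^sub>1, h\<^sub>2)\<leftarrow>cl h. F g h\<^sub>1 h\<^sub>2) = (\<Sum>(x, y, z)\<leftarrow>?R. F x y z)" for F
    by (simp_all only: sum_list_concat_map case_prod_unfold map_map comp_def fst_conv snd_conv)
  have "comult D f (\<lambda>y z. comult D y (\<lambda>y\<^sub>1 y\<^sub>2. \<gamma> y\<^sub>1 y\<^sub>2 z)) =
      (\<Sum>(g, h)\<leftarrow>cl f. comult D g (\<lambda>y\<^sub>1 y\<^sub>2. \<gamma> y\<^sub>1 y\<^sub>2 h))"
    by (rule cl(2)[OF f iter(1)])
  also have "\<dots> = (\<Sum>(g, h)\<leftarrow>cl f. \<Sum>(g\<^sub>1, g\<^sub>2)\<leftarrow>cl g. \<gamma> g\<^sub>1 g\<^sub>2 h)"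
  proof (intro arg_cong[where f = sum_list] map_cong refl)
    fix p assume "p \<in> set (cl f)"
    from cl(2)[OF cl_mem(1)[OF f this] bil(2)[OF cl_mem(2)[OF f this]]]
    show "(case p of (g, h) \<Rightarrow> comult D g (\<lambda>y\<^sub>1 y\<^sub>2. \<gamma> y\<^sub>1 y\<^sub>2 h)) =
        (case p of (g, h) \<Rightarrow> \<Sum>(g\<^sub>1, g\<^sub>2)\<leftarrow>cl g. \<gamma> g\<^sub>1 g\<^sub>2 h)"
      unfolding case_prod_unfold .
  qed
  also have "\<dots> = (\<Sum>(g, h)\<leftarrow>cl f. \<Sum>(h\<^sub>1, h\<^sub>2)\<leftarrow>cl h. \<gamma> g h\<^sub>1 h\<^sub>2)"
  proof (rule trans[OF L[of \<gamma>] trans[OF _ R[of \<gamma>, symmetric]]], rule D_tensor3_eqI[OF _ _ _ \<gamma>])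
    show "set ?L \<subseteq> carrier D \<times> carrier D \<times> carrier D"
    proof
      fix p assume "p \<in> set ?L"
      then obtain g h g\<^sub>1 g\<^sub>2 where "(g, h) \<in> set (cl f)" "(g\<^sub>1, g\<^sub>2) \<in> set (cl g)" "p = (g\<^sub>1, g\<^sub>2, h)"
        by auto
      then show "p \<in> carrier D \<times> carrier D \<times> carrier D"
        using cl_pair[OF f, of g h] cl_pair[of g g\<^sub>1 g\<^sub>2] by simp
    qed
    show "set ?R \<subseteq> carrier D \<times> carrier D \<times> carrier D"
    proof
      fix p assume "p \<in> set ?R"
      then obtain g h h\<^sub>1 h\<^sub>2 where "(g, h) \<in> set (cl f)" "(h\<^sub>1, h\<^sub>2) \<in> set (cl h)" "p = (g, h\<^sub>1, h\<^sub>2)"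
        by auto
      then show "p \<in> carrier D \<times> carrier D \<times> carrier D"
        using cl_pair[OF f, of g h] cl_pair[of h h\<^sub>1 h\<^sub>2] by simp
    qed
    fix x y z assume xyz: "x \<in> carrier H" "y \<in> carrier H" "z \<in> carrier H"
    have "(\<Sum>(g, h)\<leftarrow>cl f. \<Sum>(g\<^sub>1, g\<^sub>2)\<leftarrow>cl g. g\<^sub>1 x * g\<^sub>2 y * h z) =
        (\<Sum>(g, h)\<leftarrow>cl f. g (x \<otimes> y) * h z)"
    proof (rule arg_cong[where f = sum_list], rule map_cong[OF refl])
      fix p assume "p \<in> set (cl f)"
      then have p: "fst p \<in> carrier D" by (rule cl_mem(1)[OF f])
      have "(\<Sum>(g\<^sub>1, g\<^sub>2)\<leftarrow>cl (fst p). g\<^sub>1 x * g\<^sub>2 y * snd p z) = (\<Sum>(g\<^sub>1, g\<^sub>2)\<leftarrow>cl (fst p). g\<^sub>1 x * g\<^sub>2 y) * snd p z"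
        by (simp add: sum_list_mult_const[symmetric] case_prod_unfold)
      then show "(case p of (g, h) \<Rightarrow> \<Sum>(g\<^sub>1, g\<^sub>2)\<leftarrow>cl g. g\<^sub>1 x * g\<^sub>2 y * h z) = (case p of (g, h) \<Rightarrow> g (x \<otimes> y) * h z)"
        unfolding cl(3)[OF p xyz(1,2)] by (simp add: case_prod_unfold)
    qed
    also have "\<dots> = f (x \<otimes> (y \<otimes> z))"
      using cl(3)[OF f _ xyz(3), of "x \<otimes> y"] xyz by (simp add: mult_assoc)
    also have "\<dots> = (\<Sum>(g, h)\<leftarrow>cl f. g x * h (y \<otimes> z))"
      using cl(3)[OF f xyz(1), of "y \<otimes> z"] xyz by simp
    also have "\<dots> = (\<Sum>(g, h)\<leftarrow>cl f. \<Sum>(h\<^sub>1, h\<^sub>2)\<leftarrow>cl h. g x * h\<^sub>1 y * h\<^sub>2 z)"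
    proof (rule arg_cong[where f = sum_list], rule map_cong[OF refl])
      fix p assume "p \<in> set (cl f)"
      then have p: "snd p \<in> carrier D" by (rule cl_mem(2)[OF f])
      have "(\<Sum>(h\<^sub>1, h\<^sub>2)\<leftarrow>cl (snd p). fst p x * h\<^sub>1 y * h\<^sub>2 z) = fst p x * (\<Sum>(h\<^sub>1, h\<^sub>2)\<leftarrow>cl (snd p). h\<^sub>1 y * h\<^sub>2 z)"
        by (simp add: sum_list_const_mult[symmetric] case_prod_unfold mult.assoc)
      then show "(case p of (g, h) \<Rightarrow> g x * h (y \<otimes> z)) = (case p of (g, h) \<Rightarrow> \<Sum>(h\<^sub>1, h\<^sub>2)\<leftarrow>cl h. g x * h\<^sub>1 y * h\<^sub>2 z)"
        unfolding cl(3)[OF p xyz(2,3)] by (simp add: case_prod_unfold)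
    qed
    finally show "(\<Sum>(f, g, h)\<leftarrow>?L. f x * g y * h z) = (\<Sum>(f, g, h)\<leftarrow>?R. f x * g y * h z)"
      using L[of "\<lambda>f g h. f x * g y * h z"] R[of "\<lambda>f g h. f x * g y * h z"] by (simp only:)
  qed
  also have "\<dots> = (\<Sum>(g, h)\<leftarrow>cl f. comult D h (\<lambda>h\<^sub>1 h\<^sub>2. \<gamma> g h\<^sub>1 h\<^sub>2))"
  proof (intro arg_cong[where f = sum_list] map_cong refl)
    fix p assume "p \<in> set (cl f)"
    from cl(2)[OF cl_mem(2)[OF f this] bil(1)[OF cl_mem(1)[OF f this]], symmetric]
    show "(case p of (g, h) \<Rightarrow> \<Sum>(h\<^sub>1, h\<^sub>2)\<leftarrow>cl h. \<gamma> g h\<^sub>1 h\<^sub>2) =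
        (case p of (g, h) \<Rightarrow> comult D h (\<lambda>h\<^sub>1 h\<^sub>2. \<gamma> g h\<^sub>1 h\<^sub>2))"
      unfolding case_prod_unfold .
  qed
  also have "\<dots> = comult D f (\<lambda>y z. comult D z (\<lambda>z\<^sub>1 z\<^sub>2. \<gamma> y z\<^sub>1 z\<^sub>2))"
    by (rule cl(2)[OF f iter(2), symmetric])
  finally show ?thesis .
qed

lemma D_counit_eval: "counit D = (\<lambda>f. f \<one>)"
  by (simp add: fun_eq_iff graded_dual_simps)

lemma D_counit_linear: "linear_form D (counit D)"
  unfolding D_counit_eval by (rule linear_form_eval)

lemma D_linear_form_sum_list_eq:
  assumes k: "linear_form D k" and hs: "set hs \<subseteq> carrier D" and g: "g \<in> carrier D"
    and eq: "\<And>x. x \<in> carrier H \<Longrightarrow> (\<Sum>h\<leftarrow>hs. h x) = c * g x"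
  shows "(\<Sum>h\<leftarrow>hs. k h) = c * k g"
proof -
  have "(\<lambda>x. \<Sum>h\<leftarrow>hs. h x) = c \<odot>\<^bsub>D\<^esub> g"
    by (rule D_eqI[OF conjunct1[OF D_linear_form_sum_list[OF k hs]] D_smult_closed[OF g]])
      (simp add: eq graded_dual_simps)
  then show ?thesis
    using D_linear_form_sum_list[OF k hs] D.linear_form_smult[OF k g] by simp
qed

text \<open>The common pattern of the counit and antipode axioms: \<open>m\<close> combines the two
  factors of the coproduct into one form on \<open>H\<close>, and the sum is recognised there
  pointwise before \<open>k\<close> is applied. For the counit, \<open>h\<close> is \<open>f\<close>
  itself; for the antipode, it is the unit of \<open>D\<close>.\<close>

lemma D_comult_form:
  assumes f: "f \<in> carrier D" and k: "linear_form D k" and h: "h \<in> carrier D"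
    and bil: "bilinear_form D (\<lambda>g h. k (m g h))"
    and m: "\<And>g h. g \<in> carrier D \<Longrightarrow> h \<in> carrier D \<Longrightarrow> m g h \<in> carrier D"
    and eval: "\<And>ps x. coproduct_list f ps \<Longrightarrow> x \<in> carrier H \<Longrightarrow> (\<Sum>(g, h)\<leftarrow>ps. m g h x) = c * h x"
  shows "comult D f (\<lambda>g h. k (m g h)) = c * k h"
proof -
  obtain ps where P: "coproduct_list f ps" by (rule D_comultE[OF f])
  note ps = coproduct_listD[OF P]
  have "(\<Sum>h\<leftarrow>map (\<lambda>(g, h). m g h) ps. k h) = c * k h"
  proof (rule D_linear_form_sum_list_eq[OF k _ h])
    show "set (map (\<lambda>(g, h). m g h) ps) \<subseteq> carrier D" by (auto intro!: m dest!: subsetD[OF ps(1)])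
    show "(\<Sum>h\<leftarrow>map (\<lambda>(g, h). m g h) ps. h x) = c * h x" if "x \<in> carrier H" for x
      using eval[OF P that] by (simp add: comp_def case_prod_unfold)
  qed
  then show ?thesis
    unfolding ps(2)[OF bil] by (simp add: comp_def case_prod_unfold)
qed

text \<open>The counit of \<open>D\<close> is evaluation at the unit of \<open>H\<close>, so at
  \<open>x\<close> the sums are the values of \<open>f\<close> at the products of \<open>x\<close>
  with that unit.\<close>

lemma D_counit:
  assumes f: "f \<in> carrier D" and k: "linear_form D k"
  shows D_counit_left: "comult D f (\<lambda>g h. counit D g * k h) = k f"
    and D_counit_right: "comult D f (\<lambda>g h. k g * counit D h) = k f"
proof -
  note closed = D_comult_closed[OF f]
  have eq: "counit D g * k h = k (g \<one> \<odot>\<^bsub>D\<^esub> h)" "k h * counit D g = k (g \<one> \<odot>\<^bsub>D\<^esub> h)"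
    if "h \<in> carrier D" for g h
    using D.linear_form_smult[OF k that] by (simp_all add: D_counit_eval)
  note bil = D.bilinear_form_times[OF D_counit_linear k] D.bilinear_form_times[OF k D_counit_linear]
  note bil' = D.bilinear_form_cong[OF bil(1) eq(1)] D.bilinear_form_cong[OF bil(2) eq(2)]
  have "comult D f (\<lambda>g h. k (g \<one> \<odot>\<^bsub>D\<^esub> h)) = 1 * k f"
  proof (rule D_comult_form[OF f k f bil'(1)])
    show "(\<Sum>(g, h)\<leftarrow>ps. (g \<one> \<odot>\<^bsub>D\<^esub> h) x) = 1 * f x" if "coproduct_list f ps" "x \<in> carrier H" for ps x
      using coproduct_listD(3)[OF that(1) one_closed that(2)] mult_one(1)[OF that(2)] by (simp add: graded_dual_simps)
  qed (auto intro: D_smult_closed)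
  then show "comult D f (\<lambda>g h. counit D g * k h) = k f"
    using D.tensor_cong[OF closed bil(1) eq(1)] by simp
  have "comult D f (\<lambda>g h. k (h \<one> \<odot>\<^bsub>D\<^esub> g)) = 1 * k f"
  proof (rule D_comult_form[OF f k f bil'(2)])
    show "(\<Sum>(g, h)\<leftarrow>ps. (h \<one> \<odot>\<^bsub>D\<^esub> g) x) = 1 * f x" if "coproduct_list f ps" "x \<in> carrier H" for ps x
      using coproduct_listD(3)[OF that(1,2) one_closed] mult_one(2)[OF that(2)]
      by (simp add: graded_dual_simps mult.commute)
  qed (auto intro: D_smult_closed)
  then show "comult D f (\<lambda>g h. k g * counit D h) = k f"
    using D.tensor_cong[OF closed bil(2) eq(2)] by simp
qed

text \<open>Evaluated at two vectors, the claim is multiplicativity of the counit of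
  \<open>H\<close>.\<close>

lemma D_comult_one:
  assumes \<beta>: "bilinear_form D \<beta>"
  shows "comult D \<one>\<^bsub>D\<^esub> \<beta> = \<beta> \<one>\<^bsub>D\<^esub> \<one>\<^bsub>D\<^esub>"
proof -
  have "comult D \<one>\<^bsub>D\<^esub> \<beta> = (\<Sum>(g, h)\<leftarrow>[(\<one>\<^bsub>D\<^esub>, \<one>\<^bsub>D\<^esub>)]. \<beta> g h)"
    by (rule D_comult_eqI[OF D_one_closed _ _ \<beta>])
      (simp_all add: D_one_closed, simp add: graded_dual_simps restr_form_def counit_mult)
  then show ?thesis by simp
qed

lemmas D_distribs = ring.ring_distribs[OF ring_D]

lemma D_bilinear_form_mult2:
  assumes \<beta>: "bilinear_form D \<beta>" and x: "x\<^sub>1 \<in> carrier D" "x\<^sub>2 \<in> carrier D"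
  shows "bilinear_form D (\<lambda>y\<^sub>1 y\<^sub>2. \<beta> (x\<^sub>1 \<otimes>\<^bsub>D\<^esub> y\<^sub>1) (x\<^sub>2 \<otimes>\<^bsub>D\<^esub> y\<^sub>2))"
    and "bilinear_form D (\<lambda>y\<^sub>1 y\<^sub>2. \<beta> (y\<^sub>1 \<otimes>\<^bsub>D\<^esub> x\<^sub>1) (y\<^sub>2 \<otimes>\<^bsub>D\<^esub> x\<^sub>2))"
  using \<beta> x unfolding bilinear_form_def linear_form_def
  by (auto simp: D_distribs D_smult_mult D_mult_closed)

text \<open>At \<open>x\<close>, \<open>y\<close> the right side is the sum of
  \<open>f\<^sub>1 x\<^sub>1\<close>, \<open>g\<^sub>1 x\<^sub>2\<close>,
  \<open>f\<^sub>2 y\<^sub>1\<close>, \<open>g\<^sub>2 y\<^sub>2\<close> multiplied together.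
  Summing over the factors of \<open>f\<close> and \<open>g\<close> first turns this into a
  coproduct in \<open>H\<close>, where compatibility of coproduct and product applies.\<close>

lemma D_comult_mult:
  assumes f: "f \<in> carrier D" and g: "g \<in> carrier D" and \<beta>: "bilinear_form D \<beta>"
  shows "comult D (f \<otimes>\<^bsub>D\<^esub> g) \<beta> =
    comult D f (\<lambda>f\<^sub>1 f\<^sub>2. comult D g (\<lambda>g\<^sub>1 g\<^sub>2. \<beta> (f\<^sub>1 \<otimes>\<^bsub>D\<^esub> g\<^sub>1) (f\<^sub>2 \<otimes>\<^bsub>D\<^esub> g\<^sub>2)))"
proof -
  obtain ps where "coproduct_list f ps" by (rule D_comultE[OF f])
  note ps = coproduct_listD[OF this]
  obtain qs where "coproduct_list g qs" by (rule D_comultE[OF g])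
  note qs = coproduct_listD[OF this]
  note mult2 = D_bilinear_form_mult2[OF \<beta>]
  let ?L = "concat (map (\<lambda>(f\<^sub>1, f\<^sub>2). map (\<lambda>(g\<^sub>1, g\<^sub>2). (f\<^sub>1 \<otimes>\<^bsub>D\<^esub> g\<^sub>1, f\<^sub>2 \<otimes>\<^bsub>D\<^esub> g\<^sub>2)) qs) ps)"
  have L: "(\<Sum>(f\<^sub>1, f\<^sub>2)\<leftarrow>ps. \<Sum>(g\<^sub>1, g\<^sub>2)\<leftarrow>qs. F (f\<^sub>1 \<otimes>\<^bsub>D\<^esub> g\<^sub>1) (f\<^sub>2 \<otimes>\<^bsub>D\<^esub> g\<^sub>2)) = (\<Sum>(x, y)\<leftarrow>?L. F x y)" for F
    by (simp only: sum_list_concat_map case_prod_unfold map_map comp_def fst_conv snd_conv)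
  have "comult D f (\<lambda>f\<^sub>1 f\<^sub>2. comult D g (\<lambda>g\<^sub>1 g\<^sub>2. \<beta> (f\<^sub>1 \<otimes>\<^bsub>D\<^esub> g\<^sub>1) (f\<^sub>2 \<otimes>\<^bsub>D\<^esub> g\<^sub>2))) =
      (\<Sum>(f\<^sub>1, f\<^sub>2)\<leftarrow>ps. comult D g (\<lambda>g\<^sub>1 g\<^sub>2. \<beta> (f\<^sub>1 \<otimes>\<^bsub>D\<^esub> g\<^sub>1) (f\<^sub>2 \<otimes>\<^bsub>D\<^esub> g\<^sub>2)))"
    by (rule ps(2), rule D.tensor_bilinear[OF D_comult_closed[OF g] _ _ vspace_D]) (rule mult2; assumption)+
  also have "\<dots> = (\<Sum>(f\<^sub>1, f\<^sub>2)\<leftarrow>ps. \<Sum>(g\<^sub>1, g\<^sub>2)\<leftarrow>qs. \<beta> (f\<^sub>1 \<otimes>\<^bsub>D\<^esub> g\<^sub>1) (f\<^sub>2 \<otimes>\<^bsub>D\<^esub> g\<^sub>2))"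
    by (rule arg_cong[where f = sum_list], rule map_cong[OF refl])
      (auto dest!: subsetD[OF ps(1)] intro!: qs(2) mult2)
  also have "\<dots> = comult D (f \<otimes>\<^bsub>D\<^esub> g) \<beta>"
  proof (rule trans[OF L[of \<beta>]], rule D_comult_eqI[OF D_mult_closed[OF f g] _ _ \<beta>, symmetric])
    show "set ?L \<subseteq> carrier D \<times> carrier D"
      using ps(1) qs(1) by (fastforce intro: D_mult_closed)
    fix x y assume x: "x \<in> carrier H" and y: "y \<in> carrier H"
    obtain xs where xs: "set xs \<subseteq> carrier H \<times> carrier H"
      "\<And>\<beta>. bilinear_form H \<beta> \<Longrightarrow> comult H x \<beta> = (\<Sum>(y, z)\<leftarrow>xs. \<beta> y z)"
      using tensorsE[OF comult_closed[OF x]] by blast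
    obtain ys where ys: "set ys \<subseteq> carrier H \<times> carrier H"
      "\<And>\<beta>. bilinear_form H \<beta> \<Longrightarrow> comult H y \<beta> = (\<Sum>(y, z)\<leftarrow>ys. \<beta> y z)"
      using tensorsE[OF comult_closed[OF y]] by blast
    have fst_snd: "fst p \<in> carrier D" "snd p \<in> carrier D" if "p \<in> set ps \<union> set qs" for p
      using that ps(1) qs(1) by auto
    have fst_snd': "fst p \<in> carrier H" "snd p \<in> carrier H" if "p \<in> set xs \<union> set ys" for p
      using that xs(1) ys(1) by auto
    have bil: "bilinear_form H (\<lambda>y z. f y * g z)" using f g by (rule D_bilinear)
    have "(\<Sum>(g, h)\<leftarrow>?L. g x * h y) =
        (\<Sum>p\<leftarrow>ps. \<Sum>q\<leftarrow>qs. (fst p \<otimes>\<^bsub>D\<^esub> fst q) x * (snd p \<otimes>\<^bsub>D\<^esub> snd q) y)"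
      by (rule trans[OF L[of "\<lambda>g h. g x * h y", symmetric]]) (simp add: case_prod_unfold)
    also have "\<dots> = (\<Sum>p\<leftarrow>ps. \<Sum>q\<leftarrow>qs. \<Sum>u\<leftarrow>xs. \<Sum>v\<leftarrow>ys.
        fst p (fst u) * fst q (snd u) * (snd p (fst v) * snd q (snd v)))"
    proof (intro arg_cong[where f = sum_list] map_cong refl)
      fix p q assume "p \<in> set ps" "q \<in> set qs"
      then have "fst p \<in> carrier D" "snd p \<in> carrier D" "fst q \<in> carrier D" "snd q \<in> carrier D"
        using fst_snd by auto
      then show "(fst p \<otimes>\<^bsub>D\<^esub> fst q) x * (snd p \<otimes>\<^bsub>D\<^esub> snd q) y =
          (\<Sum>u\<leftarrow>xs. \<Sum>v\<leftarrow>ys. fst p (fst u) * fst q (snd u) * (snd p (fst v) * snd q (snd v)))"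
        by (simp add: D_mult_eval x y xs(2) ys(2) D_bilinear case_prod_unfold sum_list_mult_const
            sum_list_const_mult)
    qed
    \<comment> \<open>With the sums over \<open>ps\<close> and \<open>qs\<close> innermost, they
      evaluate to values of \<open>f\<close> and \<open>g\<close> at products in
      \<open>H\<close>.\<close>
    also have "\<dots> = (\<Sum>u\<leftarrow>xs. \<Sum>v\<leftarrow>ys. \<Sum>p\<leftarrow>ps. \<Sum>q\<leftarrow>qs.
        fst p (fst u) * fst q (snd u) * (snd p (fst v) * snd q (snd v)))"
      by (rule sum_list_swap4)
    also have "\<dots> = (\<Sum>u\<leftarrow>xs. \<Sum>v\<leftarrow>ys. f (fst u \<otimes> fst v) * g (snd u \<otimes> snd v))"
    proof (intro arg_cong[where f = sum_list] map_cong refl)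
      fix u v assume "u \<in> set xs" "v \<in> set ys"
      then have uv: "fst u \<in> carrier H" "snd u \<in> carrier H" "fst v \<in> carrier H" "snd v \<in> carrier H"
        using fst_snd' by auto
      have "f (fst u \<otimes> fst v) * g (snd u \<otimes> snd v) =
          (\<Sum>p\<leftarrow>ps. fst p (fst u) * snd p (fst v)) * (\<Sum>q\<leftarrow>qs. fst q (snd u) * snd q (snd v))"
        using ps(3)[OF uv(1,3)] qs(3)[OF uv(2,4)] by (simp add: case_prod_unfold)
      also have "\<dots> = (\<Sum>p\<leftarrow>ps. \<Sum>q\<leftarrow>qs. fst p (fst u) * snd p (fst v) * (fst q (snd u) * snd q (snd v)))"
        by (simp add: sum_list_mult_const sum_list_const_mult)
      finally show "(\<Sum>p\<leftarrow>ps. \<Sum>q\<leftarrow>qs. fst p (fst u) * fst q (snd u) * (snd p (fst v) * snd q (snd v))) =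
          f (fst u \<otimes> fst v) * g (snd u \<otimes> snd v)"
        by (simp add: mult_ac)
    qed
    also have "\<dots> = (\<Sum>(x\<^sub>1, x\<^sub>2)\<leftarrow>xs. comult H y (\<lambda>y\<^sub>1 y\<^sub>2. f (x\<^sub>1 \<otimes> y\<^sub>1) * g (x\<^sub>2 \<otimes> y\<^sub>2)))"
    proof (intro arg_cong[where f = sum_list] map_cong refl)
      fix u assume "u \<in> set xs"
      then have "fst u \<in> carrier H" "snd u \<in> carrier H" using fst_snd' by auto
      from ys(2)[OF bilinear_form_mult2(1)[OF bil this]]
      show "(\<Sum>v\<leftarrow>ys. f (fst u \<otimes> fst v) * g (snd u \<otimes> snd v)) =
          (case u of (x\<^sub>1, x\<^sub>2) \<Rightarrow> comult H y (\<lambda>y\<^sub>1 y\<^sub>2. f (x\<^sub>1 \<otimes> y\<^sub>1) * g (x\<^sub>2 \<otimes> y\<^sub>2)))"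
        by (simp add: case_prod_unfold)
    qed
    also have "\<dots> = comult H x (\<lambda>x\<^sub>1 x\<^sub>2. comult H y (\<lambda>y\<^sub>1 y\<^sub>2. f (x\<^sub>1 \<otimes> y\<^sub>1) * g (x\<^sub>2 \<otimes> y\<^sub>2)))"
      by (rule xs(2)[symmetric], rule tensor_bilinear[OF comult_closed[OF y] _ _ vspace_H])
        (rule bilinear_form_mult2[OF bil]; assumption)+
    also have "\<dots> = (f \<otimes>\<^bsub>D\<^esub> g) (x \<otimes> y)"
      using x y by (simp add: D_mult_eval comult_mult bil)
    finally show "(\<Sum>(g, h)\<leftarrow>?L. g x * h y) = (f \<otimes>\<^bsub>D\<^esub> g) (x \<otimes> y)" .
  qed
  finally show ?thesis ..
qed

lemma D_antipode_eval: "x \<in> carrier H \<Longrightarrow> antipode D f x = f (antipode H x)"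
  by (simp add: graded_dual_simps restr_form_def)

lemma D_antipode_linear:
  "antipode D (f \<oplus>\<^bsub>D\<^esub> g) = antipode D f \<oplus>\<^bsub>D\<^esub> antipode D g"
  "antipode D (c \<odot>\<^bsub>D\<^esub> f) = c \<odot>\<^bsub>D\<^esub> antipode D f"
  by (simp_all add: graded_dual_simps restr_form_def fun_eq_iff)

text \<open>At \<open>x\<close>, the convolution becomes \<open>f\<close> applied to the convolution
  of the antipode of \<open>H\<close> with the identity. The antipode axiom of \<open>H\<close>
  makes this \<open>counit H x\<close> times the value of \<open>f\<close> at the unit, that is, a
  multiple of the unit of \<open>D\<close>.\<close>

lemma D_antipode:
  assumes f: "f \<in> carrier D" and k: "linear_form D k"
  shows D_antipode_left: "comult D f (\<lambda>g h. k (antipode D g \<otimes>\<^bsub>D\<^esub> h)) = counit D f * k \<one>\<^bsub>D\<^esub>"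
    and D_antipode_right: "comult D f (\<lambda>g h. k (g \<otimes>\<^bsub>D\<^esub> antipode D h)) = counit D f * k \<one>\<^bsub>D\<^esub>"
proof -
  have bil: "bilinear_form D (\<lambda>g h. k (antipode D g \<otimes>\<^bsub>D\<^esub> h))"
    "bilinear_form D (\<lambda>g h. k (g \<otimes>\<^bsub>D\<^esub> antipode D h))"
    using k unfolding bilinear_form_def linear_form_def
    by (auto simp: D_antipode_linear D_antipode_closed D_distribs D_smult_mult D_mult_closed)
  have one: "c * \<one>\<^bsub>D\<^esub> x = counit H x * c" if "x \<in> carrier H" for x c
    using that by (simp add: graded_dual_simps restr_form_def)
  have bilH: "bilinear_form H (\<lambda>y z. g (antipode H y) * h z)" "bilinear_form H (\<lambda>y z. g y * h (antipode H z))"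
    if "g \<in> carrier D" "h \<in> carrier D" for g h
    using that[THEN D_linear] unfolding bilinear_form_def linear_form_def
    by (auto simp: antipode_add antipode_smult antipode_closed algebra_simps)
  \<comment> \<open>\<open>s\<close> and \<open>t\<close> stand for the antipode and the identity,
    in one order for each of the two axioms.\<close>
  have sum: "(\<Sum>(g, h)\<leftarrow>ps. m g h x) = f \<one> * \<one>\<^bsub>D\<^esub> x"
    if ps: "coproduct_list f ps" and x: "x \<in> carrier H"
      and bil: "\<And>g h. g \<in> carrier D \<Longrightarrow> h \<in> carrier D \<Longrightarrow> bilinear_form H (\<lambda>y z. g (s y) * h (t z))"
      and m: "\<And>g h. g \<in> carrier D \<Longrightarrow> h \<in> carrier D \<Longrightarrow> m g h x = comult H x (\<lambda>y z. g (s y) * h (t z))"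
      and bil_f: "bilinear_form H (\<lambda>y z. f (s y \<otimes> t z))"
      and anti: "comult H x (\<lambda>y z. f (s y \<otimes> t z)) = counit H x * f \<one>"
      and st: "\<And>y. y \<in> carrier H \<Longrightarrow> s y \<in> carrier H \<and> t y \<in> carrier H" for ps x m s t
  proof -
    have mem: "fst p \<in> carrier D" "snd p \<in> carrier D" if "p \<in> set ps" for p
      using coproduct_listD(1)[OF ps] that by auto
    have "(\<Sum>(g, h)\<leftarrow>ps. m g h x) = (\<Sum>p\<leftarrow>ps. comult H x (\<lambda>y z. fst p (s y) * snd p (t z)))"
      by (rule arg_cong[where f = sum_list], rule map_cong[OF refl]) (simp add: case_prod_unfold m mem)
    also have "\<dots> = comult H x (\<lambda>y z. \<Sum>p\<leftarrow>ps. fst p (s y) * snd p (t z))"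
      by (rule tensor_sum_list[OF comult_closed[OF x], symmetric]) (simp add: bil mem)
    also have "\<dots> = comult H x (\<lambda>y z. f (s y \<otimes> t z))"
      by (rule tensor_cong[OF comult_closed[OF x] bil_f, symmetric])
        (use coproduct_listD(3)[OF ps] st in \<open>simp add: case_prod_unfold\<close>)
    finally show ?thesis unfolding one[OF x] anti .
  qed
  have "comult D f (\<lambda>g h. k (antipode D g \<otimes>\<^bsub>D\<^esub> h)) = f \<one> * k \<one>\<^bsub>D\<^esub>"
  proof (rule D_comult_form[OF f k D_one_closed bil(1)])
    fix ps x assume ps: "coproduct_list f ps" and x: "x \<in> carrier H"
    show "(\<Sum>(g, h)\<leftarrow>ps. (antipode D g \<otimes>\<^bsub>D\<^esub> h) x) = f \<one> * \<one>\<^bsub>D\<^esub> x"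
    proof (rule sum[OF ps x bilH(1)])
      show "(antipode D g \<otimes>\<^bsub>D\<^esub> h) x = comult H x (\<lambda>y z. g (antipode H y) * h z)"
        if "g \<in> carrier D" "h \<in> carrier D" for g h
        unfolding D_mult_eval[OF x]
        by (rule tensor_cong[OF comult_closed[OF x] bilH(1)[OF that], symmetric]) (simp add: D_antipode_eval)
    qed (auto intro: antipode_closed bilinear_form_antipode antipode_left x D_linear f)
  qed (auto intro: D_mult_closed D_antipode_closed)
  then show "comult D f (\<lambda>g h. k (antipode D g \<otimes>\<^bsub>D\<^esub> h)) = counit D f * k \<one>\<^bsub>D\<^esub>"
    by (simp add: D_counit_eval)
  have "comult D f (\<lambda>g h. k (g \<otimes>\<^bsub>D\<^esub> antipode D h)) = f \<one> * k \<one>\<^bsub>D\<^esub>"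
  proof (rule D_comult_form[OF f k D_one_closed bil(2)])
    fix ps x assume ps: "coproduct_list f ps" and x: "x \<in> carrier H"
    show "(\<Sum>(g, h)\<leftarrow>ps. (g \<otimes>\<^bsub>D\<^esub> antipode D h) x) = f \<one> * \<one>\<^bsub>D\<^esub> x"
    proof (rule sum[OF ps x bilH(2)])
      show "(g \<otimes>\<^bsub>D\<^esub> antipode D h) x = comult H x (\<lambda>y z. g y * h (antipode H z))"
        if "g \<in> carrier D" "h \<in> carrier D" for g h
        unfolding D_mult_eval[OF x]
        by (rule tensor_cong[OF comult_closed[OF x] bilH(2)[OF that], symmetric]) (simp add: D_antipode_eval)
    qed (auto intro: antipode_closed bilinear_form_antipode antipode_right x D_linear f)
  qed (auto intro: D_mult_closed D_antipode_closed)
  then show "comult D f (\<lambda>g h. k (g \<otimes>\<^bsub>D\<^esub> antipode D h)) = counit D f * k \<one>\<^bsub>D\<^esub>"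
    by (simp add: D_counit_eval)
qed

lemma hopf_algebra_D: "hopf_algebra D"
proof (intro hopf_algebra.intro hopf_algebra_axioms.intro ring_D D.module_axioms)
  show "comult D (f \<oplus>\<^bsub>D\<^esub> g) \<beta> = comult D f \<beta> + comult D g \<beta>"
    if "f \<in> carrier D" "g \<in> carrier D" "bilinear_form D \<beta>" for f g \<beta>
    using D.linear_form_add[OF D_linear_form_comult[OF that(3)] that(1,2)] .
  show "comult D (c \<odot>\<^bsub>D\<^esub> f) \<beta> = c * comult D f \<beta>" if "f \<in> carrier D" "bilinear_form D \<beta>" for c f \<beta>
    using D.linear_form_smult[OF D_linear_form_comult[OF that(2)] that(1)] .
  show "counit D \<one>\<^bsub>D\<^esub> = 1"
    by (simp add: graded_dual_simps restr_form_def counit_one)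
  show "counit D (f \<otimes>\<^bsub>D\<^esub> g) = counit D f * counit D g" if "f \<in> carrier D" "g \<in> carrier D" for f g
    using that by (simp add: graded_dual_simps restr_form_def comult_one D_bilinear)
qed ((fact D_smult_mult D_comult_closed D_coassoc D_counit_linear D_counit_left D_counit_right
    D_comult_one D_comult_mult D_antipode_closed)+,
  simp_all add: D_antipode_linear D_antipode_left D_antipode_right)

end

section \<open>Duals of Hopf subalgebras\<close>

text \<open>The retraction \<pi> extends forms from \<open>B\<close> to \<open>H\<close>, so tensors
  over the dual of \<open>B\<close> can be compared in \<open>D\<close> and no basis of
  \<open>B\<close> has to be constructed.\<close>

locale hopf_retract = graded_hopf_basis H gr I e deg
  for H :: "('k::field, 'v) hopf" (structure) and gr and I :: "'i set" and e deg +
  fixes B :: "'v set" and \<pi> :: "'v \<Rightarrow> 'v"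
  assumes sub: "hopf_subalgebra H B"
    and \<pi>_closed: "x \<in> carrier H \<Longrightarrow> \<pi> x \<in> B"
    and \<pi>_id: "x \<in> B \<Longrightarrow> \<pi> x = x"
    and \<pi>_add: "x \<in> carrier H \<Longrightarrow> y \<in> carrier H \<Longrightarrow> \<pi> (x \<oplus> y) = \<pi> x \<oplus> \<pi> y"
    and \<pi>_smult: "x \<in> carrier H \<Longrightarrow> \<pi> (c \<odot> x) = c \<odot> \<pi> x"
    and \<pi>_gr: "x \<in> gr n \<Longrightarrow> \<pi> x \<in> gr n"
begin

abbreviation S :: "('k, 'v) hopf" where "S \<equiv> sub_hopf H B"
abbreviation Bd :: "('k, 'v \<Rightarrow> 'k) hopf" where "Bd \<equiv> graded_dual S (\<lambda>n. B \<inter> gr n)"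
abbreviation r :: "('v \<Rightarrow> 'k) \<Rightarrow> 'v \<Rightarrow> 'k" where "r \<equiv> restr_form B"

definition lift :: "('v \<Rightarrow> 'k) \<Rightarrow> 'v \<Rightarrow> 'k" where
  "lift g = restr_form (carrier H) (\<lambda>x. g (\<pi> x))"

definition K :: "('v \<Rightarrow> 'k) set" where
  "K = {f \<in> carrier D. \<forall>x\<in>B. f x = 0}"

lemma B_subspace: "vsubspace B H"
  and B_one: "\<one> \<in> B"
  and B_mult: "x \<in> B \<Longrightarrow> y \<in> B \<Longrightarrow> x \<otimes> y \<in> B"
  and B_comult: "x \<in> B \<Longrightarrow> comult H x \<in> tensors H (B \<times> B)"
  and B_antipode: "x \<in> B \<Longrightarrow> antipode H x \<in> B"
  using sub by (auto simp: hopf_subalgebra_def)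

lemma B_carrier: "x \<in> B \<Longrightarrow> x \<in> carrier H"
  using submoduleE(1)[OF B_subspace] by blast

lemma B_add: "x \<in> B \<Longrightarrow> y \<in> B \<Longrightarrow> x \<oplus> y \<in> B"
  using submoduleE(5)[OF B_subspace] by blast

lemma B_smult: "x \<in> B \<Longrightarrow> c \<odot> x \<in> B"
  using submoduleE(4)[OF B_subspace] by simp

section \<open>Restriction of forms to the subalgebra\<close>

lemma S_simps [simp]:
  "carrier S = B" "x \<oplus>\<^bsub>S\<^esub> y = x \<oplus> y" "c \<odot>\<^bsub>S\<^esub> x = c \<odot> x" "x \<otimes>\<^bsub>S\<^esub> y = x \<otimes> y"
  "\<one>\<^bsub>S\<^esub> = \<one>" "counit S = counit H" "antipode S = antipode H"
  by (simp_all add: sub_hopf_def)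

lemma linear_form_S: "linear_form S f \<longleftrightarrow>
    (\<forall>x\<in>B. \<forall>y\<in>B. f (x \<oplus> y) = f x + f y) \<and> (\<forall>c. \<forall>x\<in>B. f (c \<odot> x) = c * f x)"
  by (simp add: linear_form_def)

lemma linear_form_SI: "linear_form H f \<Longrightarrow> linear_form S f"
  unfolding linear_form_S using B_carrier by (auto simp: linear_form_add linear_form_smult)

lemma bilinear_form_SI: "bilinear_form H \<beta> \<Longrightarrow> bilinear_form S \<beta>"
  unfolding bilinear_form_def using B_carrier linear_form_SI by auto

text \<open>A single list in \<open>B\<close> computes both coproducts: the chosen tensor agrees
  with \<open>comult H x\<close> at forms on \<open>H\<close>, and these are also forms on
  \<open>B\<close>.\<close>

lemma S_comultE:
  assumes x: "x \<in> B"
  obtains qs where "set qs \<subseteq> B \<times> B"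
    "\<And>\<beta>. bilinear_form S \<beta> \<Longrightarrow> comult S x \<beta> = (\<Sum>(y, z)\<leftarrow>qs. \<beta> y z)"
    "\<And>\<beta>. bilinear_form H \<beta> \<Longrightarrow> comult H x \<beta> = (\<Sum>(y, z)\<leftarrow>qs. \<beta> y z)"
proof -
  define P where "P t \<longleftrightarrow> t \<in> tensors (H\<lparr>carrier := B\<rparr>) (B \<times> B) \<and>
    (\<forall>\<beta>. bilinear_form H \<beta> \<longrightarrow> t \<beta> = comult H x \<beta>)" for t
  obtain ps where ps: "set ps \<subseteq> B \<times> B"
    "\<And>\<beta>. bilinear_form H \<beta> \<Longrightarrow> comult H x \<beta> = (\<Sum>(y, z)\<leftarrow>ps. \<beta> y z)"
    using tensorsE[OF B_comult[OF x]] by blast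
  have "P (\<lambda>\<beta>. \<Sum>(y, z)\<leftarrow>ps. \<beta> y z)"
    using ps by (auto simp: P_def intro: tensorsI)
  then have "P (SOME t. P t)" by (rule someI[of P])
  moreover have "comult S x = (SOME t. P t)" by (simp add: sub_hopf_def P_def)
  ultimately have "P (comult S x)" by simp
  then have P: "comult S x \<in> tensors (H\<lparr>carrier := B\<rparr>) (B \<times> B)"
    "\<And>\<beta>. bilinear_form H \<beta> \<Longrightarrow> comult S x \<beta> = comult H x \<beta>"
    by (auto simp: P_def)
  have bil: "bilinear_form (H\<lparr>carrier := B\<rparr>) \<beta> \<longleftrightarrow> bilinear_form S \<beta>" for \<beta>
    by (simp add: bilinear_form_def linear_form_def)
  from P(1) show thesis
  proof (rule tensorsE)
    fix qs assume qs: "set qs \<subseteq> B \<times> B"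
      "\<And>\<beta>. bilinear_form (H\<lparr>carrier := B\<rparr>) \<beta> \<Longrightarrow> comult S x \<beta> = (\<Sum>(y, z)\<leftarrow>qs. \<beta> y z)"
    then show thesis
      using P(2) bil bilinear_form_SI by (intro that[of qs]) auto
  qed
qed

lemma r_closed: "f \<in> carrier D \<Longrightarrow> r f \<in> carrier Bd"
proof -
  assume f: "f \<in> carrier D"
  obtain N where N: "\<And>n x. N < n \<Longrightarrow> x \<in> gr n \<Longrightarrow> f x = 0" using D_bounded[OF f] by blast
  have "linear_form S (r f)"
    using linear_form_SI[OF D_linear[OF f]] B_add B_smult by (auto simp: linear_form_S restr_form_def)
  then show ?thesis
    unfolding carrier_graded_dual using N
    by (intro conjI exI[of _ N]) (auto simp: restr_form_def)
qed

lemma Bd_outside: "g \<in> carrier Bd \<Longrightarrow> x \<notin> B \<Longrightarrow> g x = 0"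
  unfolding carrier_graded_dual by simp

lemma lift_closed:
  assumes g: "g \<in> carrier Bd"
  shows "lift g \<in> carrier D"
proof -
  obtain N where N: "\<forall>n>N. \<forall>x\<in>B \<inter> gr n. g x = 0"
    using g unfolding carrier_graded_dual by blast
  have "linear_form H (\<lambda>x. g (\<pi> x))"
    using g \<pi>_closed unfolding carrier_graded_dual linear_form_S
    by (auto simp: linear_form_def \<pi>_add \<pi>_smult)
  then have "linear_form H (lift g)"
    unfolding lift_def by (rule linear_form_restr[OF vspace_H])
  then show ?thesis
    unfolding carrier_graded_dual using N \<pi>_gr \<pi>_closed gr_closed
    by (intro conjI exI[of _ N]) (auto simp: lift_def restr_form_def)
qed

lemma r_lift: "g \<in> carrier Bd \<Longrightarrow> r (lift g) = g"
  using Bd_outside B_carrier by (auto simp: restr_form_def lift_def \<pi>_id fun_eq_iff)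

lemma r_add: "r (f \<oplus>\<^bsub>D\<^esub> g) = r f \<oplus>\<^bsub>Bd\<^esub> r g"
  and r_smult: "r (c \<odot>\<^bsub>D\<^esub> f) = c \<odot>\<^bsub>Bd\<^esub> r f"
  by (auto simp: graded_dual_simps restr_form_def)

lemma r_mult:
  assumes f: "f \<in> carrier D" and g: "g \<in> carrier D"
  shows "r (f \<otimes>\<^bsub>D\<^esub> g) = r f \<otimes>\<^bsub>Bd\<^esub> r g"
proof
  fix x
  show "r (f \<otimes>\<^bsub>D\<^esub> g) x = (r f \<otimes>\<^bsub>Bd\<^esub> r g) x"
  proof (cases "x \<in> B")
    case True
    obtain qs where qs: "set qs \<subseteq> B \<times> B"
      "\<And>\<beta>. bilinear_form S \<beta> \<Longrightarrow> comult S x \<beta> = (\<Sum>(y, z)\<leftarrow>qs. \<beta> y z)"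
      "\<And>\<beta>. bilinear_form H \<beta> \<Longrightarrow> comult H x \<beta> = (\<Sum>(y, z)\<leftarrow>qs. \<beta> y z)"
      using S_comultE[OF True] by blast
    have "bilinear_form S (\<lambda>y z. r f y * r g z)"
      using r_closed[OF f] r_closed[OF g] B_add B_smult
      unfolding carrier_graded_dual linear_form_S bilinear_form_def
      by (auto simp: algebra_simps)
    then have "(r f \<otimes>\<^bsub>Bd\<^esub> r g) x = (\<Sum>(y, z)\<leftarrow>qs. r f y * r g z)"
      unfolding graded_dual_simps S_simps by (subst restr_form_def) (simp add: True qs(2))
    also have "\<dots> = (\<Sum>(y, z)\<leftarrow>qs. f y * g z)"
      by (rule arg_cong[where f = sum_list], rule map_cong[OF refl])
        (auto simp: restr_form_def dest!: subsetD[OF qs(1)])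
    also have "\<dots> = r (f \<otimes>\<^bsub>D\<^esub> g) x"
      using True qs(3)[OF D_bilinear[OF f g]] B_carrier[OF True]
      by (simp add: graded_dual_simps restr_form_def)
    finally show ?thesis ..
  next
    case False
    then show ?thesis by (simp add: graded_dual_simps restr_form_def)
  qed
qed

lemma bilinear_form_r:
  assumes "bilinear_form Bd \<beta>"
  shows "bilinear_form D (\<lambda>g h. \<beta> (r g) (r h))"
  using assms r_closed unfolding bilinear_form_def linear_form_def
  by (simp add: r_add r_smult)

text \<open>The coproduct of \<open>Bd\<close> is a choice characterized by evaluations, while
  separation by evaluations is available only for \<open>D\<close>. So both lists are lifted to
  \<open>D\<close>; at \<open>x\<close>, \<open>y\<close> each gives the value of \<open>f\<close>
  at the product of the projections.\<close>

lemma r_comult: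
  assumes f: "f \<in> carrier D" and \<beta>: "bilinear_form Bd \<beta>"
  shows "comult Bd (r f) \<beta> = comult D f (\<lambda>g h. \<beta> (r g) (r h))"
proof -
  obtain ps where "coproduct_list f ps" by (rule D_comultE[OF f])
  note ps = coproduct_listD[OF this]
  define P where "P t \<longleftrightarrow> t \<in> tensors Bd (carrier Bd \<times> carrier Bd) \<and>
    (\<forall>x\<in>B. \<forall>y\<in>B. t (\<lambda>g h. g x * h y) = r f (x \<otimes> y))" for t
  have "(\<Sum>(g, h)\<leftarrow>map (map_prod r r) ps. g x * h y) = r f (x \<otimes> y)" if xy: "x \<in> B" "y \<in> B" for x y
    using ps(3)[OF B_carrier B_carrier, OF xy] xy B_mult
    by (simp add: restr_form_def comp_def case_prod_unfold)
  \<comment> \<open>The restricted list witnesses that the choice in \<open>Bd\<close> is from a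
    nonempty set.\<close>
  then have "P (\<lambda>\<beta>. \<Sum>(g, h)\<leftarrow>map (map_prod r r) ps. \<beta> g h)"
    unfolding P_def
    by (auto intro!: tensorsI[of "map (map_prod r r) ps"] r_closed dest!: subsetD[OF ps(1)])
  then have "P (SOME t. P t)" by (rule someI[of P])
  moreover have "comult Bd (r f) = (SOME t. P t)" by (simp add: comult_graded_dual P_def)
  ultimately have "P (comult Bd (r f))" by simp
  then have P: "comult Bd (r f) \<in> tensors Bd (carrier Bd \<times> carrier Bd)"
    "\<And>x y. x \<in> B \<Longrightarrow> y \<in> B \<Longrightarrow> comult Bd (r f) (\<lambda>g h. g x * h y) = r f (x \<otimes> y)"
    by (auto simp: P_def)
  obtain qs where qs: "set qs \<subseteq> carrier Bd \<times> carrier Bd"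
    "\<And>\<beta>. bilinear_form Bd \<beta> \<Longrightarrow> comult Bd (r f) \<beta> = (\<Sum>(g, h)\<leftarrow>qs. \<beta> g h)"
    using tensorsE[OF P(1)] by blast
  have eval: "bilinear_form Bd (\<lambda>g h. g x * h y)" for x y
    by (simp add: bilinear_form_def linear_form_def graded_dual_simps algebra_simps)
  let ?ps = "map (\<lambda>(g, h). (lift (r g), lift (r h))) ps" and ?qs = "map (\<lambda>(g, h). (lift g, lift h)) qs"
  have "(\<Sum>(g, h)\<leftarrow>?ps. \<beta> (r g) (r h)) = (\<Sum>(g, h)\<leftarrow>?qs. \<beta> (r g) (r h))"
  proof (rule D_tensor_eqI[OF _ _ _ bilinear_form_r[OF \<beta>]])
    show "set ?ps \<subseteq> carrier D \<times> carrier D" "set ?qs \<subseteq> carrier D \<times> carrier D"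
      using ps(1) qs(1) by (auto intro!: lift_closed r_closed)
    fix x y assume xy: "x \<in> carrier H" "y \<in> carrier H"
    then have \<pi>: "\<pi> x \<in> B" "\<pi> y \<in> B" by (auto intro: \<pi>_closed)
    have "(\<Sum>(g, h)\<leftarrow>?ps. g x * h y) = (\<Sum>(g, h)\<leftarrow>ps. g (\<pi> x) * h (\<pi> y))"
      using xy \<pi> by (simp add: comp_def case_prod_unfold lift_def restr_form_def)
    also have "\<dots> = f (\<pi> x \<otimes> \<pi> y)"
      using \<pi> by (intro ps(3) B_carrier)
    also have "\<dots> = (\<Sum>(g, h)\<leftarrow>qs. g (\<pi> x) * h (\<pi> y))"
      using P(2)[OF \<pi>] \<pi> B_mult[OF \<pi>] unfolding qs(2)[OF eval] by (simp add: restr_form_def)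
    also have "\<dots> = (\<Sum>(g, h)\<leftarrow>?qs. g x * h y)"
      using xy by (simp add: comp_def case_prod_unfold lift_def restr_form_def)
    finally show "(\<Sum>(g, h)\<leftarrow>?ps. g x * h y) = (\<Sum>(g, h)\<leftarrow>?qs. g x * h y)" .
  qed
  moreover have "(\<Sum>(g, h)\<leftarrow>?ps. \<beta> (r g) (r h)) = (\<Sum>(g, h)\<leftarrow>ps. \<beta> (r g) (r h))"
    unfolding map_map comp_def
    by (rule arg_cong[where f = sum_list], rule map_cong[OF refl])
      (auto dest!: subsetD[OF ps(1)] simp: r_lift r_closed)
  moreover have "(\<Sum>(g, h)\<leftarrow>?qs. \<beta> (r g) (r h)) = (\<Sum>(g, h)\<leftarrow>qs. \<beta> g h)"
    unfolding map_map comp_def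
    by (rule arg_cong[where f = sum_list], rule map_cong[OF refl])
      (auto dest!: subsetD[OF qs(1)] simp: r_lift)
  ultimately show ?thesis
    unfolding qs(2)[OF \<beta>] ps(2)[OF bilinear_form_r[OF \<beta>]] by simp
qed

lemma r_surj: "r ` carrier D = carrier Bd"
  using r_closed lift_closed r_lift by (auto intro!: image_eqI[where f = r, OF r_lift[symmetric]])

lemma hopf_image_Bd: "hopf_image D Bd r"
proof (intro hopf_image.intro hopf_image_axioms.intro hopf_algebra_D)
  show "r \<zero>\<^bsub>D\<^esub> = \<zero>\<^bsub>Bd\<^esub>" by (simp add: graded_dual_simps restr_form_def)
  show "r \<one>\<^bsub>D\<^esub> = \<one>\<^bsub>Bd\<^esub>" using B_carrier by (auto simp: graded_dual_simps restr_form_def fun_eq_iff)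
  show "counit Bd (r f) = counit D f" for f
    using B_one by (simp add: graded_dual_simps restr_form_def)
  show "antipode Bd (r f) = r (antipode D f)" for f
    using B_antipode B_carrier by (auto simp: graded_dual_simps restr_form_def fun_eq_iff)
qed (simp_all add: r_surj r_add r_mult r_smult r_comult)

sublocale im: hopf_image D Bd r by (rule hopf_image_Bd)

section \<open>The annihilator of the subalgebra\<close>

lemma D_minus: "f \<in> carrier D \<Longrightarrow> \<ominus>\<^bsub>D\<^esub> f = (-1) \<odot>\<^bsub>D\<^esub> f"
  by (rule D.M.minus_equality) (auto intro: D_smult_closed simp: graded_dual_simps(3,4), simp add: graded_dual_simps)

lemma K_closed: "f \<in> K \<Longrightarrow> f \<in> carrier D"
  by (simp add: K_def)

text \<open>The coproduct of an element of \<open>B\<close> has a representing list in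
  \<open>B\<close>, on which one of the two forms vanishes.\<close>

lemma K_mult:
  assumes "f \<in> carrier D" "g \<in> carrier D" "f \<in> K \<or> g \<in> K" "x \<in> B"
  shows "(f \<otimes>\<^bsub>D\<^esub> g) x = 0"
proof -
  obtain qs where qs: "set qs \<subseteq> B \<times> B"
    "\<And>\<beta>. bilinear_form S \<beta> \<Longrightarrow> comult S x \<beta> = (\<Sum>(y, z)\<leftarrow>qs. \<beta> y z)"
    "\<And>\<beta>. bilinear_form H \<beta> \<Longrightarrow> comult H x \<beta> = (\<Sum>(y, z)\<leftarrow>qs. \<beta> y z)"
    using S_comultE[OF assms(4)] by blast
  have "(f \<otimes>\<^bsub>D\<^esub> g) x = (\<Sum>(y, z)\<leftarrow>qs. f y * g z)"
    using B_carrier[OF assms(4)] by (simp add: D_mult_eval qs(3) D_bilinear assms)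
  also have "\<dots> = (\<Sum>p\<leftarrow>qs. 0)"
    by (rule arg_cong[where f = sum_list], rule map_cong[OF refl])
      (use assms(3) in \<open>auto simp: K_def dest!: subsetD[OF qs(1)]\<close>)
  finally show ?thesis by simp
qed

lemma ideal_K: "ideal K D"
proof (rule idealI[OF ring_D])
  show "subgroup K (add_monoid D)"
  proof (rule group.subgroupI)
    show "group (add_monoid D)" by (rule D.M.a_group)
    show "K \<subseteq> carrier (add_monoid D)" using K_closed by auto
    have "\<zero>\<^bsub>D\<^esub> \<in> K" using D.M.zero_closed by (simp add: K_def) (simp add: graded_dual_simps)
    then show "K \<noteq> {}" by blast
    fix f assume f: "f \<in> K"
    have "\<ominus>\<^bsub>D\<^esub> f \<in> K"
      unfolding D_minus[OF K_closed[OF f]]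
      using f D_smult_closed[OF K_closed[OF f], of "-1"] by (simp add: K_def) (simp add: graded_dual_simps)
    then show "inv\<^bsub>add_monoid D\<^esub> f \<in> K" by (simp add: a_inv_def)
    fix g assume g: "g \<in> K"
    show "f \<otimes>\<^bsub>add_monoid D\<^esub> g \<in> K"
      using f g D.M.a_closed[of f g] by (simp add: K_def) (simp add: graded_dual_simps)
  qed
  fix f g assume f: "f \<in> K" and g: "g \<in> carrier D"
  note f' = K_closed[OF f]
  show "g \<otimes>\<^bsub>D\<^esub> f \<in> K" "f \<otimes>\<^bsub>D\<^esub> g \<in> K"
    unfolding K_def using K_mult[OF f' g] K_mult[OF g f'] f D_mult_closed[OF f' g] D_mult_closed[OF g f']
    by simp_all
qed

lemma coset_eq_iff:
  assumes f: "f \<in> carrier D" and g: "g \<in> carrier D"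
  shows "K +>\<^bsub>D\<^esub> f = K +>\<^bsub>D\<^esub> g \<longleftrightarrow> r f = r g"
proof -
  have "f \<ominus>\<^bsub>D\<^esub> g = f \<oplus>\<^bsub>D\<^esub> (-1) \<odot>\<^bsub>D\<^esub> g"
    by (simp add: a_minus_def D_minus[OF g])
  then have ev: "(f \<ominus>\<^bsub>D\<^esub> g) x = f x - g x" for x by (simp add: graded_dual_simps)
  have "K +>\<^bsub>D\<^esub> f = K +>\<^bsub>D\<^esub> g \<longleftrightarrow> f \<ominus>\<^bsub>D\<^esub> g \<in> K"
    by (rule ring.quotient_eq_iff_same_a_r_cos[OF ring_D ideal_K f g, symmetric])
  also have "\<dots> \<longleftrightarrow> (\<forall>x\<in>B. f x = g x)"
    unfolding K_def using D.M.minus_closed[OF f g] by (simp add: ev)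
  also have "\<dots> \<longleftrightarrow> r f = r g"
  proof
    assume eq: "\<forall>x\<in>B. f x = g x"
    show "r f = r g" by (rule ext) (simp add: restr_form_def eq)
  next
    assume eq: "r f = r g"
    show "\<forall>x\<in>B. f x = g x"
    proof
      fix x assume "x \<in> B"
      then show "f x = g x" using fun_cong[OF eq, of x] by (simp add: restr_form_def)
    qed
  qed
  finally show ?thesis .
qed

section \<open>The quotient by the annihilator\<close>

abbreviation q :: "('v \<Rightarrow> 'k) \<Rightarrow> ('v \<Rightarrow> 'k) set" where "q f \<equiv> K +>\<^bsub>D\<^esub> f"
abbreviation Q :: "('k, ('v \<Rightarrow> 'k) set) hopf" where "Q \<equiv> quot_hopf D K"

text \<open>The operations of \<open>quot_hopf\<close> pick an arbitrary representative; by this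
  lemma, whatever depends only on the restriction to \<open>B\<close> is independent of the
  pick.\<close>

lemma q_some:
  assumes f: "f \<in> carrier D"
  shows "(SOME g. g \<in> q f) \<in> carrier D" "r (SOME g. g \<in> q f) = r f"
proof -
  interpret ideal K D by (rule ideal_K)
  have "f \<in> q f" by (rule a_rcos_self[OF f])
  then have g: "(SOME g. g \<in> q f) \<in> q f" by (rule someI[of "\<lambda>g. g \<in> q f"])
  show closed: "(SOME g. g \<in> q f) \<in> carrier D"
    using f g by (rule a_elemrcos_carrier)
  show "r (SOME g. g \<in> q f) = r f"
    using a_repr_independence'[OF g f] coset_eq_iff[OF f closed] by simp
qed

lemma Q_simps:
  shows carrier_Q: "carrier Q = q ` carrier D"
    and Q_add: "f \<in> carrier D \<Longrightarrow> g \<in> carrier D \<Longrightarrow> q f \<oplus>\<^bsub>Q\<^esub> q g = q (f \<oplus>\<^bsub>D\<^esub> g)"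
    and Q_mult: "f \<in> carrier D \<Longrightarrow> g \<in> carrier D \<Longrightarrow> q f \<otimes>\<^bsub>Q\<^esub> q g = q (f \<otimes>\<^bsub>D\<^esub> g)"
    and Q_zero: "\<zero>\<^bsub>Q\<^esub> = q \<zero>\<^bsub>D\<^esub>"
    and Q_one: "\<one>\<^bsub>Q\<^esub> = q \<one>\<^bsub>D\<^esub>"
proof -
  interpret ideal K D by (rule ideal_K)
  show "carrier Q = q ` carrier D"
    by (auto simp: quot_hopf_def FactRing_def A_RCOSETS_def')
  show "q f \<oplus>\<^bsub>Q\<^esub> q g = q (f \<oplus>\<^bsub>D\<^esub> g)" if "f \<in> carrier D" "g \<in> carrier D"
    using a_rcos_sum[OF that] by (simp add: quot_hopf_def FactRing_def)
  show "q f \<otimes>\<^bsub>Q\<^esub> q g = q (f \<otimes>\<^bsub>D\<^esub> g)" if "f \<in> carrier D" "g \<in> carrier D"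
    using rcoset_mult_add[OF that] by (simp add: quot_hopf_def FactRing_def)
  show "\<zero>\<^bsub>Q\<^esub> = q \<zero>\<^bsub>D\<^esub>"
    using ring.a_rcos_zero[OF ring_D ideal_K zero_closed] by (simp add: quot_hopf_def FactRing_def)
  show "\<one>\<^bsub>Q\<^esub> = q \<one>\<^bsub>D\<^esub>" by (simp add: quot_hopf_def FactRing_def)
qed

lemma q_closed: "f \<in> carrier D \<Longrightarrow> q f \<in> carrier Q"
  by (simp add: carrier_Q)

lemma Q_smult:
  assumes f: "f \<in> carrier D"
  shows "c \<odot>\<^bsub>Q\<^esub> q f = q (c \<odot>\<^bsub>D\<^esub> f)"
proof -
  have "c \<odot>\<^bsub>Q\<^esub> q f = q (c \<odot>\<^bsub>D\<^esub> (SOME g. g \<in> q f))" by (simp add: quot_hopf_def)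
  then show ?thesis
    using coset_eq_iff[OF D_smult_closed[OF q_some(1)[OF f]] D_smult_closed[OF f]] q_some(2)[OF f]
    by (simp add: r_smult)
qed

lemma lift_add: "lift (g \<oplus>\<^bsub>Bd\<^esub> h) = lift g \<oplus>\<^bsub>D\<^esub> lift h"
  and lift_smult: "lift (c \<odot>\<^bsub>Bd\<^esub> g) = c \<odot>\<^bsub>D\<^esub> lift g"
  by (auto simp: lift_def graded_dual_simps restr_form_def)

lemma q_lift: "f \<in> carrier D \<Longrightarrow> q (lift (r f)) = q f"
  by (simp add: coset_eq_iff lift_closed r_closed r_lift)

lemma bilinear_form_q:
  assumes \<beta>: "bilinear_form Q \<beta>"
  shows "bilinear_form Bd (\<lambda>g h. \<beta> (q (lift g)) (q (lift h)))"
  using \<beta> unfolding bilinear_form_def linear_form_def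
  by (simp add: lift_add lift_smult lift_closed q_closed flip: Q_add Q_smult)

text \<open>Only the coproduct needs an argument for independence of the representative. A form on
  \<open>Q\<close>, pulled back to \<open>D\<close>, factors through restriction as
  \<open>?\<gamma>\<close>, so by \<open>r_comult\<close> the value depends only on the restriction
  of the representative.\<close>

lemma hopf_image_Q: "hopf_image D Q q"
proof (intro hopf_image.intro hopf_image_axioms.intro hopf_algebra_D)
  fix f assume f: "f \<in> carrier D"
  show "comult Q (q f) \<beta> = comult D f (\<lambda>g h. \<beta> (q g) (q h))" if \<beta>: "bilinear_form Q \<beta>" for \<beta>
  proof -
    let ?g = "SOME g. g \<in> q f"
    let ?\<gamma> = "\<lambda>g h. \<beta> (q (lift g)) (q (lift h))"
    have \<gamma>: "bilinear_form Bd ?\<gamma>" by (rule bilinear_form_q[OF \<beta>])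
    have *: "comult D g (\<lambda>g h. \<beta> (q g) (q h)) = comult Bd (r g) ?\<gamma>" if g: "g \<in> carrier D" for g
      unfolding r_comult[OF g \<gamma>]
      by (rule D.tensor_cong[OF D_comult_closed[OF g] bilinear_form_r[OF \<gamma>], symmetric])
        (simp add: q_lift)
    have "comult Q (q f) \<beta> = comult D ?g (\<lambda>g h. \<beta> (q g) (q h))" by (simp add: quot_hopf_def)
    then show ?thesis using *[OF f] *[OF q_some(1)[OF f]] q_some(2)[OF f] by simp
  qed
  have ev: "counit D g = r g \<one>" for g
    using B_one by (simp add: graded_dual_simps restr_form_def)
  show "counit Q (q f) = counit D f"
    using q_some(2)[OF f] by (simp add: quot_hopf_def ev)
  show "antipode Q (q f) = q (antipode D f)"
    using q_some[OF f] f im.r_antipode[of f, symmetric] im.r_antipode[of "SOME g. g \<in> q f", symmetric]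
    by (simp add: quot_hopf_def coset_eq_iff D_antipode_closed)
qed (simp_all add: carrier_Q Q_add Q_mult Q_zero Q_one Q_smult)

sublocale qm: hopf_image D Q q by (rule hopf_image_Q)

lemma hopf_iso_quot:
  "\<exists>\<phi>. hopf_iso Q Bd \<phi> \<and> (\<forall>f\<in>carrier D. \<phi> (q f) = r f)"
proof (intro exI conjI ballI)
  \<comment> \<open>Any representative serves, as restriction to \<open>B\<close> is constant on
    cosets.\<close>
  define \<phi> where "\<phi> U = r (SOME g. g \<in> U)" for U :: "('v \<Rightarrow> 'k) set"
  show \<phi>: "\<phi> (q f) = r f" if "f \<in> carrier D" for f
    unfolding \<phi>_def by (rule q_some(2)[OF that])
  show "hopf_iso Q Bd \<phi>"
    unfolding hopf_iso_def
  proof (intro conjI ballI allI impI)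
    show "hopf_algebra Q" by (rule qm.hopf_algebra_Q)
    show "hopf_algebra Bd" by (rule im.hopf_algebra_Q)
    have hom: "\<phi> \<in> ring_hom Q Bd"
      by (rule ring_hom_memI)
        (auto elim!: qm.Q_cases simp: \<phi> r_closed Q_mult Q_add D_mult_closed D.M.a_closed Q_one D_one_closed
          im.r_one r_mult r_add)
    have "inj_on \<phi> (carrier Q)"
      by (rule inj_onI, elim qm.Q_cases) (simp add: \<phi> coset_eq_iff)
    moreover have "\<phi> ` carrier Q = carrier Bd"
    proof -
      have "\<phi> ` carrier Q = (\<lambda>f. \<phi> (q f)) ` carrier D" by (simp only: carrier_Q image_image)
      also have "\<dots> = r ` carrier D" by (rule image_cong) (simp_all add: \<phi>)
      finally show ?thesis by (simp only: r_surj)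
    qed
    ultimately show "\<phi> \<in> ring_iso Q Bd"
      using hom by (simp add: ring_iso_def bij_betw_def)
    fix u assume "u \<in> carrier Q"
    then obtain f where f: "f \<in> carrier D" "u = q f" by (rule qm.Q_cases)
    show "\<phi> (c \<odot>\<^bsub>Q\<^esub> u) = c \<odot>\<^bsub>Bd\<^esub> \<phi> u" for c
      using f by (simp add: Q_smult \<phi> D_smult_closed r_smult)
    show "counit Bd (\<phi> u) = counit Q u"
      using f by (simp add: \<phi> im.r_counit qm.r_counit)
    show "\<phi> (antipode Q u) = antipode Bd (\<phi> u)"
      using f by (simp add: \<phi> im.r_antipode qm.r_antipode D_antipode_closed)
    fix \<beta> assume \<beta>: "bilinear_form Bd \<beta>"
    have bil: "bilinear_form Q (\<lambda>y z. \<beta> (\<phi> y) (\<phi> z))"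
      using \<beta> unfolding bilinear_form_def linear_form_def carrier_Q
      by (simp add: \<phi> r_closed D.M.a_closed D_smult_closed Q_add Q_smult r_add r_smult)
    have "comult Bd (\<phi> u) \<beta> = comult D f (\<lambda>g h. \<beta> (r g) (r h))"
      using f \<beta> by (simp add: \<phi> r_comult)
    also have "\<dots> = comult D f (\<lambda>g h. \<beta> (\<phi> (q g)) (\<phi> (q h)))"
      by (rule D.tensor_cong[OF D_comult_closed[OF f(1)] bilinear_form_r[OF \<beta>]]) (simp add: \<phi>)
    also have "\<dots> = comult Q u (\<lambda>y z. \<beta> (\<phi> y) (\<phi> z))"
      using qm.r_comult[OF f(1) bil] by (simp add: f(2))
    finally show "comult Bd (\<phi> u) \<beta> = comult Q u (\<lambda>y z. \<beta> (\<phi> y) (\<phi> z))" .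
  qed
qed

end

section \<open>Words and shuffles\<close>

lemma length_pack [simp]: "length (pack w) = length w"
  by (simp add: pack_def)

text \<open>The rank of a letter among the letters of \<open>w\<close> increases strictly with the
  letter.\<close>

lemma pack_nth_eq_iff:
  assumes "i < length w" "j < length w"
  shows "pack w ! i = pack w ! j \<longleftrightarrow> w ! i = w ! j"
proof -
  have "card {y \<in> set w. y \<le> w ! p} < card {y \<in> set w. y \<le> w ! q}"
    if "w ! p < w ! q" "q < length w" for p q
  proof (rule psubset_card_mono)
    have "w ! q \<in> {y \<in> set w. y \<le> w ! q}" "w ! q \<notin> {y \<in> set w. y \<le> w ! p}"
      using that by simp_all
    moreover have "{y \<in> set w. y \<le> w ! p} \<subseteq> {y \<in> set w. y \<le> w ! q}"
      using that(1) by auto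
    ultimately show "{y \<in> set w. y \<le> w ! p} \<subset> {y \<in> set w. y \<le> w ! q}"
      by blast
  qed simp
  from this[of i j] this[of j i] show ?thesis
    using assms by (cases "w ! i" "w ! j" rule: linorder_cases) (auto simp: pack_def)
qed

lemma pack_shift: "pack (shift k w) = pack w"
proof -
  have "{y \<in> set (shift k w). y \<le> x + k} = (\<lambda>i. i + k) ` {y \<in> set w. y \<le> x}" for x
    by (auto simp: shift_def)
  then have "card {y \<in> set (shift k w). y \<le> x + k} = card {y \<in> set w. y \<le> x}" for x
    by (simp add: card_image)
  then show ?thesis
    unfolding pack_def by (subst (2) shift_def) simp
qed

lemma ev_eq_iff: "ev u = ev v \<longleftrightarrow> mset u = mset v"
  by (simp add: ev_def fun_eq_iff multiset_eq_iff count_mset)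

lemma length_shift [simp]: "length (shift k w) = length w"
  by (simp add: shift_def)

section \<open>Counting shuffles\<close>

lemma mset_shuffle: "w \<in># shuffle u v \<Longrightarrow> mset w = mset u + mset v"
  by (induction u v arbitrary: w rule: shuffle.induct) auto

lemma length_shuffle: "w \<in># shuffle u v \<Longrightarrow> length w = length u + length v"
  using mset_shuffle[of w u v] by (metis size_mset size_union)

lemma shuffle_Nil_right [simp]: "shuffle u [] = {#u#}"
  by (cases u) auto

lemma size_shuffle: "size (shuffle u v) = (length u + length v) choose length u"
  by (induction u v rule: shuffle.induct) auto

lemma append_in_shuffle: "u @ v \<in># shuffle u v"
  by (induction u v rule: shuffle.induct) auto

lemma count_image_Cons: "count (image_mset ((#) x) M) (y # w) = (if x = y then count M w else 0)"
  by (induction M) auto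

lemma count_image_Cons_Nil: "count (image_mset ((#) x) M) [] = 0"
  by (induction M) auto

lemma filter_separated:
  shows "\<forall>y\<in>set v. \<not> P y \<Longrightarrow> filter P w = [] \<and> filter (\<lambda>x. \<not> P x) w = v \<longleftrightarrow> v = w"
    and "\<forall>x\<in>set u. P x \<Longrightarrow> filter P w = u \<and> filter (\<lambda>x. \<not> P x) w = [] \<longleftrightarrow> u = w"
  by (auto simp: filter_empty_conv intro: filter_True filter_True[symmetric])

text \<open>If \<open>P\<close> tells the letters of \<open>u\<close> from those of
  \<open>v\<close>, each letter of a shuffle shows which word it comes from, so a word arises in at
  most one way.\<close>

lemma count_shuffle_separated:
  assumes "\<forall>x\<in>set u. P x" "\<forall>y\<in>set v. \<not> P y"
  shows "count (shuffle u v) w = of_bool (filter P w = u \<and> filter (\<lambda>x. \<not> P x) w = v)"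
  using assms
proof (induction w arbitrary: u v)
  case Nil
  then show ?case by (cases u; cases v) (auto simp: count_image_Cons_Nil)
next
  case (Cons z w)
  show ?case
  proof (cases u)
    case Nil
    show ?thesis
      unfolding Nil shuffle.simps(1) filter_separated(1)[OF Cons.prems(2)] by simp
  next
    case u: (Cons x u')
    show ?thesis
    proof (cases v)
      case Nil
      show ?thesis
        unfolding Nil shuffle_Nil_right filter_separated(2)[OF Cons.prems(1)] by simp
    next
      case v: (Cons y v')
      have 1: "count (shuffle u' v) w = of_bool (filter P w = u' \<and> filter (\<lambda>x. \<not> P x) w = v)"
        using Cons.prems u by (intro Cons.IH) auto
      have 2: "count (shuffle u v') w = of_bool (filter P w = u \<and> filter (\<lambda>x. \<not> P x) w = v')"
        using Cons.prems v by (intro Cons.IH) auto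
      have "P x" "\<not> P y" using Cons.prems u v by auto
      then show ?thesis
        using 1[unfolded v] 2[unfolded u] unfolding u v
        by (cases "x = z"; cases "y = z") (simp_all add: count_image_Cons)
    qed
  qed
qed

text \<open>The initial \<open>x\<close> is either that of the second word or, if \<open>u\<close>
  begins with \<open>x\<close>, that of the first.\<close>

lemma size_shuffle_start:
  "size (shuffle u v) + (if \<exists>u'. u = x # u' then size (shuffle (tl u) (x # v)) else 0)
    \<le> size (filter_mset (\<lambda>w. \<exists>w'. w = x # w') (shuffle u (x # v)))"
  by (cases u) (auto simp: filter_mset_image_mset)

lemma size_shuffle_start':
  "size (shuffle u v) + (if \<exists>v'. v = x # v' then size (shuffle (x # u) (tl v)) else 0)
    \<le> size (filter_mset (\<lambda>w. \<exists>w'. w = x # w') (shuffle (x # u) v))"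
  by (cases v) (auto simp: filter_mset_image_mset)

text \<open>The two equal initial letters may come one from each word, in either order, which gives
  the factor 2. They may also come from the same word, if it begins with two letters
  \<open>x\<close>.\<close>

lemma size_shuffle_square:
  "2 * size (shuffle u v)
      + (if \<exists>u'. u = x # u' then size (shuffle (tl u) (x # v)) else 0)
      + (if \<exists>v'. v = x # v' then size (shuffle (x # u) (tl v)) else 0)
    \<le> size (filter_mset (\<lambda>w. \<exists>t w'. w = t # t # w') (shuffle (x # u) (x # v)))"
  using size_shuffle_start[of u v x] size_shuffle_start'[of u v x]
  by (simp add: filter_mset_image_mset)

section \<open>Intervals and factors of words\<close>

lemma restr_word_interval:
  assumes "w \<in> words"
  shows "restr_word w {1..<n} = filter (\<lambda>x. x < n) w"
    and "restr_word w {max 1 n..} = filter (\<lambda>x. \<not> x < n) w"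
  using assms unfolding restr_word_def words_def by (auto intro!: filter_cong simp: in_lists_conv_set)

lemma interval_Ico: "interval {1..<n}" "interval {max 1 n..}"
  by (auto simp: interval_def)

lemma words_mset: "u \<in> words \<Longrightarrow> mset v = mset u \<Longrightarrow> v \<in> words"
  unfolding words_def by (auto simp: in_lists_conv_set dest: mset_eq_setD)

lemma words_append: "u @ v \<in> words \<longleftrightarrow> u \<in> words \<and> v \<in> words"
  by (simp add: words_def)

lemma words_take_drop: "w \<in> words \<Longrightarrow> take i w \<in> words \<and> drop i w \<in> words"
  using words_append[of "take i w" "drop i w"] by simp

lemma sum_mset_image_conv_sum:
  "(\<Sum>x\<in>#M. g x) = (\<Sum>x\<in>set_mset M. of_nat (count M x) * (g x :: 'a::comm_semiring_1))"
proof (induction M)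
  case (add y M)
  have "(\<Sum>x\<in>set_mset (add_mset y M). of_nat (count (add_mset y M) x) * g x)
      = (\<Sum>x\<in>insert y (set_mset M). of_nat (count M x) * g x + (if x = y then g x else 0))"
    by (intro sum.cong) (auto simp: algebra_simps)
  also have "\<dots> = (\<Sum>x\<in>insert y (set_mset M). of_nat (count M x) * g x) + g y"
    by (simp add: sum.distrib)
  also have "(\<Sum>x\<in>insert y (set_mset M). of_nat (count M x) * g x) = (\<Sum>x\<in>set_mset M. of_nat (count M x) * g x)"
    by (rule sum.mono_neutral_right) (auto simp: not_in_iff)
  finally show ?case using add by (simp add: add.commute)
qed simp

section \<open>Shuffle-like Hopf algebras\<close>

lemma sum_mset_of_nat: "(\<Sum>w\<in>#M. of_nat (h w)) = (of_nat (\<Sum>w\<in>#M. h w) :: 'a::semiring_1)"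
  by (induction M) auto

lemma sum_mset_of_bool:
  "(\<Sum>w\<in>#M. of_bool (P w)) = (of_nat (size (filter_mset P M)) :: 'a::semiring_1)"
  by (induction M) auto

text \<open>Characteristic 0 enters in \<open>prefix_count\<close>, where equal scalars have to give
  equal numbers of words.\<close>

locale shuffle_like_char0 = shuffle_like_hopf_algebra H gr C b a
  for H :: "('k::field_char_0, 'v) hopf" (structure) and gr C b a

sublocale shuffle_like_char0 \<subseteq> homogeneous_basis H gr C b length
  by unfold_locales (use basis basis_degree in auto)

context shuffle_like_char0
begin

section \<open>Unit, counit and the algorithm on index words\<close>

lemma C_words: "w \<in> C \<Longrightarrow> w \<in> words"
  using index_words by blast

lemma C_mset:
  assumes "u \<in> C" "mset v = mset u"
  shows "v \<in> C"
proof -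
  obtain \<sigma> where "\<sigma> permutes {..<length u}" "permute_list \<sigma> u = v"
    using mset_eq_permutation[OF assms(2)] by blast
  then show ?thesis using index_permute[OF assms(1)] by blast
qed

lemma length_a [simp]: "w \<in> words \<Longrightarrow> length (a w) = length w"
  using alg_pack[of w] by (metis length_pack)

lemma a_take_drop:
  assumes "w \<in> C"
  shows "a (take i w) \<in> C" "a (drop i w) \<in> C"
    "length (a (take i w)) = min (length w) i" "length (a (drop i w)) = length w - i"
  using index_alg[of "take i w" "drop i w"] words_take_drop[OF C_words[OF assms], of i] assms by auto

lemma b_mult_form:
  assumes f: "linear_form H f" and uv: "u \<in> C" "v \<in> C"
  shows "f (b u \<otimes> b v) = (\<Sum>w\<in>#shifted_shuffle u v. f (b w))"
proof -
  have closed: "b w \<in> carrier H" if "w \<in># shifted_shuffle u v" for w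
    using index_shuffle[OF uv that] by simp
  have "f (b u \<otimes> b v) = (\<Sum>w\<in>set_mset (shifted_shuffle u v).
      f (of_nat (count (shifted_shuffle u v) w) \<odot> b w))"
    unfolding mult_basis[OF uv] by (rule linear_form_finsum[OF f]) (auto intro!: closed)
  also have "\<dots> = (\<Sum>w\<in>set_mset (shifted_shuffle u v). of_nat (count (shifted_shuffle u v) w) * f (b w))"
    by (intro sum.cong refl linear_form_smult[OF f] closed)
  finally show ?thesis by (simp add: sum_mset_image_conv_sum)
qed

lemma shifted_shuffle_Nil: "shifted_shuffle [] [] = {#[]#}"
  by (simp add: shifted_shuffle_def shift_def)

text \<open>The unit is homogeneous of degree 0, where the empty word is the only possible index, so
  it is a multiple of \<open>b []\<close>. As \<open>b []\<close> is idempotent, the unit law forces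
  the multiple to be \<open>b []\<close> itself.\<close>

lemma one_eq: "[] \<in> C" "\<one> = b []"
proof -
  have "1 \<odot> \<one> \<in> gr 0" unfolding connected by blast
  then have one: "\<one> \<in> gr 0" by simp
  have supp: "w = []" if "coord \<one> w \<noteq> 0" for w
    using gr_coord[OF one that] by simp
  have "\<one> \<noteq> \<zero>"
    using counit_one linear_form_zero[OF counit_linear] by auto
  then obtain w where "coord \<one> w \<noteq> 0"
    using coord_eqI[of \<one> \<zero>] by (auto simp: coord_zero fun_eq_iff)
  then have nz: "coord \<one> [] \<noteq> 0" using supp by blast
  then show Nil: "[] \<in> C" using coord_outside[of \<one> "[]"] by auto
  have one_b: "\<one> = coord \<one> [] \<odot> b []"
    using basis_expansion[of \<one> "{[]}"] supp Nil by (auto simp: finsum_one)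
  have bb: "b [] \<otimes> b [] = b []"
    using mult_basis[OF Nil Nil] Nil by (simp add: shifted_shuffle_Nil finsum_one)
  have "b [] = \<one> \<otimes> b []" using Nil by (simp add: mult_one)
  also have "\<dots> = coord \<one> [] \<odot> b []"
    by (subst one_b) (use Nil in \<open>simp add: smult_mult_left bb\<close>)
  finally show "\<one> = b []" using one_b by simp
qed

lemma counit_b: "w \<in> C \<Longrightarrow> counit H (b w) = of_bool (w = [])"
  using gr_counit[OF basis_degree, of w] counit_one one_eq(2) by (cases w) auto

text \<open>Applying the counit to the left factor of the coproduct of \<open>b w\<close> leaves
  only the empty prefix, hence \<open>b (a w)\<close>, which the counit axiom equates with
  \<open>b w\<close>.\<close>

lemma a_id:
  assumes w: "w \<in> C"
  shows "a w = w"
proof -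
  have aw: "a w \<in> C" using index_alg[of "[]" w] w by simp
  have "comult H (b w) (\<lambda>y z. counit H y * coord z w) = coord (b w) w"
    by (rule counit_left) (use w linear_form_coord in auto)
  also have "comult H (b w) (\<lambda>y z. counit H y * coord z w) =
      (\<Sum>i\<le>length w. counit H (b (a (take i w))) * coord (b (a (drop i w))) w)"
    by (rule comult_basis[OF w bilinear_form_times[OF counit_linear linear_form_coord]])
  also have "\<dots> = (\<Sum>i\<le>length w. if i = 0 then coord (b (a w)) w else 0)"
  proof (rule sum.cong[OF refl])
    fix i assume i: "i \<in> {..length w}"
    have "length (a (take i w)) = i" using a_take_drop(3)[OF w, of i] i by simp
    then have "a (take i w) = [] \<longleftrightarrow> i = 0" by (metis length_0_conv)
    then show "counit H (b (a (take i w))) * coord (b (a (drop i w))) w =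
        (if i = 0 then coord (b (a w)) w else 0)"
      using counit_b[OF a_take_drop(1)[OF w, of i]] by simp
  qed
  finally show ?thesis using w aw by (simp add: coord_basis split: if_splits)
qed

text \<open>Compatibility of the coproduct with the product, paired with a form that tests the left
  factor for a property of words and counts the right factor.\<close>
lemma prefix_count:
  assumes u: "u \<in> C" and v: "v \<in> C"
  shows "(\<Sum>w\<in>#shifted_shuffle u v. \<Sum>i\<le>length w. of_bool (P (a (take i w)))) =
    (\<Sum>i\<le>length u. \<Sum>j\<le>length v.
      size (filter_mset P (shifted_shuffle (a (take i u)) (a (take j v)))) *
      size (shifted_shuffle (a (drop i u)) (a (drop j v))))" (is "?l = ?r")
proof -
  define f where "f = form (\<lambda>w. of_bool (P w))"
  define g where "g = form (\<lambda>w. 1)"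
  have f: "linear_form H f" "\<And>w. w \<in> C \<Longrightarrow> f (b w) = of_bool (P w)"
    unfolding f_def by (simp_all add: linear_form_form form_basis)
  have g: "linear_form H g" "\<And>w. w \<in> C \<Longrightarrow> g (b w) = 1"
    unfolding g_def by (simp_all add: linear_form_form form_basis)
  note fg = bilinear_form_times[OF f(1) g(1)]
  have fp: "f (b p \<otimes> b q) = of_nat (size (filter_mset P (shifted_shuffle p q)))"
    if "p \<in> C" "q \<in> C" for p q
  proof -
    have "f (b p \<otimes> b q) = (\<Sum>w\<in>#shifted_shuffle p q. of_bool (P w))"
      unfolding b_mult_form[OF f(1) that]
      by (intro arg_cong[where f = sum_mset] image_mset_cong f(2) index_shuffle[OF that])
    then show ?thesis by (simp add: sum_mset_of_bool)
  qed
  have gp: "g (b p \<otimes> b q) = of_nat (size (shifted_shuffle p q))" if "p \<in> C" "q \<in> C" for p q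
  proof -
    have "g (b p \<otimes> b q) = (\<Sum>w\<in>#shifted_shuffle p q. 1)"
      unfolding b_mult_form[OF g(1) that]
      by (intro arg_cong[where f = sum_mset] image_mset_cong g(2) index_shuffle[OF that])
    then show ?thesis by simp
  qed
  have "comult H (b u \<otimes> b v) (\<lambda>x y. f x * g y) =
      (\<Sum>w\<in>#shifted_shuffle u v. comult H (b w) (\<lambda>x y. f x * g y))"
    by (rule b_mult_form[OF linear_form_comult[OF fg] u v])
  also have "\<dots> = (\<Sum>w\<in>#shifted_shuffle u v. of_nat (\<Sum>i\<le>length w. of_bool (P (a (take i w)))))"
  proof (intro arg_cong[where f = sum_mset] image_mset_cong)
    fix w assume "w \<in># shifted_shuffle u v"
    then have w: "w \<in> C" by (rule index_shuffle[OF u v])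
    show "comult H (b w) (\<lambda>x y. f x * g y) = of_nat (\<Sum>i\<le>length w. of_bool (P (a (take i w))))"
      unfolding comult_basis[OF w fg] of_nat_sum
      by (intro sum.cong refl) (simp add: f(2) g(2) a_take_drop[OF w])
  qed
  also have "\<dots> = of_nat ?l"
    by (rule sum_mset_of_nat)
  finally have 1: "comult H (b u \<otimes> b v) (\<lambda>x y. f x * g y) = of_nat ?l" .
  have "comult H (b u \<otimes> b v) (\<lambda>x y. f x * g y) =
      comult H (b u) (\<lambda>x\<^sub>1 x\<^sub>2. comult H (b v) (\<lambda>y\<^sub>1 y\<^sub>2. f (x\<^sub>1 \<otimes> y\<^sub>1) * g (x\<^sub>2 \<otimes> y\<^sub>2)))"
    by (rule comult_mult) (use u v fg in auto)
  also have "\<dots> = (\<Sum>i\<le>length u. comult H (b v) (\<lambda>y\<^sub>1 y\<^sub>2. f (b (a (take i u)) \<otimes> y\<^sub>1) * g (b (a (drop i u)) \<otimes> y\<^sub>2)))"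
    by (rule comult_basis[OF u], rule tensor_bilinear[OF comult_closed[OF basis_closed[OF v]] _ _ vspace_H])
      (rule bilinear_form_mult2[OF fg]; assumption)+
  also have "\<dots> = (\<Sum>i\<le>length u. \<Sum>j\<le>length v. f (b (a (take i u)) \<otimes> b (a (take j v))) * g (b (a (drop i u)) \<otimes> b (a (drop j v))))"
    by (intro sum.cong refl comult_basis[OF v] bilinear_form_mult2(1)[OF fg] basis_closed a_take_drop[OF u])
  also have "\<dots> = of_nat ?r"
    by (simp add: fp gp a_take_drop[OF u] a_take_drop[OF v])
  finally have "(of_nat ?l :: 'k) = of_nat ?r" unfolding 1 .
  \<comment> \<open>Here characteristic 0 turns an equation of scalars into one of natural
    numbers.\<close>
  then show ?thesis by (simp only: of_nat_eq_iff)
qed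

text \<open>Otherwise \<open>[s]\<close> and the shifted \<open>[s']\<close> are the same word, and
  both of their shuffles are \<open>[s, s]\<close>. In \<open>prefix_count\<close> the prefix
  \<open>[s]\<close> then counts twice on the left but once on the right, where the prefix
  \<open>[s']\<close> of the second factor does not match.\<close>

lemma letters_of_degree_1:
  assumes "[s] \<in> C" "[s'] \<in> C"
  shows "s \<noteq> s' + 1"
proof
  assume s: "s = s' + 1"
  have "a [s] = [s]" "a [s'] = [s']" using assms by (auto intro: a_id)
  moreover have "a [] = []" using a_id[OF one_eq(1)] .
  moreover have "length (a [s, s]) = 2"
    using assms(1) C_words[OF assms(1)] by (subst length_a) (auto simp: words_def)
  then have "a [s, s] \<noteq> [s]" by auto
  ultimately show False
    using prefix_count[OF assms, of "\<lambda>w. w = [s]"] s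
    by (simp add: shifted_shuffle_def shift_def del: sum_of_bool_eq)
qed

section \<open>The window of letters of an index word\<close>

definition letters :: "nat set" where
  "letters = (\<Union>w\<in>C. set w)"

text \<open>Otherwise the two factors can be permuted so that they begin with \<open>x\<close> and \<open>y\<close>. Count the prefixes
  of two equal letters on both sides of the compatibility of coproduct and product: the shuffles
  that begin with one \<open>x\<close> from each factor occur only on the left, because by
  \<open>letters_of_degree_1\<close> no product of two basis elements of degree 1 contains such a word.\<close>
lemma letters_separated:
  assumes "x # u \<in> C" "y # v \<in> C"
  shows "x \<noteq> y + Suc (length u)"
proof
  assume x: "x = y + Suc (length u)"
  define E where "E w \<longleftrightarrow> (\<exists>t w'. w = t # t # w')" for w :: word
  define P where "P w \<longleftrightarrow> (\<exists>t. w = [t, t])" for w :: word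
  define v' where "v' = shift (Suc (length u)) v"
  let ?u = "x # u" and ?v = "y # v"
  \<comment> \<open>\<open>P\<close> depends only on the packed word, and \<open>a\<close> preserves
    packed words.\<close>
  have P_a: "P (a w) \<longleftrightarrow> P w" if w: "w \<in> words" for w
  proof -
    have eq: "P z \<longleftrightarrow> length z = 2 \<and> pack z ! 0 = pack z ! 1" for z
    proof (cases "length z = 2")
      case True
      then obtain s t where z: "z = [s, t]" by (auto simp: length_Suc_conv numeral_2_eq_2)
      then show ?thesis using pack_nth_eq_iff[of 0 z 1] unfolding P_def by (simp add: eq_commute)
    next
      case False
      then show ?thesis unfolding P_def by auto
    qed
    show ?thesis unfolding eq using w by (simp add: alg_pack)
  qed
  have E_P: "P (take 2 w) \<longleftrightarrow> E w" for w
    by (cases w; cases "tl w") (auto simp: P_def E_def)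
  \<comment> \<open>Only the prefix of length 2 can satisfy \<open>P\<close>, so the inner sum tests
    whether \<open>w\<close> begins with two equal letters.\<close>
  have lhs: "(\<Sum>i\<le>length w. of_bool (P (a (take i w)))) = (of_bool (E w) :: nat)" if w: "w \<in> C" for w
  proof -
    have "(\<Sum>i\<le>length w. of_bool (P (a (take i w)))) = (\<Sum>i\<le>length w. if i = 2 then of_bool (E w) else (0 :: nat))"
    proof (rule sum.cong[OF refl])
      fix i assume i: "i \<in> {..length w}"
      have 1: "P (a (take i w)) \<longleftrightarrow> P (take i w)"
        using words_take_drop[OF C_words[OF w]] by (intro P_a) blast
      have 2: "i = 2" if "P (take i w)"
      proof -
        from that obtain t where "take i w = [t, t]" unfolding P_def by blast
        then have "length (take i w) = 2" by simp
        then show "i = 2" using i by simp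
      qed
      show "of_bool (P (a (take i w))) = (if i = 2 then of_bool (E w) else (0 :: nat))"
      proof (cases "i = 2")
        case True
        show ?thesis unfolding 1 unfolding True E_P by simp
      next
        case False
        then have "\<not> P (take i w)" using 2 by blast
        then show ?thesis unfolding 1 using False by simp
      qed
    qed
    also have "\<dots> = of_bool (E w)"
    proof -
      have "E w \<longrightarrow> 2 \<le> length w" unfolding E_def by auto
      then show ?thesis by auto
    qed
    finally show ?thesis .
  qed
  define T where "T i j = size (filter_mset P (shifted_shuffle (a (take i ?u)) (a (take j ?v)))) *
      size (shifted_shuffle (a (drop i ?u)) (a (drop j ?v)))" for i j
  \<comment> \<open>The left prefixes must have total length 2, and the split into 1 and 1 is
    excluded by \<open>letters_of_degree_1\<close>.\<close>
  have T: "T i j = 0" if i: "i \<le> length ?u" and j: "j \<le> length ?v" and ij: "(i, j) \<noteq> (2, 0)" "(i, j) \<noteq> (0, 2)" for i j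
  proof -
    let ?p = "a (take i ?u)" and ?q = "a (take j ?v)"
    note p = a_take_drop(1,3)[OF assms(1), of i] and q = a_take_drop(1,3)[OF assms(2), of j]
    have "\<not> P w" if w: "w \<in># shifted_shuffle ?p ?q" for w
    proof
      assume P: "P w"
      have "length w = i + j"
        using length_shuffle[OF w[unfolded shifted_shuffle_def]] p(2) q(2) i j by simp
      with P ij have "i = 1" "j = 1" by (auto simp: P_def)
      then obtain s s' where s: "?p = [s]" "?q = [s']"
        using p(2) q(2) by (auto simp: length_Suc_conv)
      then show False
        using letters_of_degree_1[of s s'] p(1) q(1) w P
        by (auto simp: shifted_shuffle_def shift_def P_def)
    qed
    then have "filter_mset P (shifted_shuffle ?p ?q) = {#}" by simp
    then show ?thesis by (simp add: T_def)
  qed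
  have "size (filter_mset E (shifted_shuffle ?u ?v)) = (\<Sum>w\<in>#shifted_shuffle ?u ?v. of_bool (E w))"
    by (simp add: sum_mset_of_bool)
  also have "\<dots> = (\<Sum>w\<in>#shifted_shuffle ?u ?v. \<Sum>i\<le>length w. of_bool (P (a (take i w))))"
    by (intro arg_cong[where f = sum_mset] image_mset_cong lhs[symmetric] index_shuffle[OF assms])
  also have "\<dots> = (\<Sum>i\<le>length ?u. \<Sum>j\<le>length ?v. T i j)"
    unfolding T_def by (rule prefix_count[OF assms])
  also have "\<dots> = (\<Sum>(i, j)\<in>{..length ?u} \<times> {..length ?v}. T i j)"
    by (rule sum.cartesian_product)
  also have "\<dots> = (\<Sum>(i, j)\<in>({..length ?u} \<times> {..length ?v}) \<inter> {(2, 0), (0, 2)}. T i j)"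
  proof (rule sum.mono_neutral_right)
    show "\<forall>p\<in>{..length ?u} \<times> {..length ?v} - ({..length ?u} \<times> {..length ?v}) \<inter> {(2, 0), (0, 2)}.
        (case p of (i, j) \<Rightarrow> T i j) = 0"
    proof
      fix p assume "p \<in> {..length ?u} \<times> {..length ?v} - ({..length ?u} \<times> {..length ?v}) \<inter> {(2, 0), (0, 2)}"
      then obtain i j where p: "p = (i, j)" "i \<le> length ?u" "j \<le> length ?v" "(i, j) \<noteq> (2, 0)" "(i, j) \<noteq> (0, 2)"
        by blast
      then show "(case p of (i, j) \<Rightarrow> T i j) = 0" using T[OF p(2-5)] by simp
    qed
  qed auto
  also have "\<dots> \<le> (\<Sum>(i, j)\<in>{(2, 0), (0, 2)}. T i j)"
    by (rule sum_mono2) auto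
  also have "\<dots> = T 2 0 + T 0 2" by simp
  finally have le: "size (filter_mset E (shifted_shuffle ?u ?v)) \<le> T 2 0 + T 0 2" .
  have Nil: "a [] = []" using a_id[OF one_eq(1)] .
  have len: "length (a (drop i w)) = length w - i" if "w \<in> C" for i w
    using a_take_drop(4)[OF that] .
  have a0: "a ?u = ?u" "a ?v = ?v" using assms a_id by auto
  have P2: "P (a (take 2 w)) \<longleftrightarrow> E w" if "w \<in> C" for w
    using P_a[of "take 2 w"] E_P[of w] words_take_drop[OF C_words[OF that], of 2] by simp
  \<comment> \<open>A shifted shuffle with an empty left word is the right word shifted by
    0.\<close>
  have P2s: "P (shift 0 (a (take 2 w))) \<longleftrightarrow> E w" if "w \<in> C" for w
    using P2[OF that] by (simp add: shift_def)
  have E_u: "E ?u \<longleftrightarrow> (\<exists>u'. u = x # u')" by (auto simp: E_def)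
  \<comment> \<open>By the choice of \<open>x\<close>, shifting turns the first letter
    \<open>y\<close> of \<open>?v\<close> into \<open>x\<close>, so two equal letters at its start
    mean that \<open>v'\<close> begins with \<open>x\<close>.\<close>
  have E_v: "E ?v \<longleftrightarrow> (\<exists>v''. v' = x # v'')"
    unfolding E_def v'_def x by (cases v) (auto simp: shift_def)
  have T20: "T 2 0 = (if \<exists>u'. u = x # u' then size (shuffle (tl u) (x # v')) else 0)"
  proof -
    have "T 2 0 = of_bool (E ?u) * size (shifted_shuffle (a (drop 2 ?u)) ?v)"
      unfolding T_def using P2[OF assms(1)] by (simp add: Nil a0 shifted_shuffle_def shift_def)
    then show ?thesis
      unfolding E_u using len[OF assms(1), of 2]
      by (auto simp: shifted_shuffle_def size_shuffle v'_def)
  qed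
  have T02: "T 0 2 = (if \<exists>v''. v' = x # v'' then size (shuffle (x # u) (tl v')) else 0)"
  proof -
    have "T 0 2 = of_bool (E ?v) * size (shifted_shuffle ?u (a (drop 2 ?v)))"
      unfolding T_def using P2s[OF assms(2)] by (simp add: Nil a0 shifted_shuffle_def)
    then show ?thesis
      unfolding E_v using len[OF assms(2), of 2]
      by (auto simp: shifted_shuffle_def size_shuffle v'_def shift_def)
  qed
  have sh: "shifted_shuffle ?u ?v = shuffle (x # u) (x # v')"
    unfolding shifted_shuffle_def v'_def x by (simp add: shift_def del: shuffle.simps)
  have E: "E = (\<lambda>w. \<exists>t w'. w = t # t # w')"
    by (rule ext) (rule E_def)
  \<comment> \<open>The shuffles with both initial letters from one factor match
    \<open>T 2 0\<close> and \<open>T 0 2\<close> exactly; those with one from each factor are in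
    excess.\<close>
  have "2 * size (shuffle u v') + T 2 0 + T 0 2 \<le> size (filter_mset E (shifted_shuffle ?u ?v))"
    unfolding T20 T02 E sh by (rule size_shuffle_square)
  with le have "size (shuffle u v') = 0" by linarith
  then show False by (simp add: size_shuffle)
qed

text \<open>Multiplication by an index word of length 1 raises every letter of \<open>v\<close> by
  one; such a word is obtained by applying \<open>a\<close> to the first letter of
  \<open>v\<close>.\<close>

lemma letters_Suc:
  assumes "y \<in> letters"
  shows "Suc y \<in> letters"
proof -
  obtain v where v: "v \<in> C" "y \<in> set v" using assms by (auto simp: letters_def)
  then obtain z v' where z: "v = z # v'" by (cases v) auto
  have s: "a [z] \<in> C" "length (a [z]) = 1"
    using a_take_drop(1,3)[OF v(1), of 1] z by auto
  have "a [z] @ shift 1 v \<in># shifted_shuffle (a [z]) v"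
    unfolding shifted_shuffle_def s(2) by (rule append_in_shuffle)
  then have "a [z] @ shift 1 v \<in> C" by (rule index_shuffle[OF s(1) v(1)])
  moreover have "Suc y \<in> set (a [z] @ shift 1 v)" using v(2) by (auto simp: shift_def)
  ultimately show ?thesis unfolding letters_def by blast
qed

text \<open>It need not be 1: adding a constant to every letter of all permutations gives another
  possible class of index words. The default keeps it positive when the empty word is the only index
  word.\<close>

definition least_letter :: nat where
  "least_letter = (if letters = {} then 1 else LEAST y. y \<in> letters)"

lemma least_letter_pos: "1 \<le> least_letter"
proof (cases "letters = {}")
  case False
  then have "least_letter \<in> letters"
    unfolding least_letter_def by (auto intro: LeastI)
  then show ?thesis
    using index_words by (auto simp: letters_def words_def in_lists_conv_set)
qed (simp add: least_letter_def)

text \<open>It follows that the homogeneous components are finite-dimensional, and that the two words in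
  a shifted shuffle occupy disjoint intervals of letters.\<close>
lemma letters_window:
  assumes u: "u \<in> C" and x: "x \<in> set u"
  shows "least_letter \<le> x" "x < least_letter + length u"
proof -
  have xl: "x \<in> letters" using assms by (auto simp: letters_def)
  then have m: "least_letter = (LEAST y. y \<in> letters)" by (auto simp: least_letter_def)
  then show "least_letter \<le> x" using xl by (simp add: Least_le)
  have "least_letter + j \<in> letters" for j
  proof (induction j)
    case 0
    show ?case unfolding m using LeastI[of "\<lambda>y. y \<in> letters", OF xl] by simp
  qed (simp add: letters_Suc)
  show "x < least_letter + length u"
  \<comment> \<open>A letter beyond the window has the form \<open>y + length u\<close>, where
    \<open>y\<close> is \<open>least_letter + j\<close> and hence itself a letter. Bringing
    \<open>x\<close> and \<open>y\<close> to the front of their words contradicts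
    \<open>letters_separated\<close>; removing \<open>x\<close> from \<open>u\<close> accounts for
    the successor there.\<close>
  proof (rule ccontr)
    assume "\<not> x < least_letter + length u"
    then obtain j where j: "x = least_letter + j + length u"
      by (metis add.assoc add.commute le_Suc_ex not_less)
    obtain v where v: "v \<in> C" "least_letter + j \<in> set v"
      using \<open>\<And>j. least_letter + j \<in> letters\<close>[of j] by (auto simp: letters_def)
    have "x # remove1 x u \<in> C" "(least_letter + j) # remove1 (least_letter + j) v \<in> C"
      using x v by (auto intro: C_mset[OF u] C_mset[OF v(1)])
    from letters_separated[OF this] show False
      using x j by (simp add: length_remove1) (metis Suc_pred length_pos_if_in_set add_Suc_right)
  qed
qed

lemma finite_C: "finite {w \<in> C. length w = n}"
proof (rule finite_subset)
  show "{w \<in> C. length w = n} \<subseteq> {w. set w \<subseteq> {..<least_letter + n} \<and> length w = n}"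
    using letters_window by auto
qed (rule finite_lists_length_eq, simp)

end

sublocale shuffle_like_char0 \<subseteq> graded_hopf_basis H gr C b length
  by unfold_locales (rule finite_C)

section \<open>Congruences\<close>

context shuffle_like_char0
begin

text \<open>If \<open>w\<close> occurs in the shifted shuffle of \<open>u\<close> and \<open>v\<close> and \<open>u\<close> has length \<open>k\<close>, then
  \<open>u = low k w\<close> and \<open>v = high k w\<close>.\<close>
definition low :: "nat \<Rightarrow> word \<Rightarrow> word" where
  "low k w = filter (\<lambda>x. x < least_letter + k) w"

definition high :: "nat \<Rightarrow> word \<Rightarrow> word" where
  "high k w = map (\<lambda>i. i - k) (filter (\<lambda>x. \<not> x < least_letter + k) w)"

lemma shift_high: "shift k (high k w) = filter (\<lambda>x. \<not> x < least_letter + k) w"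
  unfolding high_def shift_def map_map comp_def by (rule map_idI) auto

lemma shift_inj: "shift k u = shift k v \<longleftrightarrow> u = v"
  unfolding shift_def by (rule inj_map_eq_map) (auto simp: inj_def)

text \<open>By \<open>letters_window\<close>, the letters of \<open>u\<close> lie below the
  threshold \<open>least_letter + length u\<close>, and the shifted letters of \<open>v\<close> do
  not.\<close>

lemma count_shifted_shuffle:
  assumes u: "u \<in> C" and v: "v \<in> C"
  shows "count (shifted_shuffle u v) w = of_bool (low (length u) w = u \<and> high (length u) w = v)"
proof -
  have "count (shifted_shuffle u v) w = of_bool (filter (\<lambda>x. x < least_letter + length u) w = u \<and>
      filter (\<lambda>x. \<not> x < least_letter + length u) w = shift (length u) v)"
    unfolding shifted_shuffle_def
    by (rule count_shuffle_separated)
      (auto simp: shift_def not_less intro: letters_window(1)[OF v] letters_window(2)[OF u])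
  also have "filter (\<lambda>x. \<not> x < least_letter + length u) w = shift (length u) v \<longleftrightarrow> high (length u) w = v"
    unfolding shift_high[symmetric] by (rule shift_inj)
  finally show ?thesis by (simp add: low_def)
qed

text \<open>\<open>k\<close> runs over the possible lengths of the left factor. The indicator keeps
  those \<open>k\<close> for which cutting at the corresponding threshold really yields a left
  factor of length \<open>k\<close>.\<close>

lemma coord_mult:
  assumes x: "x \<in> carrier H" and y: "y \<in> carrier H"
  shows "coord (x \<otimes> y) w =
    (\<Sum>k\<le>length w. of_bool (length (low k w) = k) * (coord x (low k w) * coord y (high k w)))"
proof (rule bilinear_form_eqI[OF bilinear_form_mult[OF linear_form_coord] _ _ x y])
  show "bilinear_form H (\<lambda>x y. \<Sum>k\<le>length w. of_bool (length (low k w) = k) * (coord x (low k w) * coord y (high k w)))"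
    unfolding bilinear_form_def linear_form_def
    by (auto simp: coord_add coord_smult algebra_simps sum.distrib sum_distrib_left
        simp del: sum_of_bool_mult_eq sum_mult_of_bool_eq)
  fix u v assume u: "u \<in> C" and v: "v \<in> C"
  have "coord (b u \<otimes> b v) w = of_nat (count (shifted_shuffle u v) w)"
    unfolding mult_basis[OF u v]
    by (subst coord_finsum) (auto simp: not_in_iff intro: index_shuffle[OF u v])
  also have "\<dots> = (\<Sum>k\<le>length w. if k = length u then of_bool (low k w = u \<and> high k w = v) else 0)"
  proof -
    \<comment> \<open>This puts \<open>k = length u\<close> into the range of the sum whenever its
      term is nonzero.\<close>
    have "length (low k w) \<le> length w" for k by (simp add: low_def)
    then have "low (length u) w = u \<Longrightarrow> length u \<le> length w" by metis
    then show ?thesis unfolding count_shifted_shuffle[OF u v] by (auto simp: sum.delta)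
  qed
  also have "\<dots> = (\<Sum>k\<le>length w. of_bool (length (low k w) = k) * (coord (b u) (low k w) * coord (b v) (high k w)))"
    using u v by (intro sum.cong refl) (auto simp: coord_basis)
  finally show "coord (b u \<otimes> b v) w =
      (\<Sum>k\<le>length w. of_bool (length (low k w) = k) * (coord (b u) (low k w) * coord (b v) (high k w)))" .
qed

text \<open>\<open>a\<close> preserves lengths, so only the cut after \<open>length p\<close>
  letters can produce \<open>p\<close> on the left.\<close>

lemma coord_comult:
  assumes x: "x \<in> carrier H" and p: "p \<in> C"
  shows "comult H x (\<lambda>y z. coord y p * coord z q) =
    (\<Sum>w | coord x w \<noteq> 0 \<and> a (take (length p) w) = p \<and> a (drop (length p) w) = q. coord x w)"
proof -
  have bil: "bilinear_form H (\<lambda>y z. coord y p * coord z q)"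
    by (intro bilinear_form_times linear_form_coord)
  have basis: "comult H (b w) (\<lambda>y z. coord y p * coord z q) =
      of_bool (a (take (length p) w) = p \<and> a (drop (length p) w) = q)" if w: "w \<in> C" for w
  proof -
    have "comult H (b w) (\<lambda>y z. coord y p * coord z q) =
        (\<Sum>i\<le>length w. coord (b (a (take i w))) p * coord (b (a (drop i w))) q)"
      by (rule comult_basis[OF w bil])
    also have "\<dots> = (\<Sum>i\<le>length w. if i = length p then of_bool (a (take i w) = p \<and> a (drop i w) = q) else 0)"
    proof (rule sum.cong[OF refl])
      fix i assume "i \<in> {..length w}"
      then have "length (a (take i w)) = i" using a_take_drop(3)[OF w, of i] by simp
      then show "coord (b (a (take i w))) p * coord (b (a (drop i w))) q =
          (if i = length p then of_bool (a (take i w) = p \<and> a (drop i w) = q) else 0)"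
        using coord_basis[OF a_take_drop(1)[OF w, of i]] coord_basis[OF a_take_drop(2)[OF w, of i]] by auto
    qed
    also have "\<dots> = of_bool (a (take (length p) w) = p \<and> a (drop (length p) w) = q)"
    proof -
      have "length p \<le> length w" if "a (take (length p) w) = p"
        using a_take_drop(3)[OF w, of "length p"] unfolding that by simp
      then show ?thesis by (auto simp: sum.delta)
    qed
    finally show ?thesis .
  qed
  have "comult H x (\<lambda>y z. coord y p * coord z q) =
      (\<Sum>w | coord x w \<noteq> 0. coord x w * comult H (b w) (\<lambda>y z. coord y p * coord z q))"
    by (rule linear_form_expansion[OF linear_form_comult[OF bil] x finite_coord[OF x] coord_support[OF x] order_refl])
  also have "\<dots> = (\<Sum>w | coord x w \<noteq> 0.
      if a (take (length p) w) = p \<and> a (drop (length p) w) = q then coord x w else 0)"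
    using coord_support[OF x] by (intro sum.cong refl) (simp add: basis subset_iff)
  also have "\<dots> = (\<Sum>w | coord x w \<noteq> 0 \<and> a (take (length p) w) = p \<and> a (drop (length p) w) = q. coord x w)"
    by (rule sum.mono_neutral_cong_right) (auto simp: finite_coord[OF x])
  finally show ?thesis .
qed

end

section \<open>The congruence on index words\<close>

locale shuffle_congruence = shuffle_like_char0 H gr C b a
  for H :: "('k::field_char_0, 'v) hopf" (structure) and gr C b a +
  fixes E :: "(word \<times> word) set"
  assumes cong: "congruence E"
    and E_iff: "u \<in> words \<Longrightarrow> v \<in> words \<Longrightarrow> (u, v) \<in> E \<longleftrightarrow> ev u = ev v \<and> (pack u, pack v) \<in> E"
    and E_restr: "interval I \<Longrightarrow> (u, v) \<in> E \<Longrightarrow> (restr_word u I, restr_word v I) \<in> E"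
begin

lemma equiv_E: "equiv words E"
  using cong by (simp add: congruence_def)

lemma E_words: "(u, v) \<in> E \<Longrightarrow> u \<in> words" "(u, v) \<in> E \<Longrightarrow> v \<in> words"
  using equiv_type[OF equiv_E] by auto

lemma E_refl: "u \<in> words \<Longrightarrow> (u, u) \<in> E"
  using equiv_E by (auto simp: equiv_def refl_on_def)

lemma E_sym: "(u, v) \<in> E \<Longrightarrow> (v, u) \<in> E"
  using equiv_E by (auto simp: equiv_def dest: symD)

lemma E_trans: "(u, v) \<in> E \<Longrightarrow> (v, w) \<in> E \<Longrightarrow> (u, w) \<in> E"
  using equiv_E by (auto simp: equiv_def dest: transD)

lemma E_append:
  assumes "(u, u') \<in> E" "(v, v') \<in> E"
  shows "(u @ v, u' @ v') \<in> E"
proof -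
  have *: "(x @ u @ y, x @ v @ y) \<in> E" if "(u, v) \<in> E" "x \<in> words" "y \<in> words" for u v x y
    using cong that unfolding congruence_def by blast
  have "[] \<in> words" by (simp add: words_def)
  then have "(u @ v, u' @ v) \<in> E" "(u' @ v, u' @ v') \<in> E"
    using *[OF assms(1), of "[]" v] *[OF assms(2), of u' "[]"] E_words[OF assms(1)] E_words[OF assms(2)] by auto
  then show ?thesis by (rule E_trans)
qed

lemma E_mset: "(u, v) \<in> E \<Longrightarrow> mset u = mset v"
  using E_iff[of u v] E_words[of u v] by (simp add: ev_eq_iff)

lemma E_length: "(u, v) \<in> E \<Longrightarrow> length u = length v"
  using E_mset[of u v] by (metis size_mset)

lemma E_C: "(u, v) \<in> E \<Longrightarrow> u \<in> C \<longleftrightarrow> v \<in> C"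
  using C_mset[of u v] C_mset[of v u] E_mset[of u v] by auto

lemma E_low:
  assumes "(u, v) \<in> E"
  shows "(low k u, low k v) \<in> E"
  unfolding low_def restr_word_interval(1)[OF E_words(1)[OF assms], symmetric]
    restr_word_interval(1)[OF E_words(2)[OF assms], symmetric]
  by (rule E_restr[OF interval_Ico(1) assms])

text \<open>Condition (2) yields the equivalence of the shifted words. Packing ignores the shift and
  evaluations can be shifted back, so condition (1) removes it.\<close>

lemma E_high:
  assumes uv: "(u, v) \<in> E"
  shows "(high k u, high k v) \<in> E"
proof -
  have F: "(shift k (high k u), shift k (high k v)) \<in> E"
    unfolding shift_high restr_word_interval(2)[OF E_words(1)[OF uv], symmetric]
      restr_word_interval(2)[OF E_words(2)[OF uv], symmetric]
    by (rule E_restr[OF interval_Ico(2) uv])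
  have words: "high k w \<in> words" for w
    using least_letter_pos by (auto simp: high_def words_def in_lists_conv_set)
  have "mset (high k u) = mset (high k v)"
  proof -
    have "mset (high k w) = image_mset (\<lambda>i. i - k) (mset (shift k (high k w)))" for w
      unfolding shift_high by (simp add: high_def)
    then show ?thesis using E_mset[OF F] by simp
  qed
  moreover have "(pack (high k u), pack (high k v)) \<in> E"
    using F E_iff[OF E_words[OF F]] by (simp add: pack_shift)
  ultimately show ?thesis
    using E_iff[OF words words, of u v] by (simp add: ev_eq_iff)
qed

section \<open>Elements with coordinates constant on classes\<close>

definition B :: "'v set" where
  "B = {x \<in> carrier H. \<forall>(u, v)\<in>E. coord x u = coord x v}"

lemma B_closed: "x \<in> B \<Longrightarrow> x \<in> carrier H"
  and B_coord: "x \<in> B \<Longrightarrow> (u, v) \<in> E \<Longrightarrow> coord x u = coord x v"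
  by (auto simp: B_def)

lemma B_I: "x \<in> carrier H \<Longrightarrow> (\<And>u v. (u, v) \<in> E \<Longrightarrow> coord x u = coord x v) \<Longrightarrow> x \<in> B"
  by (auto simp: B_def)

lemma B_vsubspace: "vsubspace B H"
proof (rule submoduleI)
  show "B \<subseteq> carrier H" using B_closed by blast
  show "\<zero> \<in> B" by (rule B_I) (simp_all add: coord_zero)
  fix x assume x: "x \<in> B"
  have "coord (\<ominus> x) u = - coord x u" for u
    using coord_minus[of \<zero> x u] B_closed[OF x]
    by (simp add: a_minus_def coord_zero)
  then show "\<ominus> x \<in> B"
    using B_closed[OF x] by (intro B_I) (auto dest: B_coord[OF x])
  show "x \<oplus> y \<in> B" if y: "y \<in> B" for y
    using B_closed[OF x] B_closed[OF y] B_coord[OF x] B_coord[OF y] by (intro B_I) (auto simp: coord_add)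
  show "c \<odot> x \<in> B" for c
    using B_closed[OF x] B_coord[OF x] by (intro B_I) (auto simp: coord_smult)
qed

lemma B_one: "\<one> \<in> B"
proof (rule B_I)
  fix u v assume "(u, v) \<in> E"
  then have "u = [] \<longleftrightarrow> v = []" using E_length by fastforce
  then show "coord \<one> u = coord \<one> v"
    unfolding one_eq(2) coord_basis[OF one_eq(1)] by simp
qed simp

text \<open>In \<open>coord_mult\<close> the word enters only through its length, its low part and
  its high part, all of which respect the congruence.\<close>

lemma B_mult:
  assumes x: "x \<in> B" and y: "y \<in> B"
  shows "x \<otimes> y \<in> B"
proof (rule B_I)
  fix u v assume uv: "(u, v) \<in> E"
  have "coord x (low k u) = coord x (low k v)" "coord y (high k u) = coord y (high k v)"
      "length (low k u) = length (low k v)" for k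
    using B_coord[OF x E_low[OF uv]] B_coord[OF y E_high[OF uv]] E_length[OF E_low[OF uv]] by auto
  then show "coord (x \<otimes> y) u = coord (x \<otimes> y) v"
    unfolding coord_mult[OF B_closed[OF x] B_closed[OF y]] E_length[OF uv] by simp
qed (use x y B_closed in auto)

text \<open>Outside \<open>C\<close> the word is returned unchanged, so that
  \<open>coord x (rep w)\<close> vanishes there.\<close>

definition rep :: "word \<Rightarrow> word" where
  "rep w = (if w \<in> C then SOME v. (v, w) \<in> E else w)"

definition proj :: "'v \<Rightarrow> 'v" where
  "proj x = vec (\<lambda>w. coord x (rep w))"

lemma rep_E: "w \<in> C \<Longrightarrow> (rep w, w) \<in> E"
  using someI[of "\<lambda>v. (v, w) \<in> E", OF E_refl[OF C_words]] by (simp add: rep_def)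

lemma rep_C: "rep w \<in> C \<longleftrightarrow> w \<in> C"
  using E_C[OF rep_E] by (cases "w \<in> C") (auto simp: rep_def)

lemma rep_eq:
  assumes "(u, v) \<in> E" "u \<in> C"
  shows "rep u = rep v"
proof -
  have "(w, u) \<in> E \<longleftrightarrow> (w, v) \<in> E" for w
    using E_trans[OF _ assms(1)] E_trans[OF _ E_sym[OF assms(1)]] by blast
  then show ?thesis
    using E_C[OF assms(1)] assms(2) by (simp add: rep_def)
qed

text \<open>Words with a given representative have its length, and there are finitely many index
  words of each length.\<close>

lemma proj_support:
  assumes x: "x \<in> carrier H"
  shows "finite {w. coord x (rep w) \<noteq> 0}" "{w. coord x (rep w) \<noteq> 0} \<subseteq> C"
proof -
  show sub: "{w. coord x (rep w) \<noteq> 0} \<subseteq> C"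
    using coord_outside[OF x] rep_C by blast
  have "{w. coord x (rep w) \<noteq> 0} \<subseteq> (\<Union>v\<in>{v. coord x v \<noteq> 0}. {w \<in> C. length w = length v})"
  proof
    fix w assume w: "w \<in> {w. coord x (rep w) \<noteq> 0}"
    then have "w \<in> C" using sub by blast
    then show "w \<in> (\<Union>v\<in>{v. coord x v \<noteq> 0}. {w \<in> C. length w = length v})"
      using w E_length[OF rep_E[of w]] by auto
  qed
  moreover have "finite (\<Union>v\<in>{v. coord x v \<noteq> 0}. {w \<in> C. length w = length v})"
    using finite_coord[OF x] finite_C by (intro finite_UN_I) auto
  ultimately show "finite {w. coord x (rep w) \<noteq> 0}" by (rule finite_subset)
qed

lemma proj_closed: "x \<in> carrier H \<Longrightarrow> proj x \<in> carrier H"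
  unfolding proj_def by (rule vec_closed) (rule proj_support)

lemma coord_proj: "x \<in> carrier H \<Longrightarrow> coord (proj x) w = coord x (rep w)"
  unfolding proj_def by (simp add: coord_vec proj_support)

lemma proj_B:
  assumes x: "x \<in> carrier H"
  shows "proj x \<in> B"
proof (rule B_I[OF proj_closed[OF x]])
  fix u v assume uv: "(u, v) \<in> E"
  show "coord (proj x) u = coord (proj x) v"
  proof (cases "u \<in> C")
    case True
    then show ?thesis using rep_eq[OF uv] by (simp add: coord_proj x)
  next
    case False
    then show ?thesis
      using E_C[OF uv] coord_outside[OF proj_closed[OF x]] by auto
  qed
qed

lemma proj_id:
  assumes x: "x \<in> B"
  shows "proj x = x"
proof (rule coord_eqI)
  show "coord (proj x) = coord x"
  proof
    fix w
    show "coord (proj x) w = coord x w"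
      unfolding coord_proj[OF B_closed[OF x]]
      using B_coord[OF x rep_E[of w]] by (cases "w \<in> C") (auto simp: rep_def)
  qed
qed (use x B_closed proj_closed in auto)

lemma proj_add: "x \<in> carrier H \<Longrightarrow> y \<in> carrier H \<Longrightarrow> proj (x \<oplus> y) = proj x \<oplus> proj y"
  by (rule coord_eqI) (auto simp: proj_closed coord_proj coord_add)

lemma proj_smult: "x \<in> carrier H \<Longrightarrow> proj (c \<odot> x) = c \<odot> proj x"
  by (rule coord_eqI) (auto simp: proj_closed coord_proj coord_smult)

lemma proj_gr:
  assumes x: "x \<in> gr n"
  shows "proj x \<in> gr n"
proof -
  note xc = gr_closed[OF x]
  have "length w = n" if "coord x (rep w) \<noteq> 0" for w
  proof -
    have "w \<in> C" using proj_support(2)[OF xc] that by blast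
    then show ?thesis using gr_coord[OF x that] E_length[OF rep_E] by simp
  qed
  then show ?thesis
    unfolding gr_iff using proj_closed[OF xc] by (simp add: coord_proj[OF xc])
qed

section \<open>Invariance of the coproduct under the congruence\<close>

lemma permute_list_inv:
  assumes "\<tau> permutes {..<length z}"
  shows "permute_list (inv_into UNIV \<tau>) (permute_list \<tau> z) = z"
  using permute_list_compose[OF permutes_inv[OF assms], of \<tau>] permutes_inv_o(1)[OF assms] by simp

text \<open>Condition (1) is used in both directions: the equivalence of \<open>a w\<close> and its
  rearrangement passes to packed words. These are the packed words of \<open>w\<close> and of its
  rearrangement, because \<open>a\<close> commutes with permutations, and a permutation leaves the
  evaluation unchanged.\<close>

lemma E_permute_a:
  assumes w: "w \<in> words" and \<sigma>: "\<sigma> permutes {..<length w}" and E: "(a w, permute_list \<sigma> (a w)) \<in> E"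
  shows "(w, permute_list \<sigma> w) \<in> E"
proof -
  have w': "permute_list \<sigma> w \<in> words"
    by (rule words_mset[OF w]) (rule mset_permute_list[OF \<sigma>])
  have "(pack (a w), pack (permute_list \<sigma> (a w))) \<in> E"
    using E_iff[OF E_words[OF E]] E by simp
  then have "(pack w, pack (permute_list \<sigma> w)) \<in> E"
    unfolding alg_permute[OF w \<sigma>, symmetric] alg_pack[OF w] alg_pack[OF w'] .
  then show ?thesis
    unfolding E_iff[OF w w'] ev_eq_iff by (simp add: mset_permute_list[OF \<sigma>])
qed

text \<open>By \<open>coord_comult\<close>, these words make up the coefficient of the coproduct of
  \<open>x\<close> at the pair \<open>p\<close>, \<open>q\<close>.\<close>

definition split_set :: "'v \<Rightarrow> word \<Rightarrow> word \<Rightarrow> word set" where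
  "split_set x p q = {w. coord x w \<noteq> 0 \<and> a (take (length p) w) = p \<and> a (drop (length p) w) = q}"

definition permute_split :: "nat \<Rightarrow> (nat \<Rightarrow> nat) \<Rightarrow> (nat \<Rightarrow> nat) \<Rightarrow> word \<Rightarrow> word" where
  "permute_split k \<sigma> \<rho> w = permute_list \<sigma> (take k w) @ permute_list \<rho> (drop k w)"

text \<open>By \<open>E_permute_a\<close> the halves of \<open>w\<close> are equivalent to their
  rearrangements, and a congruence lets the halves be glued together again. The rearranged word is
  thus in the class of \<open>w\<close>, where \<open>x\<close> has constant coordinates.\<close>

lemma permute_split_set:
  assumes x: "x \<in> B" and \<sigma>: "\<sigma> permutes {..<length p}" and \<rho>: "\<rho> permutes {..<length q}"
    and p: "(p, permute_list \<sigma> p) \<in> E" and q: "(q, permute_list \<rho> q) \<in> E"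
    and w: "w \<in> split_set x p q"
  shows "permute_split (length p) \<sigma> \<rho> w \<in> split_set x (permute_list \<sigma> p) (permute_list \<rho> q)"
    and "coord x (permute_split (length p) \<sigma> \<rho> w) = coord x w"
    and "permute_split (length p) (inv_into UNIV \<sigma>) (inv_into UNIV \<rho>) (permute_split (length p) \<sigma> \<rho> w) = w"
proof -
  let ?u = "take (length p) w" and ?v = "drop (length p) w"
  have nz: "coord x w \<noteq> 0" and a: "a ?u = p" "a ?v = q" using w by (auto simp: split_set_def)
  then have wC: "w \<in> C" using coord_outside[OF B_closed[OF x]] by blast
  have words: "?u \<in> words" "?v \<in> words" using words_take_drop[OF C_words[OF wC]] by auto
  have len: "length ?u = length p" "length ?v = length q"
    using length_a[OF words(1)] length_a[OF words(2)] a by simp_all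
  have \<sigma>': "\<sigma> permutes {..<length ?u}" unfolding len(1) by (rule \<sigma>)
  have \<rho>': "\<rho> permutes {..<length ?v}" unfolding len(2) by (rule \<rho>)
  have E: "(w, permute_split (length p) \<sigma> \<rho> w) \<in> E"
    using E_append[OF E_permute_a[OF words(1) \<sigma>'] E_permute_a[OF words(2) \<rho>']] p q
    by (simp only: a permute_split_def append_take_drop_id)
  show eq: "coord x (permute_split (length p) \<sigma> \<rho> w) = coord x w"
    using B_coord[OF x E] by simp
  have td: "take (length p) (permute_split (length p) \<sigma> \<rho> w) = permute_list \<sigma> ?u"
    "drop (length p) (permute_split (length p) \<sigma> \<rho> w) = permute_list \<rho> ?v"
    unfolding permute_split_def using len(1) by (simp_all add: min_def split: if_splits)
  show "permute_split (length p) \<sigma> \<rho> w \<in> split_set x (permute_list \<sigma> p) (permute_list \<rho> q)"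
    unfolding split_set_def using nz
    by (simp add: eq td alg_permute[OF words(1) \<sigma>'] alg_permute[OF words(2) \<rho>'] a)
  show "permute_split (length p) (inv_into UNIV \<sigma>) (inv_into UNIV \<rho>) (permute_split (length p) \<sigma> \<rho> w) = w"
    by (subst permute_split_def) (simp only: td permute_list_inv[OF \<sigma>'] permute_list_inv[OF \<rho>'] append_take_drop_id)
qed

text \<open>Permuting the letters inside the two factors is a bijection between the words that contribute
  to the two sides, and it stays inside the classes of the congruence.\<close>
lemma comult_E:
  assumes x: "x \<in> B" and p: "(p, p') \<in> E" "p \<in> C" and q: "(q, q') \<in> E"
  shows "comult H x (\<lambda>y z. coord y p * coord z q) = comult H x (\<lambda>y z. coord y p' * coord z q')"
proof -
  obtain \<sigma> where \<sigma>: "\<sigma> permutes {..<length p}" "permute_list \<sigma> p = p'"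
    using mset_eq_permutation[of p' p] E_mset[OF p(1)] by metis
  obtain \<rho> where \<rho>: "\<rho> permutes {..<length q}" "permute_list \<rho> q = q'"
    using mset_eq_permutation[of q' q] E_mset[OF q(1)] by metis
  have \<sigma>': "inv_into UNIV \<sigma> permutes {..<length p'}" "permute_list (inv_into UNIV \<sigma>) p' = p"
    using permutes_inv[OF \<sigma>(1)] permute_list_inv[OF \<sigma>(1)] \<sigma>(2) E_length[OF p(1)] by auto
  have \<rho>': "inv_into UNIV \<rho> permutes {..<length q'}" "permute_list (inv_into UNIV \<rho>) q' = q"
    using permutes_inv[OF \<rho>(1)] permute_list_inv[OF \<rho>(1)] \<rho>(2) E_length[OF q(1)] by auto
  have E1: "(p, permute_list \<sigma> p) \<in> E" "(q, permute_list \<rho> q) \<in> E"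
    and E2: "(p', permute_list (inv_into UNIV \<sigma>) p') \<in> E" "(q', permute_list (inv_into UNIV \<rho>) q') \<in> E"
    using p q \<sigma> \<rho> \<sigma>' \<rho>' by (simp_all add: E_sym)
  note fwd = permute_split_set[OF x \<sigma>(1) \<rho>(1) E1, unfolded \<sigma>(2) \<rho>(2)]
  \<comment> \<open>The inverse permutations lead back, so the same lemma supplies the other half of
    the bijection.\<close>
  note bwd = permute_split_set[OF x \<sigma>'(1) \<rho>'(1) E2, unfolded \<sigma>'(2) \<rho>'(2)
      permutes_inv_inv[OF \<sigma>(1)] permutes_inv_inv[OF \<rho>(1)] E_length[OF p(1), symmetric]]
  have "(\<Sum>w\<in>split_set x p q. coord x w) = (\<Sum>w\<in>split_set x p' q'. coord x w)"
    by (rule sum.reindex_bij_witness[where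
          i = "permute_split (length p) (inv_into UNIV \<sigma>) (inv_into UNIV \<rho>)" and j = "permute_split (length p) \<sigma> \<rho>"])
      (fact fwd bwd)+
  then show ?thesis
    using E_C[OF p(1)] p(2) by (simp add: coord_comult[OF B_closed[OF x]] split_set_def)
qed

lemma comult_proj:
  assumes x: "x \<in> B" and ps: "set ps \<subseteq> carrier H \<times> carrier H"
    "\<And>\<beta>. bilinear_form H \<beta> \<Longrightarrow> comult H x \<beta> = (\<Sum>(y, z)\<leftarrow>ps. \<beta> y z)"
    and \<beta>: "bilinear_form H \<beta>"
  shows "comult H x \<beta> = (\<Sum>(y, z)\<leftarrow>map (map_prod proj proj) ps. \<beta> y z)"
  unfolding ps(2)[OF \<beta>]
proof (rule tensor_eqI[OF ps(1) _ _ \<beta>])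
  show "set (map (map_prod proj proj) ps) \<subseteq> carrier H \<times> carrier H"
    using ps(1) by (auto intro!: proj_closed)
  fix p q assume p: "p \<in> C" and q: "q \<in> C"
  have bil: "bilinear_form H (\<lambda>y z. coord y p * coord z q)" for p q
    by (intro bilinear_form_times linear_form_coord)
  \<comment> \<open>The coordinates of a projected vector at \<open>p\<close> are those of the
    vector at \<open>rep p\<close>, so invariance under passing to representatives is all that is
    needed.\<close>
  have "(\<Sum>(y, z)\<leftarrow>ps. coord y p * coord z q) = (\<Sum>(y, z)\<leftarrow>ps. coord y (rep p) * coord z (rep q))"
    using comult_E[OF x E_sym[OF rep_E[OF p]] p E_sym[OF rep_E[OF q]]] unfolding ps(2)[OF bil] .
  also have "\<dots> = (\<Sum>(y, z)\<leftarrow>map (map_prod proj proj) ps. coord y p * coord z q)"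
    unfolding map_map comp_def
    by (rule arg_cong[where f = sum_list], rule map_cong[OF refl])
      (auto simp: coord_proj dest!: subsetD[OF ps(1)])
  finally show "(\<Sum>(y, z)\<leftarrow>ps. coord y p * coord z q) =
      (\<Sum>(y, z)\<leftarrow>map (map_prod proj proj) ps. coord y p * coord z q)" .
qed

lemma B_comult:
  assumes x: "x \<in> B"
  shows "comult H x \<in> tensors H (B \<times> B)"
proof -
  obtain ps where ps: "set ps \<subseteq> carrier H \<times> carrier H"
    "\<And>\<beta>. bilinear_form H \<beta> \<Longrightarrow> comult H x \<beta> = (\<Sum>(y, z)\<leftarrow>ps. \<beta> y z)"
    using tensorsE[OF comult_closed[OF B_closed[OF x]]] by blast
  show ?thesis
    by (rule tensorsI[OF _ comult_proj[OF x ps]]) (auto intro!: proj_B dest!: subsetD[OF ps(1)])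
qed

text \<open>The antipode is determined degree by degree: in \<open>\<Sum> S(x\<^sub>1) x\<^sub>2 = \<epsilon>(x) 1\<close>, the terms with
  \<open>x\<^sub>2\<close> of degree 0 add up to \<open>S(x)\<close>, and in all other terms \<open>x\<^sub>1\<close> has smaller degree.\<close>
lemma B_antipode_gr:
  assumes "x \<in> B" "x \<in> gr n"
  shows "antipode H x \<in> B"
  using assms
proof (induction n arbitrary: x rule: less_induct)
  case (less n)
  note x = less.prems(1)
  show ?case
  proof (rule B_I[OF antipode_closed[OF B_closed[OF x]]])
    fix u v assume uv: "(u, v) \<in> E"
    \<comment> \<open>It vanishes on \<open>B\<close>, and its value at \<open>antipode H x\<close>
      is what has to be shown to be 0.\<close>
    define f where "f y = coord y u - coord y v" for y
    have f: "linear_form H f"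
      unfolding f_def linear_form_def by (auto simp: coord_add coord_smult algebra_simps)
    have fB: "f y = 0" if "y \<in> B" for y
      unfolding f_def using B_coord[OF that uv] by simp
    have fS: "linear_form H (\<lambda>y. f (antipode H y))"
      using f by (simp add: linear_form_def antipode_add antipode_smult antipode_closed)
    obtain ps where ps: "set ps \<subseteq> (\<Union>i\<le>n. gr i \<times> gr (n - i))"
      "\<And>\<beta>. bilinear_form H \<beta> \<Longrightarrow> comult H x \<beta> = (\<Sum>(y, z)\<leftarrow>ps. \<beta> y z)"
      using tensorsE[OF gr_comult[OF less.prems(2)]] by metis
    have ps_carrier: "set ps \<subseteq> carrier H \<times> carrier H"
      using ps(1) gr_closed by blast
    \<comment> \<open>The projected list has homogeneous factors in \<open>B\<close>, as the
      induction hypothesis demands.\<close>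
    let ?qs = "map (map_prod proj proj) ps"
    have summand: "f (antipode H y) * counit H z = f (antipode H y \<otimes> z)" if yz: "(y, z) \<in> set ?qs" for y z
    proof -
      obtain y' z' where y': "(y', z') \<in> set ps" "y = proj y'" "z = proj z'" using yz by auto
      then obtain i where i: "i \<le> n" "y' \<in> gr i" "z' \<in> gr (n - i)" using ps(1) by blast
      have y: "y \<in> B" "y \<in> gr i" and z: "z \<in> B" "z \<in> gr (n - i)"
        using i y' by (auto intro: proj_B proj_gr gr_closed)
      show ?thesis
      \<comment> \<open>For \<open>i = n\<close> the right factor is a scalar multiple of the unit,
        and both sides are that scalar times \<open>f (antipode H y)\<close>. Otherwise
        \<open>antipode H y\<close> is in \<open>B\<close> by induction, and both sides are
        0.\<close>
      proof (cases "i = n")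
        case True
        then obtain c where c: "z = c \<odot> \<one>" using z(2) connected by auto
        have "counit H z = c"
          unfolding c using linear_form_smult[OF counit_linear, of \<one> c] counit_one by simp
        moreover have "antipode H y \<otimes> z = c \<odot> antipode H y"
          unfolding c using B_closed[OF y(1)] by (simp add: smult_mult_right antipode_closed mult_one)
        ultimately show ?thesis
          using linear_form_smult[OF f antipode_closed[OF B_closed[OF y(1)]]] by simp
      next
        case False
        then have "antipode H y \<in> B" using less.IH[OF _ y] i(1) by simp
        then show ?thesis using fB[of "antipode H y"] fB[OF B_mult[OF _ z(1)]] by simp
      qed
    qed
    have "f (antipode H x) = comult H x (\<lambda>y z. f (antipode H y) * counit H z)"
      by (rule counit_right[OF B_closed[OF x] fS, symmetric])
    also have "\<dots> = (\<Sum>(y, z)\<leftarrow>?qs. f (antipode H y) * counit H z)"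
      by (rule comult_proj[OF x ps_carrier ps(2) bilinear_form_times[OF fS counit_linear]])
    also have "\<dots> = (\<Sum>(y, z)\<leftarrow>?qs. f (antipode H y \<otimes> z))"
      by (rule arg_cong[where f = sum_list], rule map_cong[OF refl]) (use summand in auto)
    also have "\<dots> = comult H x (\<lambda>y z. f (antipode H y \<otimes> z))"
      by (rule comult_proj[OF x ps_carrier ps(2) bilinear_form_antipode(1)[OF f], symmetric])
    also have "\<dots> = 0"
      using antipode_left[OF B_closed[OF x] f] fB[OF B_one] by simp
    finally show "coord (antipode H x) u = coord (antipode H x) v" by (simp add: f_def)
  qed
qed

section \<open>Class sums as a spanning family\<close>

abbreviation P :: "word \<Rightarrow> 'v" where "P u \<equiv> class_sum H C b E u"

lemma finite_class: "finite {w \<in> C. (w, u) \<in> E}"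
  by (rule finite_subset[OF _ finite_C[of "length u"]]) (auto dest: E_length)

lemma P_closed: "P u \<in> carrier H"
  unfolding class_sum_def by (rule finsum_carrier) auto

lemma coord_P: "coord (P u) w = of_bool (w \<in> C \<and> (w, u) \<in> E)"
proof -
  have "coord (P u) w = (\<Sum>v\<in>{w \<in> C. (w, u) \<in> E}. coord (b v) w)"
    unfolding class_sum_def by (rule coord_sum[OF finite_class]) auto
  also have "\<dots> = (\<Sum>v\<in>{w \<in> C. (w, u) \<in> E}. if v = w then 1 else 0)"
    by (intro sum.cong refl) (auto simp: coord_basis)
  finally show ?thesis by (simp add: finite_class)
qed

lemma P_B: "P u \<in> B"
proof (rule B_I[OF P_closed])
  fix w w' assume ww': "(w, w') \<in> E"
  have "(w, u) \<in> E \<longleftrightarrow> (w', u) \<in> E"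
    using E_trans[OF ww'] E_trans[OF E_sym[OF ww']] by blast
  then show "coord (P u) w = coord (P u) w'"
    unfolding coord_P using E_C[OF ww'] by simp
qed

text \<open>The fixed points of \<open>rep\<close> in \<open>C\<close> contain exactly one word of
  each class.\<close>

lemma B_expansion:
  assumes x: "x \<in> B"
  shows "x = (\<Oplus>u\<in>{u. coord x u \<noteq> 0 \<and> rep u = u}. coord x u \<odot> P u)"
proof -
  let ?U = "{u. coord x u \<noteq> 0 \<and> rep u = u}"
  have fin: "finite ?U" by (rule finite_subset[OF _ finite_coord[OF B_closed[OF x]]]) auto
  have UC: "u \<in> C" if "u \<in> ?U" for u
    using coord_outside[OF B_closed[OF x]] that by blast
  have closed: "(\<lambda>u. coord x u \<odot> P u) \<in> ?U \<rightarrow> carrier H" using P_closed by auto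
  show ?thesis
  proof (rule coord_eqI[OF B_closed[OF x]])
    show "(\<Oplus>u\<in>?U. coord x u \<odot> P u) \<in> carrier H" using closed by (rule finsum_carrier)
    show "coord x = coord (\<Oplus>u\<in>?U. coord x u \<odot> P u)"
    proof
      fix w
      have "coord (\<Oplus>u\<in>?U. coord x u \<odot> P u) w = (\<Sum>u\<in>?U. coord x u * of_bool (w \<in> C \<and> (w, u) \<in> E))"
        by (subst coord_sum[OF fin closed]) (simp add: coord_smult P_closed coord_P)
      also have "\<dots> = (\<Sum>u\<in>?U. if u = rep w then of_bool (w \<in> C) * coord x (rep w) else 0)"
      proof (rule sum.cong[OF refl])
        fix u assume u: "u \<in> ?U"
        have "(w, u) \<in> E \<longleftrightarrow> u = rep w" if w: "w \<in> C"
          using rep_eq[OF _ w, of u] u rep_E[OF w] E_sym by auto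
        then show "coord x u * of_bool (w \<in> C \<and> (w, u) \<in> E) =
            (if u = rep w then of_bool (w \<in> C) * coord x (rep w) else 0)"
          by auto
      qed
      also have "\<dots> = coord x w"
      proof (cases "w \<in> C")
        case True
        have "rep (rep w) = rep w" using rep_eq[OF rep_E[OF True]] rep_C True by simp
        then show ?thesis
          using True B_coord[OF x rep_E[OF True]] by (simp add: fin)
      next
        case False
        then show ?thesis using coord_outside[OF B_closed[OF x]] by (simp add: sum.neutral)
      qed
      finally show "coord x w = coord (\<Oplus>u\<in>?U. coord x u \<odot> P u) w" ..
    qed
  qed
qed

lemma P_gr: "P u \<in> gr (length u)"
  unfolding gr_iff using E_length by (auto simp: P_closed coord_P)

text \<open>Every element of \<open>B\<close> is a combination of class sums, which are homogeneous,
  so \<open>B_antipode_gr\<close> suffices.\<close>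

lemma B_antipode:
  assumes x: "x \<in> B"
  shows "antipode H x \<in> B"
proof (rule B_I[OF antipode_closed[OF B_closed[OF x]]])
  fix u v assume uv: "(u, v) \<in> E"
  define f where "f y = coord (antipode H y) u - coord (antipode H y) v" for y
  have f: "linear_form H f"
    unfolding f_def linear_form_def
    by (auto simp: coord_add coord_smult algebra_simps antipode_add antipode_smult antipode_closed)
  have "f (P w) = 0" for w
    unfolding f_def using B_coord[OF B_antipode_gr[OF P_B P_gr] uv] by simp
  then have "f (c \<odot> P w) = 0" for c w
    using linear_form_smult[OF f P_closed] by simp
  moreover have "f x = (\<Sum>u | coord x u \<noteq> 0 \<and> rep u = u. f (coord x u \<odot> P u))"
    by (subst B_expansion[OF x], rule linear_form_finsum[OF f])
      (use finite_coord[OF B_closed[OF x]] P_closed in auto)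
  ultimately show "coord (antipode H x) u = coord (antipode H x) v" by (simp add: f_def)
qed

lemma hopf_subalgebra_B: "hopf_subalgebra H B"
  unfolding hopf_subalgebra_def using B_vsubspace B_one B_mult B_comult B_antipode by blast

lemma vspan_P: "vspan H (P ` C) = B"
proof
  show "vspan H (P ` C) \<subseteq> B"
    unfolding vspan_def using B_vsubspace P_B by blast
  show "B \<subseteq> vspan H (P ` C)"
    unfolding vspan_def
  proof (intro subsetI InterI)
    fix x W assume x: "x \<in> B" and "W \<in> {W. vsubspace W H \<and> P ` C \<subseteq> W}"
    then have W: "vsubspace W H" "P ` C \<subseteq> W" by auto
    have "u \<in> C" if "coord x u \<noteq> 0" for u
      using coord_outside[OF B_closed[OF x]] that by blast
    then show "x \<in> W"
      using W(2) finite_subset[OF _ finite_coord[OF B_closed[OF x]]]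
      by (subst B_expansion[OF x], intro subspace_finsum[OF W(1)]) (auto intro!: submoduleE(4)[OF W(1)])
  qed
qed

end

sublocale shuffle_congruence \<subseteq> R: hopf_retract H gr C b length B proj
  by unfold_locales (auto intro: hopf_subalgebra_B proj_B proj_id proj_add proj_smult proj_gr)

context shuffle_congruence
begin

section \<open>The relations in the graded dual\<close>

lemma dual_basis_eq:
  assumes w: "w \<in> C"
  shows "dual_basis H C b w = dual w"
  unfolding dual_basis_def
proof (rule the_equality)
  show dual: "linear_form H (dual w) \<and> (\<forall>x. x \<notin> carrier H \<longrightarrow> dual w x = 0) \<and>
      (\<forall>j\<in>C. dual w (b j) = (if j = w then 1 else 0))"
    using D_linear[OF dual_closed] by (auto simp: dual_def restr_form_def coord_basis)
  fix f assume f: "linear_form H f \<and> (\<forall>x. x \<notin> carrier H \<longrightarrow> f x = 0) \<and>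
      (\<forall>j\<in>C. f (b j) = (if j = w then 1 else 0))"
  show "f = dual w"
  proof
    fix x
    show "f x = dual w x"
    proof (cases "x \<in> carrier H")
      case True
      show ?thesis
        by (rule linear_form_eqI[OF conjunct1[OF f] conjunct1[OF dual] _ True]) (use f dual in simp)
    next
      case False
      then show ?thesis using f dual by metis
    qed
  qed
qed

lemma D_minus_eval: "g \<in> carrier D \<Longrightarrow> (f \<ominus>\<^bsub>D\<^esub> g) x = f x - g x"
  by (simp add: a_minus_def R.D_minus graded_dual_simps)

lemma dual_diff_K:
  assumes "(w, w') \<in> E"
  shows "dual w \<ominus>\<^bsub>D\<^esub> dual w' \<in> R.K"
  unfolding R.K_def using D.M.minus_closed[OF dual_closed dual_closed, of w w'] assms B_closed B_coord
  by (simp add: D_minus_eval dual_closed) (simp add: dual_def restr_form_def)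

text \<open>The terms with \<^term>\<open>dual (rep w)\<close> add up to the composition of \<^term>\<open>f\<close> with \<^const>\<open>proj\<close>,
  which is 0.\<close>
lemma K_expansion:
  assumes f: "f \<in> R.K"
  obtains N where "f = (\<Oplus>\<^bsub>D\<^esub>w\<in>{w \<in> C. length w \<le> N}. f (b w) \<odot>\<^bsub>D\<^esub> (dual w \<ominus>\<^bsub>D\<^esub> dual (rep w)))"
proof -
  have fD: "f \<in> carrier D" using f by (rule R.K_closed)
  obtain N where N: "\<And>n x. N < n \<Longrightarrow> x \<in> gr n \<Longrightarrow> f x = 0" using D_bounded[OF fD] by blast
  let ?F = "{w \<in> C. length w \<le> N}"
  let ?g = "\<lambda>w. f (b w) \<odot>\<^bsub>D\<^esub> (dual w \<ominus>\<^bsub>D\<^esub> dual (rep w))"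
  have fin: "finite ?F" by (rule finite_deg_le)
  have closed: "?g \<in> ?F \<rightarrow> carrier D"
    by (auto intro!: D_smult_closed D.M.minus_closed dual_closed)
  have expand: "f x = (\<Sum>w\<in>?F. coord x w * f (b w))" if x: "x \<in> carrier H" for x
  proof -
    have "f x = (\<Sum>w | coord x w \<noteq> 0. coord x w * f (b w))"
      by (rule linear_form_expansion[OF D_linear[OF fD] x finite_coord[OF x] coord_support[OF x] order_refl])
    also have "\<dots> = (\<Sum>w\<in>?F. coord x w * f (b w))"
    proof (rule sum.mono_neutral_cong[OF fin finite_coord[OF x]])
      fix w assume "w \<in> {w. coord x w \<noteq> 0} - ?F"
      then have "w \<in> C" "N < length w" using coord_outside[OF x, of w] by auto
      then show "coord x w * f (b w) = 0" using N[OF _ basis_deg] by simp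
    qed auto
    finally show ?thesis .
  qed
  have "f = (\<Oplus>\<^bsub>D\<^esub>w\<in>?F. ?g w)"
  proof (rule D_eqI[OF fD D.finsum_carrier[OF closed]])
    fix x assume x: "x \<in> carrier H"
    have "f (proj x) = 0" using f proj_B[OF x] by (simp add: R.K_def)
    then have "f x = (\<Sum>w\<in>?F. coord x w * f (b w)) - (\<Sum>w\<in>?F. coord (proj x) w * f (b w))"
      using expand[OF x] expand[OF proj_closed[OF x]] by simp
    also have "\<dots> = (\<Sum>w\<in>?F. ?g w x)"
      using x unfolding sum_subtractf[symmetric]
      by (intro sum.cong refl)
        (simp add: graded_dual_simps(5) D_minus_eval dual_closed, simp add: dual_def restr_form_def coord_proj algebra_simps)
    also have "\<dots> = (\<Oplus>\<^bsub>D\<^esub>w\<in>?F. ?g w) x"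
      by (rule D.linear_form_finsum[OF linear_form_eval fin closed, symmetric])
    finally show "f x = (\<Oplus>\<^bsub>D\<^esub>w\<in>?F. ?g w) x" .
  qed
  then show thesis by (rule that)
qed

text \<open>\<open>Idl\<close> generates ideals of the underlying ring. They absorb scalars because
  a scalar acts as multiplication by a multiple of the unit.\<close>

lemma ideal_smult:
  assumes "ideal J D" "g \<in> J"
  shows "c \<odot>\<^bsub>D\<^esub> g \<in> J"
proof -
  interpret ideal J D by fact
  have g: "g \<in> carrier D" using a_subset assms(2) by blast
  have "c \<odot>\<^bsub>D\<^esub> g = (c \<odot>\<^bsub>D\<^esub> \<one>\<^bsub>D\<^esub>) \<otimes>\<^bsub>D\<^esub> g"
    using D_smult_mult(1)[OF D_one_closed g] monoid.l_one[OF ring.axioms(2)[OF ring_D] g] by simp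
  then show ?thesis
    using I_l_closed[OF assms(2) D_smult_closed[OF D_one_closed]] by simp
qed

lemma ideal_vsubspace:
  assumes J: "ideal J D"
  shows "vsubspace J D"
proof -
  interpret ideal J D by fact
  show ?thesis
    by (rule D.submoduleI) (use a_subset ideal_smult[OF J] in \<open>auto intro: a_inv_closed a_closed\<close>)
qed

text \<open>The annihilator of \<open>B\<close> is an ideal that contains the generators. By
  \<open>K_expansion\<close> its elements are linear combinations of generators, hence lie in every
  ideal that contains them.\<close>

lemma genideal_eq_K:
  "Idl\<^bsub>D\<^esub> {dual_basis H C b w \<ominus>\<^bsub>D\<^esub> dual_basis H C b w' | w w'. w \<in> C \<and> w' \<in> C \<and> (w, w') \<in> E} = R.K"
    (is "Idl\<^bsub>D\<^esub> ?G = _")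
proof
  have "?G \<subseteq> R.K" using dual_diff_K by (auto simp: dual_basis_eq)
  then show "Idl\<^bsub>D\<^esub> ?G \<subseteq> R.K"
    unfolding genideal_def using R.ideal_K by blast
  show "R.K \<subseteq> Idl\<^bsub>D\<^esub> ?G"
    unfolding genideal_def
  proof (intro subsetI InterI)
    fix f J assume f: "f \<in> R.K" and "J \<in> {J. ideal J D \<and> ?G \<subseteq> J}"
    then have J: "ideal J D" "?G \<subseteq> J" by auto
    obtain N where N: "f = (\<Oplus>\<^bsub>D\<^esub>w\<in>{w \<in> C. length w \<le> N}. f (b w) \<odot>\<^bsub>D\<^esub> (dual w \<ominus>\<^bsub>D\<^esub> dual (rep w)))"
      by (rule K_expansion[OF f])
    have gen: "dual w \<ominus>\<^bsub>D\<^esub> dual (rep w) \<in> J" if w: "w \<in> C" for w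
    proof -
      have "dual_basis H C b w \<ominus>\<^bsub>D\<^esub> dual_basis H C b (rep w) \<in> ?G"
        using w rep_C[of w] E_sym[OF rep_E[OF w]] by blast
      then show ?thesis using J(2) w by (auto simp: dual_basis_eq rep_C)
    qed
    show "f \<in> J"
      by (subst N, rule D.subspace_finsum[OF ideal_vsubspace[OF J(1)] finite_deg_le])
        (auto intro: ideal_smult[OF J(1)] gen)
  qed
qed

text \<open>Class sums detect the congruence: for an index word \<open>v\<close>, the value of
  \<open>dual v\<close> at \<open>P w\<close> is 1 or 0 according to whether \<open>v\<close> is
  equivalent to \<open>w\<close>.\<close>

lemma coset_dual_eq_iff:
  assumes w: "w \<in> C" and w': "w' \<in> C"
  shows "R.K +>\<^bsub>D\<^esub> dual_basis H C b w = R.K +>\<^bsub>D\<^esub> dual_basis H C b w' \<longleftrightarrow> (w, w') \<in> E"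
  unfolding dual_basis_eq[OF w] dual_basis_eq[OF w'] R.coset_eq_iff[OF dual_closed dual_closed]
proof
  assume eq: "restr_form B (dual w) = restr_form B (dual w')"
  have "restr_form B (dual v) (P w) = coord (P w) v" for v
    using P_B P_closed by (simp add: restr_form_def dual_def)
  then have "coord (P w) w = coord (P w) w'"
    using fun_cong[OF eq, of "P w"] by simp
  then show "(w, w') \<in> E"
    using w w' E_refl[OF C_words[OF w]] by (auto simp: coord_P E_sym split: if_splits)
next
  assume E: "(w, w') \<in> E"
  show "restr_form B (dual w) = restr_form B (dual w')"
    using B_coord[OF _ E] B_closed by (auto simp: restr_form_def dual_def)
qed

end

theorem theorem2p1:
  fixes H :: "('k::field_char_0, 'v) hopf"
    and gr :: "nat \<Rightarrow> 'v set"
    and C :: "word set"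
    and b :: "word \<Rightarrow> 'v"
    and a :: "word \<Rightarrow> word"
    and E :: "(word \<times> word) set"
  assumes "shuffle_like_hopf_algebra H gr C b a"
    and "congruence E"
    and "\<forall>u\<in>words. \<forall>v\<in>words. (u, v) \<in> E \<longleftrightarrow> ev u = ev v \<and> (pack u, pack v) \<in> E"
    and "\<forall>u v I. interval I \<longrightarrow> (u, v) \<in> E \<longrightarrow> (restr_word u I, restr_word v I) \<in> E"
  shows "let B = vspan H (class_sum H C b E ` C);
             Hd = graded_dual H gr;
             Bd = graded_dual (sub_hopf H B) (\<lambda>n. B \<inter> gr n);
             bd = dual_basis H C b;
             J = Idl\<^bsub>Hd\<^esub> {bd w \<ominus>\<^bsub>Hd\<^esub> bd w' | w w'. w \<in> C \<and> w' \<in> C \<and> (w, w') \<in> E}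
         in hopf_subalgebra H B \<and>
            (\<exists>\<phi>. hopf_iso (quot_hopf Hd J) Bd \<phi> \<and>
                 (\<forall>f \<in> carrier Hd. \<phi> (J +>\<^bsub>Hd\<^esub> f) = restr_form B f)) \<and>
            (\<forall>w\<in>C. \<forall>w'\<in>C. J +>\<^bsub>Hd\<^esub> bd w = J +>\<^bsub>Hd\<^esub> bd w' \<longleftrightarrow> (w, w') \<in> E)"
proof -
  interpret shuffle_congruence H gr C b a E
    using assms
    by (intro shuffle_congruence.intro shuffle_like_char0.intro shuffle_congruence_axioms.intro) blast+
  show ?thesis
    unfolding Let_def vspan_P genideal_eq_K
    using hopf_subalgebra_B R.hopf_iso_quot coset_dual_eq_iff by blast
qed

end
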